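(* Let $\mathfrak g$ be of type $G_2$ or of type $B_n$ ($n\ge2$). (a) The subalgebra $\dot{\mathbf Y}^>_\hbar(\mathfrak g)\subset Y^>_\hbar(\mathfrak g)$ is independent of the choice of the root vectors $\mathsf X_{\beta,s}$ (i.e. of the decompositions $s=s_1+\dots+s_\ell$) used to define it. (b) For any choices of $s_k$ in the definition of the root vectors, the ordered monomials $\{\bar{\mathsf X}_h\}_{h\in\mathsf H}$ form a basis of the free $\mathbb Q[\hbar]$-module $\dot{\mathbf Y}^>_\hbar(\mathfrak g)$.
   Context: Conventions. $\mathbb N=\{0,1,2,\dots\}$. Type $G_2$: $I=\{1,2\}$, $(\alpha_1,\alpha_1)=6$, $(\alpha_2,\alpha_2)=2$, $(\alpha_1,\alpha_2)=-3$. Type $B_n$: $I=\{1,\dots,n\}$, $(\alpha_i,\alpha_i)=4$ for $i<n$, $(\alpha_n,\alpha_n)=2$, $(\alpha_i,\alpha_{i+1})=-2$, other pairings $0$. $d_i=(\alpha_i,\alpha_i)/2$, $a_{ij}=(\alpha_i,\alpha_j)/d_i$. Yangian. $Y^>_\hbar(\mathfrak g)$ is the $\mathbb Q[\hbar]$-algebra generated by $\mathsf x_{i,r}$ ($i\in I$, $r\in\mathbb N$) with relations $[\mathsf x_{i,r+1},\mathsf x_{j,s}]-[\mathsf x_{i,r},\mathsf x_{j,s+1}]=\frac{d_ia_{ij}\hbar}{2}(\mathsf x_{i,r}\mathsf x_{j,s}+\mathsf x_{j,s}\mathsf x_{i,r})$ for all $i,j,r,s$, and $\sum_{\sigma\in\mathfrak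 S_{1-a_{ij}}}[\mathsf x_{i,s_{\sigma(1)}},[\mathsf x_{i,s_{\sigma(2)}},\cdots,[\mathsf x_{i,s_{\sigma(1-a_{ij})}},\mathsf x_{j,r}]\cdots]]=0$ for $i\ne j$ and all $s_1,\dots,s_{1-a_{ij}},r\in\mathbb N$. Roots. A word $[i_1,\dots,i_\ell]$ denotes the root $\alpha_{i_1}+\dots+\alpha_{i_\ell}$. $G_2$: $\Delta^+$ ordered by $[1]<[1,2]<[1,2,1,2,2]<[1,2,2]<[1,2,2,2]<[2]$. $B_n$: $\Delta^+$ consists of $[i,j]:=[i,i+1,\dots,j]$ ($1\le i\le j\le n$) and $[i,n,j]:=[i,\dots,n,n,n-1,\dots,j]$ ($1\le i<j\le n$), ordered by $[1]<[1,2]<\dots<[1,n]<[1,n,n]<[1,n,n-1]<\dots<[1,n,2]<[2]<\dots<[n-1]<[n-1,n]<[n-1,n,n]<[n]$. Root vectors. For $(\beta,s)\in\Delta^+\times\mathbb N$, let $[i_1,\dots,i_\ell]$ be the word representing $\beta$, namely one of $[1],[1,2],[1,2,1,2,2],[1,2,2],[1,2,2,2],[2]$ in type $G_2$, and one of $[i,i+1,\dots,j]$ ($1\le i\le j\le n$) or $[i,\dots,n,n,n-1,\dots,j]$ ($1\le i<j\le n$) in type $B_n$; choose $s=s_1+\dots+s_\ell$ with $s_k\in\mathbb N$ and set $\mathsf X_{\beta,s}=[\cdots[[\mathsf x_{i_1,s_1},\mathsf x_{i_2,s_2}],\mathsf x_{i_3,s_3}],\cdots,\mathsf x_{i_\ell,s_\ell}]$,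 except for $\beta=[1,2,1,2,2]$ in type $G_2$, where $\mathsf X_{\beta,s}=[[\mathsf x_{1,s_1},\mathsf x_{2,s_2}],[[\mathsf x_{1,s_3},\mathsf x_{2,s_4}],\mathsf x_{2,s_5}]]$. Drinfeld–Gavarini dual. $\bar{\mathsf X}_{\beta,s}=\hbar\,\mathsf X_{\beta,s}$, and $\dot{\mathbf Y}^>_\hbar(\mathfrak g)$ is the $\mathbb Q[\hbar]$-subalgebra of $Y^>_\hbar(\mathfrak g)$ generated by $\{\bar{\mathsf X}_{\beta,s}\}_{\beta\in\Delta^+}^{s\in\mathbb N}$. $\mathsf H$ is the set of finitely supported $h\colon\Delta^+\times\mathbb N\to\mathbb N$; $\bar{\mathsf X}_h=\prod^\to_{(\beta,s)}\bar{\mathsf X}_{\beta,s}^{h(\beta,s)}$, product in increasing order for: $(\alpha,s)<(\beta,t)$ iff $\alpha<\beta$, or $\alpha=\beta$ and $s<t$. *)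

theory Defs
  imports
    "HOL-Library.Poly_Mapping"
    "HOL-Computational_Algebra.Polynomial"
    "HOL-Combinatorics.Permutations"
    "HOL-Algebra.QuotRing"
    "HOL-Algebra.Module"
    "HOL-Algebra.Subrings"
begin

section \<open>Cartan data\<close>

datatype cartan_type = G2 | B nat

fun index_set :: "cartan_type \<Rightarrow> nat set" where
  "index_set G2 = {1, 2}"
| "index_set (B n) = {1..n}"

fun root_pairing :: "cartan_type \<Rightarrow> nat \<Rightarrow> nat \<Rightarrow> int" where
  "root_pairing G2 i j = (if i = j then (if i = 1 then 6 else 2) else - 3)"
| "root_pairing (B n) i j =
    (if i = j then (if i < n then 4 else 2)
     else if j = Suc i \<or> i = Suc j then - 2
     else 0)"

text \<open>Both integer divisions are exact for indices in \<open>index_set T\<close> (for \<open>B n\<close>, \<open>n \<ge> 2\<close>).\<close>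

definition sym_d :: "cartan_type \<Rightarrow> nat \<Rightarrow> int" where
  "sym_d T i = root_pairing T i i div 2"

definition cartan_a :: "cartan_type \<Rightarrow> nat \<Rightarrow> nat \<Rightarrow> int" where
  "cartan_a T i j = root_pairing T i j div sym_d T i"

section \<open>The free algebra over \<open>\<rat>[\<hbar>]\<close>\<close>

text \<open>
  The base ring \<open>\<rat>[\<hbar>]\<close> is \<open>rat poly\<close>, with \<open>\<hbar> = [:0, 1:]\<close>. The free algebra is the monoid
  algebra of the free monoid of words; the wrapper type makes concatenation the monoid
  operation \<open>+\<close>, as the convolution product of \<^theory>\<open>HOL-Library.Poly_Mapping\<close> requires.
\<close>

datatype 'a word = Word "'a list"

instantiation word :: (type) monoid_add
begin

fun plus_word :: "'a word \<Rightarrow> 'a word \<Rightarrow> 'a word" where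
  "Word u + Word v = Word (u @ v)"

definition zero_word :: "'a word" where
  "0 = Word []"

instance
proof
  fix a b c :: "'a word"
  show "a + b + c = a + (b + c)"
    by (cases a; cases b; cases c) simp
  show "0 + a = a" "a + 0 = a"
    by (cases a; simp add: zero_word_def)+
qed

end

text \<open>The pair \<open>(i, r)\<close> is the index of the generator \<open>x\<^bsub>i,r\<^esub>\<close>.\<close>

type_synonym free_elem = "(nat \<times> nat) word \<Rightarrow>\<^sub>0 rat poly"

definition univ_ring :: "'a::ring_1 ring" where
  "univ_ring = \<lparr>carrier = UNIV, mult = (*), one = 1, zero = 0, add = (+)\<rparr>"

abbreviation Q_hbar :: "rat poly ring" where
  "Q_hbar \<equiv> univ_ring"

definition hbar :: "rat poly" where
  "hbar = [:0, 1:]"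

definition free_alg :: "nat set \<Rightarrow> free_elem ring" where
  "free_alg I = univ_ring
    \<lparr>carrier := {f. Poly_Mapping.keys f \<subseteq> Word ` lists (I \<times> UNIV)}\<rparr>"

definition scal :: "rat poly \<Rightarrow> free_elem" where
  "scal c = Poly_Mapping.single 0 c"

definition gen :: "nat \<Rightarrow> nat \<Rightarrow> free_elem" where
  "gen i r = Poly_Mapping.single (Word [(i, r)]) 1"

definition commutator :: "'a::ring_1 \<Rightarrow> 'a \<Rightarrow> 'a" where
  "commutator x y = x * y - y * x"

section \<open>The Yangian\<close>

text \<open>An element \<open>f\<close> of \<open>yangian_relators T\<close> stands for the relation \<open>f = 0\<close>.\<close>

definition quadratic_relator ::
  "cartan_type \<Rightarrow> nat \<Rightarrow> nat \<Rightarrow> nat \<Rightarrow> nat \<Rightarrow> free_elem" where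
  "quadratic_relator T i j r s =
    commutator (gen i (Suc r)) (gen j s) - commutator (gen i r) (gen j (Suc s))
    - scal ([:of_int (sym_d T i * cartan_a T i j) / 2:] * hbar)
      * (gen i r * gen j s + gen j s * gen i r)"

text \<open>The positions \<open>1, \<dots>, 1 - a\<^bsub>ij\<^esub>\<close> are shifted to \<open>0, \<dots>, m - 1\<close>; only the values of
  \<open>s\<close> there matter.\<close>

definition serre_relator ::
  "cartan_type \<Rightarrow> nat \<Rightarrow> nat \<Rightarrow> (nat \<Rightarrow> nat) \<Rightarrow> nat \<Rightarrow> free_elem" where
  "serre_relator T i j s r =
    (let m = nat (1 - cartan_a T i j) in
      \<Sum>\<sigma> | \<sigma> permutes {..<m}.
        foldr (\<lambda>k. commutator (gen i (s (\<sigma> k)))) [0..<m] (gen j r))"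

definition yangian_relators :: "cartan_type \<Rightarrow> free_elem set" where
  "yangian_relators T =
    {quadratic_relator T i j r s | i j r s. i \<in> index_set T \<and> j \<in> index_set T} \<union>
    {serre_relator T i j s r | i j s r. i \<in> index_set T \<and> j \<in> index_set T \<and> i \<noteq> j}"

definition yangian_ideal :: "cartan_type \<Rightarrow> free_elem set" where
  "yangian_ideal T = Idl\<^bsub>free_alg (index_set T)\<^esub> (yangian_relators T)"

definition proj :: "cartan_type \<Rightarrow> free_elem \<Rightarrow> free_elem set" where
  "proj T f = yangian_ideal T +>\<^bsub>free_alg (index_set T)\<^esub> f"

text \<open>The quotient ring, with scalars acting through the image of \<open>\<rat>[\<hbar>]\<close>.\<close>

definition yangian :: "cartan_type \<Rightarrow> (rat poly, free_elem set) module" where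
  "yangian T =
    (let Q = free_alg (index_set T) Quot yangian_ideal T in
      \<lparr>carrier = carrier Q, mult = mult Q, one = one Q, zero = zero Q, add = add Q,
       smult = (\<lambda>c X. proj T (scal c) \<otimes>\<^bsub>Q\<^esub> X)\<rparr>)"

definition yangian_gen :: "cartan_type \<Rightarrow> nat \<Rightarrow> nat \<Rightarrow> free_elem set" where
  "yangian_gen T i r = proj T (gen i r)"

section \<open>Positive roots and root vectors\<close>

text \<open>
  A positive root is represented by its word. The list is in increasing order; for \<open>B n\<close>,
  \<open>[i..<Suc j]\<close> is \<open>[i,j]\<close> and \<open>[i..<Suc n] @ rev [j..<Suc n]\<close> is \<open>[i,n,j]\<close>.
\<close>

fun pos_roots :: "cartan_type \<Rightarrow> nat list list" where
  "pos_roots G2 = [[1], [1,2], [1,2,1,2,2], [1,2,2], [1,2,2,2], [2]]"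
| "pos_roots (B n) =
    concat (map (\<lambda>i.
        map (\<lambda>j. [i..<Suc j]) [i..<Suc n] @
        map (\<lambda>j. [i..<Suc n] @ rev [j..<Suc n]) (rev [Suc i..<Suc n]))
      [1..<Suc n])"

definition lie :: "('a, 'b) ring_scheme \<Rightarrow> 'a \<Rightarrow> 'a \<Rightarrow> 'a" where
  "lie R x y = x \<otimes>\<^bsub>R\<^esub> y \<ominus>\<^bsub>R\<^esub> y \<otimes>\<^bsub>R\<^esub> x"

text \<open>\<open>left_nested R [x\<^sub>1, \<dots>, x\<^sub>l]\<close> is \<open>[\<dots>[[x\<^sub>1, x\<^sub>2], x\<^sub>3], \<dots>, x\<^sub>l]\<close>, for \<open>l \<ge> 1\<close>.\<close>

definition left_nested :: "('a, 'b) ring_scheme \<Rightarrow> 'a list \<Rightarrow> 'a" where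
  "left_nested R xs = foldl (lie R) (hd xs) (tl xs)"

text \<open>A choice of a decomposition \<open>s = s\<^sub>1 + \<dots> + s\<^sub>l\<close> for every \<open>(\<beta>, s)\<close>.\<close>

definition decomposition :: "cartan_type \<Rightarrow> (nat list \<Rightarrow> nat \<Rightarrow> nat list) \<Rightarrow> bool" where
  "decomposition T \<delta> \<longleftrightarrow>
    (\<forall>\<beta> \<in> set (pos_roots T). \<forall>s. length (\<delta> \<beta> s) = length \<beta> \<and> sum_list (\<delta> \<beta> s) = s)"

definition root_vector ::
  "cartan_type \<Rightarrow> (nat list \<Rightarrow> nat \<Rightarrow> nat list) \<Rightarrow> nat list \<times> nat \<Rightarrow> free_elem set" where
  "root_vector T \<delta> = (\<lambda>(\<beta>, s).
    let xs = map2 (yangian_gen T) \<beta> (\<delta> \<beta> s); Y = yangian T in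
    if T = G2 \<and> \<beta> = [1,2,1,2,2]
    then lie Y (lie Y (xs ! 0) (xs ! 1)) (lie Y (lie Y (xs ! 2) (xs ! 3)) (xs ! 4))
    else left_nested Y xs)"

definition bar_root_vector ::
  "cartan_type \<Rightarrow> (nat list \<Rightarrow> nat \<Rightarrow> nat list) \<Rightarrow> nat list \<times> nat \<Rightarrow> free_elem set" where
  "bar_root_vector T \<delta> p = hbar \<odot>\<^bsub>yangian T\<^esub> root_vector T \<delta> p"

section \<open>The Drinfeld--Gavarini dual\<close>

definition generated_subalgebra ::
  "('r, 'c) ring_scheme \<Rightarrow> ('r, 'a, 'd) module_scheme \<Rightarrow> 'a set \<Rightarrow> 'a set" where
  "generated_subalgebra R A G = \<Inter> {S. subring S A \<and> submodule S R A \<and> G \<subseteq> S}"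

definition dg_dual ::
  "cartan_type \<Rightarrow> (nat list \<Rightarrow> nat \<Rightarrow> nat list) \<Rightarrow> free_elem set set" where
  "dg_dual T \<delta> = generated_subalgebra Q_hbar (yangian T)
    (bar_root_vector T \<delta> ` (set (pos_roots T) \<times> UNIV))"

definition exponents :: "cartan_type \<Rightarrow> (nat list \<times> nat \<Rightarrow> nat) set" where
  "exponents T = {h. finite {p. h p \<noteq> 0} \<and> {p. h p \<noteq> 0} \<subseteq> set (pos_roots T) \<times> UNIV}"

definition ordered_support ::
  "cartan_type \<Rightarrow> (nat list \<times> nat \<Rightarrow> nat) \<Rightarrow> (nat list \<times> nat) list" where
  "ordered_support T h =
    concat (map (\<lambda>\<beta>. map (Pair \<beta>) (sorted_list_of_set {s. h (\<beta>, s) \<noteq> 0})) (pos_roots T))"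

definition ordered_monomial ::
  "cartan_type \<Rightarrow> (nat list \<Rightarrow> nat \<Rightarrow> nat list) \<Rightarrow> (nat list \<times> nat \<Rightarrow> nat) \<Rightarrow> free_elem set" where
  "ordered_monomial T \<delta> h =
    foldr (\<lambda>p z. (bar_root_vector T \<delta> p [^]\<^bsub>yangian T\<^esub> h p) \<otimes>\<^bsub>yangian T\<^esub> z)
      (ordered_support T h) \<one>\<^bsub>yangian T\<^esub>"

text \<open>A basis as an indexed family; in particular the members are pairwise distinct.\<close>

definition module_basis ::
  "('r, 'c) ring_scheme \<Rightarrow> ('r, 'a, 'd) module_scheme \<Rightarrow> ('h \<Rightarrow> 'a) \<Rightarrow> 'h set \<Rightarrow> bool" where
  "module_basis R M b H \<longleftrightarrow>
    module R M \<and> b \<in> H \<rightarrow> carrier M \<and>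
    (\<forall>x \<in> carrier M. \<exists>S c. finite S \<and> S \<subseteq> H \<and> c \<in> S \<rightarrow> carrier R \<and>
      x = (\<Oplus>\<^bsub>M\<^esub> h \<in> S. c h \<odot>\<^bsub>M\<^esub> b h)) \<and>
    (\<forall>S c. finite S \<and> S \<subseteq> H \<and> c \<in> S \<rightarrow> carrier R \<and>
      (\<Oplus>\<^bsub>M\<^esub> h \<in> S. c h \<odot>\<^bsub>M\<^esub> b h) = \<zero>\<^bsub>M\<^esub> \<longrightarrow> (\<forall>h \<in> S. c h = \<zero>\<^bsub>R\<^esub>))"

end

theory Submission
  imports Defs
begin

text \<open>Spanning. Up to terms \<open>\<hbar>\<^sup>b\<close> times a product of at most \<open>b + 1\<close> Lie words, with \<open>b \<ge> 1\<close>, every Lie word in the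
  generators is a rational combination of root vectors of the same loop degree: modulo such terms the loop
  degree can be moved freely between letters, so a finite table of brackets of root words with simple letters
  suffices. Hence the ordered monomials span the algebra generated by \<open>\<hbar>\<close> times all Lie words. This algebra
  contains the dual, and knows nothing about the decompositions.

  Independence. For real \<open>\<eta>\<close> in place of \<open>\<hbar>\<close> the Yangian maps to the functions on the subsets of a finite set of
  coloured points of the line, with a twisted shuffle product. The points are grouped in chains, one for each
  factor of a longest monomial of lowest order in \<open>\<hbar>\<close>; a chain carries a word of the root and its points are
  at distance \<open>O(\<eta>)\<close>, with the twist inside a chain independent of \<open>\<eta>\<close>. As \<open>\<eta>\<close> tends to \<open>0\<close> distinct chains
  stop interacting and root vectors are supported on single chains, so a monomial becomes a sum over
  assignments of its factors to the chains. With chain \<open>a\<close> at \<open>\<tau>\<close> to the power \<open>D\<^sup>a\<close>, the loop degrees are read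
  off as base \<open>D\<close> digits of the exponents of \<open>\<tau>\<close>.\<close>

section \<open>Lie algebras of loops modulo a filtration\<close>

text \<open>At points a fixed distance apart the twist tends to 1 as \<eta> tends to 0, so the
  limiting product is commutative and kills every commutator. Root vectors survive only on points at
  distance of order \<eta>. The chains are spaced so that the twist of a point against its successor
  is 0, which makes nested commutators computable. Only a homomorphism out of the Yangian is wanted,
  not a description of its image. So symmetric rational functions are replaced by their values on
  the subsets of one fixed set of points, the twist between points of different colours may be any
  convenient solution of the exchange relation, and the Serre relations are checked by partial
  fractions for all such solutions at once. Three invariants separate the monomials: the number of
  factors, as a root vector cannot straddle two chains; the roots, as distinct positive roots have
  distinct multisets of letters; and the loop degrees. In the spanning half one divides by positive
  integers only, for antisymmetry and for Serre strings. Never dividing by \<open>hbar\<close> is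
  what makes the result hold over Q[hbar].\<close>

lemma jacobi: "commutator (commutator a b) c = commutator (commutator a c) b + commutator a (commutator b c)"
  for a :: "'a::ring_1"
  by (simp add: commutator_def algebra_simps)

lemma commutator_antisym: "commutator a b = - commutator b a" for a :: "'a::ring_1"
  by (simp add: commutator_def)

lemma commutator_simps:
  fixes a :: "'a::ring_1"
  shows "commutator (a + b) c = commutator a c + commutator b c"
    "commutator (a - b) c = commutator a c - commutator b c"
    "commutator (- a) c = - commutator a c" "commutator 0 c = 0"
    "commutator c (a + b) = commutator c a + commutator c b"
    "commutator c (a - b) = commutator c a - commutator c b"
    "commutator c (- a) = - commutator c a" "commutator c 0 = 0"
  by (simp_all add: commutator_def algebra_simps)

text \<open>\<open>L d\<close> plays the role of the Lie elements of loop degree \<open>d\<close>, \<open>Z d\<close> that of the negligible elements of degree \<open>d\<close>.\<close>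

locale loop_lie =
  fixes Z :: "nat \<Rightarrow> 'a::ring_1 set" and L :: "nat \<Rightarrow> 'a set"
    and x :: "nat \<Rightarrow> nat \<Rightarrow> 'a" and I :: "nat set"
  assumes Z_0: "0 \<in> Z d"
    and Z_add: "a \<in> Z d \<Longrightarrow> b \<in> Z d \<Longrightarrow> a + b \<in> Z d"
    and Z_uminus: "a \<in> Z d \<Longrightarrow> - a \<in> Z d"
    and Z_div: "of_nat (Suc k) * a \<in> Z d \<Longrightarrow> a \<in> Z d"
    and Z_br: "a \<in> Z d \<Longrightarrow> b \<in> L e \<Longrightarrow> commutator a b \<in> Z (d + e)"
    and L_0: "0 \<in> L d"
    and L_uminus: "a \<in> L d \<Longrightarrow> - a \<in> L d"
    and L_br: "a \<in> L d \<Longrightarrow> b \<in> L e \<Longrightarrow> commutator a b \<in> L (d + e)"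
    and L_x: "i \<in> I \<Longrightarrow> x i r \<in> L r"
    and x_quad: "i \<in> I \<Longrightarrow> j \<in> I \<Longrightarrow>
      commutator (x i (Suc r)) (x j s) - commutator (x i r) (x j (Suc s)) \<in> Z (Suc (r + s))"
begin

abbreviation C :: "'a \<Rightarrow> 'a \<Rightarrow> 'a" where "C \<equiv> commutator"

lemma Z_diff: "a \<in> Z d \<Longrightarrow> b \<in> Z d \<Longrightarrow> a - b \<in> Z d"
  using Z_add[of a d "- b"] Z_uminus by simp

lemma Z_br': "a \<in> Z d \<Longrightarrow> b \<in> L e \<Longrightarrow> C b a \<in> Z (d + e)"
  using Z_uminus[OF Z_br[of a d b e]] commutator_antisym[of b a] by simp

lemma Z_double: "a + a \<in> Z d \<Longrightarrow> a \<in> Z d"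
  using Z_div[of 1 a d] by (simp add: mult_2)

definition eqv :: "nat \<Rightarrow> 'a \<Rightarrow> 'a \<Rightarrow> bool" where
  "eqv d a b \<longleftrightarrow> a - b \<in> Z d"

lemma eqv_refl [simp]: "eqv d a a" by (simp add: eqv_def Z_0)

lemma eqv_sym: "eqv d a b \<Longrightarrow> eqv d b a"
  using Z_uminus[of "a - b" d] by (simp add: eqv_def)

lemma eqv_trans [trans]: "eqv d a b \<Longrightarrow> eqv d b c \<Longrightarrow> eqv d a c"
  using Z_add[of "a - b" d "b - c"] by (simp add: eqv_def)

lemma eqv_add: "eqv d a b \<Longrightarrow> eqv d a' b' \<Longrightarrow> eqv d (a + a') (b + b')"
  using Z_add[of "a - b" d "a' - b'"] by (simp add: eqv_def algebra_simps)

lemma eqv_uminus: "eqv d a b \<Longrightarrow> eqv d (- a) (- b)"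
  using Z_uminus[of "a - b" d] by (simp add: eqv_def)

lemma eqv_diff: "eqv d a b \<Longrightarrow> eqv d a' b' \<Longrightarrow> eqv d (a - a') (b - b')"
  using eqv_add[OF _ eqv_uminus, of d a b a' b'] by simp

lemma eqv_0: "eqv d a 0 \<longleftrightarrow> a \<in> Z d" by (simp add: eqv_def)

lemma eqv_C: "eqv d a b \<Longrightarrow> c \<in> L e \<Longrightarrow> eqv (d + e) (C a c) (C b c)"
  using Z_br[of "a - b" d c e] by (simp add: eqv_def commutator_simps)

lemma eqv_C': "eqv d a b \<Longrightarrow> c \<in> L e \<Longrightarrow> eqv (d + e) (C c a) (C c b)"
  using Z_br'[of "a - b" d c e] by (simp add: eqv_def commutator_simps)

lemma x_shift:
  assumes "i \<in> I" "j \<in> I"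
  shows "eqv (r + m + s) (C (x i (r + m)) (x j s)) (C (x i r) (x j (s + m)))"
proof (induction m arbitrary: s)
  case (Suc m)
  have "eqv (r + Suc m + s) (C (x i (r + Suc m)) (x j s)) (C (x i (r + m)) (x j (Suc s)))"
    using x_quad[OF assms, of "r + m" s] by (simp add: eqv_def)
  also have "eqv (r + Suc m + s) (C (x i (r + m)) (x j (Suc s))) (C (x i r) (x j (s + Suc m)))"
    using Suc[of "Suc s"] by simp
  finally show ?case .
qed simp

text \<open>Right bracketing with \<open>x\<^sub>k\<close>, when modulo \<open>Z\<close> only the total loop degree matters.\<close>

definition br :: "(nat \<Rightarrow> 'a) \<Rightarrow> nat \<Rightarrow> (nat \<Rightarrow> 'a) \<Rightarrow> bool" where
  "br X k Y \<longleftrightarrow> k \<in> I \<and> (\<forall>s. X s \<in> L s \<and> Y s \<in> L s) \<and>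
    (\<forall>s r. eqv (s + r) (C (X s) (x k r)) (Y (s + r)))"

text \<open>The test with the zero mode alone. It does not make the bracket independent of how the
  degree is split, but once some \<open>br X k Y\<close> is known it suffices to identify the result
  (\<open>br_replace\<close>).\<close>

definition br0 :: "(nat \<Rightarrow> 'a) \<Rightarrow> nat \<Rightarrow> (nat \<Rightarrow> 'a) \<Rightarrow> bool" where
  "br0 X k Y \<longleftrightarrow> (\<forall>s. Y s \<in> L s \<and> eqv s (C (X s) (x k 0)) (Y s))"

abbreviation zs :: "nat \<Rightarrow> 'a" where "zs \<equiv> \<lambda>_. 0"
abbreviation ns :: "(nat \<Rightarrow> 'a) \<Rightarrow> nat \<Rightarrow> 'a" where "ns X \<equiv> \<lambda>s. - X s"
abbreviation ap :: "(nat \<Rightarrow> 'a) \<Rightarrow> nat \<Rightarrow> nat \<Rightarrow> 'a" where "ap X k \<equiv> \<lambda>s. C (X s) (x k 0)"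

lemma brD: "br X k Y \<Longrightarrow> eqv (s + r) (C (X s) (x k r)) (Y (s + r))"
  "br X k Y \<Longrightarrow> k \<in> I" "br X k Y \<Longrightarrow> X s \<in> L s" "br X k Y \<Longrightarrow> Y s \<in> L s"
  by (auto simp: br_def)

lemma br_br0: "br X k Y \<Longrightarrow> br0 X k Y"
  unfolding br0_def using brD(1)[of X k Y _ 0] brD(4)[of X k Y] by auto

lemma br0_ap: "k \<in> I \<Longrightarrow> (\<And>s. X s \<in> L s) \<Longrightarrow> br0 X k (ap X k)"
  unfolding br0_def using L_br[OF _ L_x[of k 0]] by fastforce

lemma br0_zs: "br0 zs k zs"
  by (simp add: br0_def commutator_simps L_0)

lemma br0_ns: "br0 X k Y \<Longrightarrow> br0 (ns X) k (ns Y)"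
  by (auto simp: br0_def commutator_simps L_uminus eqv_uminus)

lemma br_ns: "br X k Y \<Longrightarrow> br (ns X) k (ns Y)"
  by (auto simp: br_def commutator_simps L_uminus eqv_uminus)

lemma br_ns_zs: "br (ns X) k zs \<longleftrightarrow> br X k zs"
  using br_ns[of X k zs] br_ns[of "ns X" k zs] by auto

lemma br_replace: "br X k Y \<Longrightarrow> br0 X k W \<Longrightarrow> br X k W"
proof -
  assume b: "br X k Y" and w: "br0 X k W"
  have "eqv s (Y s) (W s)" for s
    using eqv_trans[OF eqv_sym[OF brD(1)[OF b, of s 0]], of "W s"] w by (simp add: br0_def)
  then show "br X k W"
    using b w unfolding br_def br0_def by (meson eqv_trans)
qed

text \<open>By Jacobi, bracketing with two letters that commute modulo \<open>Z\<close> gives the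
  same result in either order. So three sides of the square formed by \<open>X\<close>,
  \<open>Y\<close>, \<open>V\<close>, \<open>W\<close> determine the fourth.\<close>

lemma br_exchange:
  assumes "br X k Y" "br X l V" "br0 V k W" "br (x k) l zs"
  shows "br Y l W"
  unfolding br_def
proof (intro conjI allI)
  fix s r
  note k = brD(2)[OF assms(1)] and l = brD(2)[OF assms(2)]
  have "eqv s (Y s) (C (X s) (x k 0))" using eqv_sym[OF brD(1)[OF assms(1), of s 0]] by simp
  then have "eqv (s + r) (C (Y s) (x l r)) (C (C (X s) (x k 0)) (x l r))"
    using eqv_C[OF _ L_x[OF l]] by blast
  also have "C (C (X s) (x k 0)) (x l r) = C (C (X s) (x l r)) (x k 0) + C (X s) (C (x k 0) (x l r))"
    by (rule jacobi)
  also have "eqv (s + r) \<dots> (C (V (s + r)) (x k 0) + 0)"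
  proof (rule eqv_add)
    show "eqv (s + r) (C (C (X s) (x l r)) (x k 0)) (C (V (s + r)) (x k 0))"
      using eqv_C[OF brD(1)[OF assms(2), of s r] L_x[OF k, of 0]] by simp
    show "eqv (s + r) (C (X s) (C (x k 0) (x l r))) 0"
      using eqv_C'[OF brD(1)[OF assms(4), of 0 r] brD(3)[OF assms(1), of s]]
      by (simp add: commutator_simps add.commute)
  qed
  also have "eqv (s + r) (C (V (s + r)) (x k 0) + 0) (W (s + r))"
    using assms(3) by (simp add: br0_def)
  finally show "eqv (s + r) (C (Y s) (x l r)) (W (s + r))" .
qed (use assms in \<open>auto simp: br_def br0_def\<close>)

lemma br_x:
  assumes "i \<in> I" "j \<in> I"
  shows "br (x i) j (ap (x i) j)"
  unfolding br_def
proof (intro conjI allI)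
  fix s r
  show "eqv (s + r) (C (x i s) (x j r)) (C (x i (s + r)) (x j 0))"
    using eqv_sym[OF x_shift[OF assms, of s r 0]] by simp
  show "C (x i s) (x j 0) \<in> L s" using L_br[OF L_x L_x, OF assms, of s 0] by simp
qed (auto simp: L_x assms)

lemma br_x_flip:
  assumes "i \<in> I" "j \<in> I" "br0 (x i) j Y"
  shows "br (x j) i (ns Y)"
  unfolding br_def
proof (intro conjI allI)
  fix s r
  have "C (x j s) (x i r) = - C (x i r) (x j s)" by (rule commutator_antisym)
  also have "eqv (s + r) \<dots> (- Y (s + r))"
    using br_replace[OF br_x[OF assms(1,2)] assms(3)] eqv_uminus[OF brD(1), of "x i" j Y r s]
    by (simp add: add.commute)
  finally show "eqv (s + r) (C (x j s) (x i r)) (- Y (s + r))" .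
qed (use assms in \<open>auto simp: L_x br0_def L_uminus\<close>)

text \<open>Moving the degree turns the bracket into its own negative, so twice it is
  negligible.\<close>

lemma br_x_self: "i \<in> I \<Longrightarrow> br (x i) i zs"
proof -
  assume i: "i \<in> I"
  have "br0 (x i) i zs" unfolding br0_def
  proof (intro allI conjI)
    fix s
    have "eqv s (C (x i s) (x i 0)) (C (x i 0) (x i s))"
      using x_shift[OF i i, of 0 s 0] by simp
    then have "C (x i s) (x i 0) - C (x i 0) (x i s) \<in> Z s" by (simp add: eqv_def)
    moreover have "C (x i 0) (x i s) = - C (x i s) (x i 0)" by (rule commutator_antisym)
    ultimately have "C (x i s) (x i 0) + C (x i s) (x i 0) \<in> Z s" by simp
    from Z_double[OF this] show "eqv s (C (x i s) (x i 0)) 0" by (simp only: eqv_0)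
  qed (rule L_0)
  then show ?thesis using br_replace br_x[OF i i] by blast
qed

lemma br_commute: "br (x k) l zs \<Longrightarrow> k \<in> I \<Longrightarrow> br (x l) k zs"
  using br_x_flip[of k l zs] br_br0[of "x k" l zs] brD(2)[of "x k" l zs] by simp

lemma br_exchange_zs: "br X k Y \<Longrightarrow> br X l zs \<Longrightarrow> br (x k) l zs \<Longrightarrow> br Y l zs"
  using br_exchange br0_zs by blast

lemma br_exchange_ns: "br X k (ns Y) \<Longrightarrow> br X l zs \<Longrightarrow> br (x k) l zs \<Longrightarrow> br Y l zs"
  using br_exchange_zs[of X k "ns Y" l] br_ns_zs by blast

lemma br_twice: "br X k Y \<Longrightarrow> br Y k (ap Y k)"
  using br_exchange[of X k Y k Y "ap Y k"] br0_ap[of k Y] br_x_self brD by meson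

text \<open>Of the two Jacobi summands, the one that brackets \<open>X\<close> with
  \<open>x l\<close> first is negligible wherever the degree sits. In the other the degree moves
  from \<open>x l\<close> to \<open>x k\<close>, and from there it is absorbed into
  \<open>Y\<close>.\<close>

lemma br_sum:
  assumes "br X k Y" "br X l zs"
  shows "br Y l (ap Y l)"
  unfolding br_def
proof (intro conjI allI)
  fix s r
  note k = brD(2)[OF assms(1)] and l = brD(2)[OF assms(2)]
  have z: "eqv (s + r) (C (C (X s) (x l a)) (x k b)) 0" if "a + b = r" for a b
    using eqv_C[OF brD(1)[OF assms(2), of s a] L_x[OF k, of b]] that
    by (simp add: commutator_simps add.assoc)
  have "eqv s (Y s) (C (X s) (x k 0))" using eqv_sym[OF brD(1)[OF assms(1), of s 0]] by simp
  then have "eqv (s + r) (C (Y s) (x l r)) (C (C (X s) (x k 0)) (x l r))"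
    using eqv_C[OF _ L_x[OF l]] by blast
  also have "C (C (X s) (x k 0)) (x l r) = C (C (X s) (x l r)) (x k 0) + C (X s) (C (x k 0) (x l r))"
    by (rule jacobi)
  also have "eqv (s + r) \<dots> (C (C (X s) (x l 0)) (x k r) + C (X s) (C (x k r) (x l 0)))"
  proof (rule eqv_add)
    show "eqv (s + r) (C (C (X s) (x l r)) (x k 0)) (C (C (X s) (x l 0)) (x k r))"
      using eqv_trans[OF z[of r 0] eqv_sym[OF z[of 0 r]]] by simp
    have "eqv r (C (x k 0) (x l r)) (C (x k r) (x l 0))"
      using eqv_sym[OF x_shift[OF k l, of 0 r 0]] by simp
    then show "eqv (s + r) (C (X s) (C (x k 0) (x l r))) (C (X s) (C (x k r) (x l 0)))"
      using eqv_C'[OF _ brD(3)[OF assms(1), of s]] by (simp add: add.commute)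
  qed
  also have "\<dots> = C (C (X s) (x k r)) (x l 0)" by (rule jacobi[symmetric])
  also have "eqv (s + r) \<dots> (C (Y (s + r)) (x l 0))"
    using eqv_C[OF brD(1)[OF assms(1), of s r] L_x[OF l, of 0]] by simp
  finally show "eqv (s + r) (C (Y s) (x l r)) (C (Y (s + r)) (x l 0))" .
  show "C (Y s) (x l 0) \<in> L s" using L_br[OF brD(4)[OF assms(1)] L_x[OF l], of s 0] by simp
qed (use assms in \<open>auto simp: br_def\<close>)

lemma br_sum_zs:
  assumes "br X k Y" "br X l zs" "\<And>s. C (C (X s) (x k 0)) (x l 0) \<in> Z s"
  shows "br Y l zs"
proof (rule br_replace[OF br_sum[OF assms(1,2)]])
  show "br0 Y l zs" unfolding br0_def
  proof (intro allI conjI)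
    fix s
    have "eqv s (C (Y s) (x l 0)) (C (C (X s) (x k 0)) (x l 0))"
      using eqv_C[OF eqv_sym[OF brD(1)[OF assms(1), of s 0]] L_x[OF brD(2)[OF assms(2)], of 0]] by simp
    then show "eqv s (C (Y s) (x l 0)) 0"
      by (rule eqv_trans) (simp add: assms(3) eqv_0)
  qed (rule L_0)
qed

lemma br_Z:
  assumes "br X k zs"
  shows "C (X s) (x k 0) \<in> Z s"
  using brD(1)[OF assms, of s 0] by (simp add: eqv_0)

lemma Z_br0: "a \<in> Z s \<Longrightarrow> k \<in> I \<Longrightarrow> C a (x k 0) \<in> Z s"
  using Z_br[OF _ L_x, of a s k 0] by simp

lemma br_eqv0: "br X k Y \<Longrightarrow> eqv s (Y s) (C (X s) (x k 0))"
  using eqv_sym[OF brD(1)[of X k Y s 0]] by simp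

lemma eqv_C0: "eqv s a b \<Longrightarrow> k \<in> I \<Longrightarrow> eqv s (C a (x k 0)) (C b (x k 0))"
  using eqv_C[OF _ L_x, of s a b k 0] by simp

lemma eqv_Z: "eqv s a b \<Longrightarrow> a \<in> Z s \<longleftrightarrow> b \<in> Z s"
proof -
  assume *: "eqv s a b"
  show ?thesis
  proof
    assume "a \<in> Z s"
    then show "b \<in> Z s" using Z_diff[of a s "a - b"] * by (simp add: eqv_def)
  next
    assume "b \<in> Z s"
    then show "a \<in> Z s" using Z_add[of "a - b" s b] * by (simp add: eqv_def)
  qed
qed

text \<open>The next three lemmas are string arguments: the Serre relation \<open>(ad x\<^sub>k)\<^sup>m x\<^sub>l = 0\<close>, applied to a
  vector, expresses one word in the two right brackets through words that vanish.\<close>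

lemma br_serre_2:
  assumes "br X k Y" "br X l zs" "br Y k zs" "br Y l W"
    and serre: "C (C (x l 0) (x k 0)) (x k 0) \<in> Z 0"
  shows "br W k zs"
proof (rule br_sum_zs[OF assms(4) assms(3)])
  fix s
  note k = brD(2)[OF assms(1)] and l = brD(2)[OF assms(2)]
  let ?a = "X s" and ?b = "x k 0" and ?c = "x l 0"
  have "C (C (C ?a ?b) ?c) ?b + C (C (C ?a ?b) ?c) ?b =
      C (C (C ?a ?c) ?b) ?b + C (C (C ?a ?b) ?b) ?c - C ?a (C (C ?c ?b) ?b)"
    by (simp add: commutator_def algebra_simps)
  moreover have "C (C (C ?a ?c) ?b) ?b \<in> Z s" by (intro Z_br0 br_Z assms k)
  moreover have "C (C ?a ?b) ?b \<in> Z s"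
    using br_Z[OF assms(3), of s] eqv_Z[OF eqv_C0[OF br_eqv0[OF assms(1)] k]] by blast
  then have "C (C (C ?a ?b) ?b) ?c \<in> Z s" by (rule Z_br0[OF _ l])
  moreover have "C ?a (C (C ?c ?b) ?b) \<in> Z s"
    using Z_br'[OF serre brD(3)[OF assms(1), of s]] by simp
  ultimately have "C (C (C ?a ?b) ?c) ?b + C (C (C ?a ?b) ?c) ?b \<in> Z s"
    by (simp only: Z_add Z_diff)
  then have "C (C (C ?a ?b) ?c) ?b \<in> Z s" by (rule Z_double)
  then show "C (C (Y s) ?c) ?b \<in> Z s"
    using eqv_Z[OF eqv_C0[OF eqv_C0[OF br_eqv0[OF assms(1)] l] k]] by blast
qed

lemma br_serre_2':
  assumes "br X k Y" "br X l zs" "br Y l W"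
    and serre: "C (C (x k 0) (x l 0)) (x l 0) \<in> Z 0"
  shows "br W l zs"
proof (rule br_replace[OF br_twice[OF assms(3)]])
  show "br0 W l zs" unfolding br0_def
  proof (intro allI conjI)
    fix s
    note k = brD(2)[OF assms(1)] and l = brD(2)[OF assms(2)]
    let ?a = "X s" and ?b = "x k 0" and ?c = "x l 0"
    have eq: "C (C (C ?a ?b) ?c) ?c =
        C ?a (C (C ?b ?c) ?c) + C (C (C ?a ?c) ?b) ?c + C (C (C ?a ?c) ?b) ?c - C (C (C ?a ?c) ?c) ?b"
      by (simp add: commutator_def algebra_simps)
    have "C ?a (C (C ?b ?c) ?c) \<in> Z s" using Z_br'[OF serre brD(3)[OF assms(1), of s]] by simp
    moreover have "C (C (C ?a ?c) ?b) ?c \<in> Z s" "C (C (C ?a ?c) ?c) ?b \<in> Z s"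
      by (intro Z_br0 br_Z assms k l)+
    ultimately have "C (C (C ?a ?b) ?c) ?c \<in> Z s" unfolding eq by (intro Z_add Z_diff)
    moreover have "eqv s (W s) (C (C ?a ?b) ?c)"
      using eqv_trans[OF br_eqv0[OF assms(3)] eqv_C0[OF br_eqv0[OF assms(1)] l]] .
    ultimately show "eqv s (C (W s) ?c) 0" using eqv_Z[OF eqv_C0[OF _ l]] by (simp add: eqv_0)
  qed (rule L_0)
qed

lemma br_serre_3:
  assumes "br P k Q" "br P l zs" "br Q l zs" "br Q k R" "br R k zs" "br R l S"
    and serre: "C (C (C (x l 0) (x k 0)) (x k 0)) (x k 0) \<in> Z 0"
  shows "br S k zs"
proof (rule br_sum_zs[OF assms(6) assms(5)])
  fix s
  note k = brD(2)[OF assms(1)] and l = brD(2)[OF assms(2)]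
  let ?a = "P s" and ?b = "x k 0" and ?c = "x l 0"
  have Q: "eqv s (Q s) (C ?a ?b)" by (rule br_eqv0[OF assms(1)])
  have R: "eqv s (R s) (C (C ?a ?b) ?b)" using eqv_trans[OF br_eqv0[OF assms(4)] eqv_C0[OF Q k]] .
  define V where "V = C (C (C (C ?a ?b) ?b) ?c) ?b"
  define U where "U = C (C (C (C ?a ?b) ?c) ?b) ?b"
  \<comment> \<open>Applied to \<open>?a\<close>, the triple Serre bracket expands with binomial
    coefficients 1, 3, 3, 1 and alternating signs. \<open>V\<close> is the word to be isolated; the
    others are negligible.\<close>
  have eq: "V + V + V = C ?a (C (C (C ?c ?b) ?b) ?b) - C (C (C (C ?a ?c) ?b) ?b) ?b
      + (U + U + U) + C (C (C (C ?a ?b) ?b) ?b) ?c"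
    unfolding U_def V_def by (simp add: commutator_def algebra_simps)
  have "C ?a (C (C (C ?c ?b) ?b) ?b) \<in> Z s" using Z_br'[OF serre brD(3)[OF assms(1), of s]] by simp
  moreover have "C (C (C (C ?a ?c) ?b) ?b) ?b \<in> Z s" by (intro Z_br0 br_Z assms k)
  moreover have "C (C ?a ?b) ?c \<in> Z s"
    using br_Z[OF assms(3), of s] eqv_Z[OF eqv_C0[OF Q l]] by blast
  then have "U \<in> Z s" unfolding U_def by (rule Z_br0[OF Z_br0[OF _ k] k])
  moreover have "C (C (C ?a ?b) ?b) ?b \<in> Z s"
    using br_Z[OF assms(5), of s] eqv_Z[OF eqv_C0[OF R k]] by blast
  then have "C (C (C (C ?a ?b) ?b) ?b) ?c \<in> Z s" by (rule Z_br0[OF _ l])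
  ultimately have "V + V + V \<in> Z s" unfolding eq by (simp add: Z_add Z_diff)
  moreover have "of_nat (Suc 2) * V = (1 + (1 + 1)) * V" by simp
  then have "of_nat (Suc 2) * V = V + V + V" by (simp only: distrib_right mult_1 add.assoc)
  ultimately have "V \<in> Z s" using Z_div[of 2 V s] by metis
  then show "C (C (R s) ?c) ?b \<in> Z s"
    unfolding V_def using eqv_Z[OF eqv_C0[OF eqv_C0[OF R l] k]] by blast
qed

text \<open>With \<open>Y\<close> the bracket of the letters \<open>l\<close> and \<open>k\<close>,
  Jacobi gives \<open>[W, x l] = - [Y a, Y b]\<close> for every splitting \<open>a + b\<close> of
  the degree. The splittings \<open>(s, 0)\<close> and \<open>(0, s)\<close> have opposite right
  sides, so twice the bracket is negligible.\<close>

lemma br_self_bracket: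
  assumes "br (x l) k Y" "br Y l zs" "br Y k W"
  shows "br W l zs"
proof (rule br_replace[OF br_sum[OF assms(3,2)]])
  note k = brD(2)[OF assms(1)] and l = brD(2)[OF assms(2)]
  have key: "eqv (a + b) (C (W (a + b)) (x l 0)) (- C (Y a) (Y b))" for a b
  proof -
    have "eqv (a + b) (W (a + b)) (C (Y a) (x k b))" by (rule eqv_sym[OF brD(1)[OF assms(3)]])
    from eqv_C0[OF this l]
    have "eqv (a + b) (C (W (a + b)) (x l 0)) (C (C (Y a) (x k b)) (x l 0))" .
    also have "C (C (Y a) (x k b)) (x l 0) = C (C (Y a) (x l 0)) (x k b) - C (Y a) (C (x l 0) (x k b))"
      by (simp add: commutator_def algebra_simps)
    also have "eqv (a + b) \<dots> (0 - C (Y a) (Y b))"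
    proof (rule eqv_diff)
      show "eqv (a + b) (C (C (Y a) (x l 0)) (x k b)) 0"
        using Z_br[OF br_Z[OF assms(2), of a] L_x[OF k, of b]] by (simp add: eqv_0)
      show "eqv (a + b) (C (Y a) (C (x l 0) (x k b))) (C (Y a) (Y b))"
        using eqv_C'[OF brD(1)[OF assms(1), of 0 b] brD(4)[OF assms(1), of a]] by (simp add: add.commute)
    qed
    finally show ?thesis by simp
  qed
  show "br0 W l zs" unfolding br0_def
  proof (intro allI conjI)
    fix s
    have "eqv s (C (W s) (x l 0) + C (W s) (x l 0)) (- C (Y s) (Y 0) + - C (Y 0) (Y s))"
      using eqv_add[OF key[of s 0, simplified] key[of 0 s, simplified]] .
    also have "- C (Y s) (Y 0) + - C (Y 0) (Y s) = 0" by (simp add: commutator_def)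
    finally have "C (W s) (x l 0) + C (W s) (x l 0) \<in> Z s" by (simp only: eqv_0)
    from Z_double[OF this] show "eqv s (C (W s) (x l 0)) 0" by (simp only: eqv_0)
  qed (rule L_0)
qed

text \<open>The reference vector of a word, with which all decompositions of the loop degree are
  compared.\<close>

definition wd :: "nat list \<Rightarrow> nat \<Rightarrow> 'a" where
  "wd \<beta> s = foldl C (x (hd \<beta>) s) (map (\<lambda>k. x k 0) (tl \<beta>))"

lemma wd_single [simp]: "wd [i] = x i"
  by (simp add: wd_def fun_eq_iff)

lemma wd_snoc: "\<beta> \<noteq> [] \<Longrightarrow> wd (\<beta> @ [k]) = ap (wd \<beta>) k"
  by (simp add: wd_def fun_eq_iff)

definition chain :: "nat list \<Rightarrow> bool" where
  "chain \<beta> \<longleftrightarrow> (\<forall>p k q. \<beta> = p @ k # q \<longrightarrow> p \<noteq> [] \<longrightarrow> br (wd p) k (wd (p @ [k])))"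

lemma chain_single: "chain [i]"
  by (auto simp: chain_def Cons_eq_append_conv)

lemma chain_snoc: "chain \<beta> \<Longrightarrow> br (wd \<beta>) k (wd (\<beta> @ [k])) \<Longrightarrow> chain (\<beta> @ [k])"
  unfolding chain_def
proof (intro allI impI)
  fix p l q
  assume *: "\<forall>p k q. \<beta> = p @ k # q \<longrightarrow> p \<noteq> [] \<longrightarrow> br (wd p) k (wd (p @ [k]))"
    "br (wd \<beta>) k (wd (\<beta> @ [k]))" "\<beta> @ [k] = p @ l # q" "p \<noteq> []"
  show "br (wd p) l (wd (p @ [l]))"
    using * by (cases q rule: rev_cases) auto
qed

text \<open>The letters are absorbed from the left: once a prefix depends only on its total degree,
  \<open>br\<close> hands the degree of the next letter over to it.\<close>

lemma chain_eqv:
  assumes "chain \<beta>" "\<beta> \<noteq> []" "length ss = length \<beta>" "hd \<beta> \<in> I"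
  shows "eqv (sum_list ss) (foldl C (hd (map2 x \<beta> ss)) (tl (map2 x \<beta> ss))) (wd \<beta> (sum_list ss))"
  using assms
proof (induction \<beta> arbitrary: ss rule: rev_induct)
  case (snoc k \<beta>)
  obtain ss' t where ss: "ss = ss' @ [t]" "length ss' = length \<beta>"
    using snoc.prems(3) by (cases ss rule: rev_cases) auto
  show ?case
  proof (cases "\<beta> = []")
    case True
    then show ?thesis using ss by simp
  next
    case False
    have b: "br (wd \<beta>) k (wd (\<beta> @ [k]))" using snoc.prems(1) False by (auto simp: chain_def)
    have ch: "chain \<beta>" using snoc.prems(1) by (auto simp: chain_def)
    have ne: "map2 x \<beta> ss' \<noteq> []" using False ss by auto
    have "eqv (sum_list ss') (foldl C (hd (map2 x \<beta> ss')) (tl (map2 x \<beta> ss'))) (wd \<beta> (sum_list ss'))"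
      using snoc.IH[OF ch False ss(2)] snoc.prems(4) False by simp
    from eqv_C[OF this L_x[OF brD(2)[OF b], of t]]
    have "eqv (sum_list ss) (foldl C (hd (map2 x (\<beta> @ [k]) ss)) (tl (map2 x (\<beta> @ [k]) ss)))
        (C (wd \<beta> (sum_list ss')) (x k t))"
      using ss ne by simp
    also have "eqv (sum_list ss) (C (wd \<beta> (sum_list ss')) (x k t)) (wd (\<beta> @ [k]) (sum_list ss))"
      using brD(1)[OF b, of "sum_list ss'" t] ss by simp
    finally show ?thesis .
  qed
qed simp

end

lemma (in loop_lie) br_twice_zs:
  assumes "br X k Y" "\<And>s. C (C (X s) (x k 0)) (x k 0) \<in> Z s"
  shows "br Y k zs"
proof (rule br_replace[OF br_twice[OF assms(1)]])
  have "C (Y s) (x k 0) \<in> Z s" for s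
    using assms(2)[of s] eqv_Z[OF eqv_C0[OF br_eqv0[OF assms(1), of s] brD(2)[OF assms(1)]]] by blast
  then show "br0 Y k zs" by (simp add: br0_def L_0 eqv_0)
qed

lemma roots_B: "\<beta> \<in> set (pos_roots (B n)) \<longleftrightarrow>
  (\<exists>i j. 1 \<le> i \<and> i \<le> j \<and> j \<le> n \<and> \<beta> = [i..<Suc j]) \<or>
  (\<exists>i j. 1 \<le> i \<and> i < j \<and> j \<le> n \<and> \<beta> = [i..<Suc n] @ rev [j..<Suc n])"
proof -
  have s: "set (pos_roots (B n)) = (\<Union>i\<in>{1..<Suc n}. (\<lambda>j. [i..<Suc j]) ` {i..<Suc n} \<union>
      (\<lambda>j. [i..<Suc n] @ rev [j..<Suc n]) ` {Suc i..<Suc n})"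
    by (simp only: pos_roots.simps set_concat set_map set_append set_rev set_upt image_image)
  show ?thesis
  proof
    assume "\<beta> \<in> set (pos_roots (B n))"
    then obtain i where i: "i \<in> {1..<Suc n}" and
      "\<beta> \<in> (\<lambda>j. [i..<Suc j]) ` {i..<Suc n} \<union> (\<lambda>j. [i..<Suc n] @ rev [j..<Suc n]) ` {Suc i..<Suc n}"
      unfolding s by (rule UN_E)
    from this(2) show "(\<exists>i j. 1 \<le> i \<and> i \<le> j \<and> j \<le> n \<and> \<beta> = [i..<Suc j]) \<or>
      (\<exists>i j. 1 \<le> i \<and> i < j \<and> j \<le> n \<and> \<beta> = [i..<Suc n] @ rev [j..<Suc n])"
    proof (elim UnE imageE)
      fix j assume "\<beta> = [i..<Suc j]" "j \<in> {i..<Suc n}"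
      then show ?thesis using i by (intro disjI1 exI[of _ i] exI[of _ j]) (simp del: upt_Suc)
    next
      fix j assume "\<beta> = [i..<Suc n] @ rev [j..<Suc n]" "j \<in> {Suc i..<Suc n}"
      then show ?thesis using i by (intro disjI2 exI[of _ i] exI[of _ j]) (simp del: upt_Suc)
    qed
  next
    assume "(\<exists>i j. 1 \<le> i \<and> i \<le> j \<and> j \<le> n \<and> \<beta> = [i..<Suc j]) \<or>
      (\<exists>i j. 1 \<le> i \<and> i < j \<and> j \<le> n \<and> \<beta> = [i..<Suc n] @ rev [j..<Suc n])"
    then show "\<beta> \<in> set (pos_roots (B n))"
    proof (elim disjE exE conjE)
      fix i j assume "1 \<le> i" "i \<le> j" "j \<le> n" "\<beta> = [i..<Suc j]"
      then show ?thesis unfolding s by (intro UN_I[of i] UnI1 image_eqI[of _ _ j]) (simp_all del: upt_Suc)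
    next
      fix i j assume "1 \<le> i" "i < j" "j \<le> n" "\<beta> = [i..<Suc n] @ rev [j..<Suc n]"
      then show ?thesis unfolding s by (intro UN_I[of i] UnI2 image_eqI[of _ _ j]) (simp_all del: upt_Suc)
    qed
  qed
qed

section \<open>Positive roots of type \<open>B\<^sub>n\<close>\<close>

text \<open>The three relations belong to the Cartan integers 0, -1 and -2, the last only for
  \<open>n\<close> against \<open>n - 1\<close>. Zero modes of the bracketing letter are enough,
  since \<open>br\<close> moves the degree.\<close>

locale loop_lie_B = loop_lie Z L x "{1..n}"
  for Z :: "nat \<Rightarrow> 'a::ring_1 set" and L and x and n :: nat +
  assumes n2: "n \<ge> 2"
    and far: "i \<in> {1..n} \<Longrightarrow> j \<in> {1..n} \<Longrightarrow> i + 2 \<le> j \<Longrightarrow> commutator (x j r) (x i 0) \<in> Z r"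
    and serre2: "i \<in> {1..<n} \<Longrightarrow> j \<in> {1..n} \<Longrightarrow> j = Suc i \<or> i = Suc j \<Longrightarrow>
      commutator (commutator (x j r) (x i 0)) (x i 0) \<in> Z r"
    and serre3: "commutator (commutator (commutator (x (n - 1) r) (x n 0)) (x n 0)) (x n 0) \<in> Z r"
begin

text \<open>In the usual coordinates the root is eps_i - eps_{j+1} for \<open>j < n\<close> and
  eps_i for \<open>j = n\<close>; that of \<open>f i j\<close> below is eps_i + eps_j. The vanishing
  lemmas correspond to sums with a simple root that are not roots.\<close>

definition e :: "nat \<Rightarrow> nat \<Rightarrow> nat \<Rightarrow> 'a" where
  "e i j = wd [i..<Suc j]"

definition f :: "nat \<Rightarrow> nat \<Rightarrow> nat \<Rightarrow> 'a" where
  "f i j = wd ([i..<Suc n] @ rev [j..<Suc n])"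

lemma comm_up: "i \<in> {1..n} \<Longrightarrow> j \<in> {1..n} \<Longrightarrow> i + 2 \<le> j \<Longrightarrow> br (x j) i zs"
  by (rule br_replace[OF br_x]) (auto simp: br0_def L_0 eqv_0 far)

lemma comm_down: "i \<in> {1..n} \<Longrightarrow> j \<in> {1..n} \<Longrightarrow> i + 2 \<le> j \<Longrightarrow> br (x i) j zs"
  using br_commute[OF comm_up] by simp

lemma e_self [simp]: "e i i = x i" by (simp add: e_def)

lemma e_ap: "i \<le> j \<Longrightarrow> e i (Suc j) = ap (e i j) (Suc j)"
proof -
  assume "i \<le> j"
  then have "[i..<Suc (Suc j)] = [i..<Suc j] @ [Suc j]" "[i..<Suc j] \<noteq> []" by simp_all
  then show ?thesis unfolding e_def by (simp only: wd_snoc not_False_eq_True)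
qed

lemma f_ap_n: "i \<le> n \<Longrightarrow> f i n = ap (e i n) n"
proof -
  assume "i \<le> n"
  then have "[i..<Suc n] @ rev [n..<Suc n] = [i..<Suc n] @ [n]" "[i..<Suc n] \<noteq> []" by simp_all
  then show ?thesis unfolding e_def f_def by (simp only: wd_snoc not_False_eq_True)
qed

lemma f_ap: "i \<le> n \<Longrightarrow> j < n \<Longrightarrow> f i j = ap (f i (Suc j)) j"
proof -
  assume "i \<le> n" "j < n"
  then have "[i..<Suc n] @ rev [j..<Suc n] = ([i..<Suc n] @ rev [Suc j..<Suc n]) @ [j]"
    by (simp add: upt_conv_Cons[of j])
  moreover have "[i..<Suc n] @ rev [Suc j..<Suc n] \<noteq> []" using \<open>i \<le> n\<close> by simp
  ultimately show ?thesis unfolding f_def by (simp only: wd_snoc not_False_eq_True)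
qed

text \<open>Joint induction: extending the word from \<open>Suc j\<close> by \<open>br_sum\<close>
  needs that the letter \<open>j + 2\<close> kills \<open>e i j\<close>.\<close>

lemma e_basic:
  assumes "1 \<le> i" "i \<le> j" "j \<le> n"
  shows "(\<forall>k. j + 2 \<le> k \<and> k \<le> n \<longrightarrow> br (e i j) k zs) \<and> (j < n \<longrightarrow> br (e i j) (Suc j) (e i (Suc j)))"
  using assms(2,3)
proof (induction j rule: dec_induct)
  case base
  then show ?case
    using assms(1) comm_down br_x[of i "Suc i"] e_ap[of i i] by auto
next
  case (step j)
  have st: "br (e i j) (Suc j) (e i (Suc j))"
    and fr: "\<And>k. j + 2 \<le> k \<Longrightarrow> k \<le> n \<Longrightarrow> br (e i j) k zs" using step by auto
  have "br (e i (Suc j)) k zs" if "Suc j + 2 \<le> k" "k \<le> n" for k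
    using br_exchange_zs[OF st fr, of k] comm_down that by simp
  moreover have "br (e i (Suc j)) (Suc (Suc j)) (e i (Suc (Suc j)))" if "Suc j < n"
    using br_sum[OF st fr, of "Suc (Suc j)"] that e_ap[of i "Suc j"] step by simp
  ultimately show ?case by blast
qed

lemma e_far: "1 \<le> i \<Longrightarrow> i \<le> j \<Longrightarrow> j + 2 \<le> k \<Longrightarrow> k \<le> n \<Longrightarrow> br (e i j) k zs"
  using e_basic[of i j] by auto

lemma e_step: "1 \<le> i \<Longrightarrow> i \<le> j \<Longrightarrow> j < n \<Longrightarrow> br (e i j) (Suc j) (e i (Suc j))"
  using e_basic[of i j] by auto

lemma e_low:
  assumes "1 \<le> k" "k + 2 \<le> i" "i \<le> j" "j \<le> n"
  shows "br (e i j) k zs"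
  using assms(3,4)
proof (induction j rule: dec_induct)
  case base
  then show ?case using assms comm_up[of k i] by simp
next
  case (step j)
  show ?case using br_exchange_zs[OF e_step step.IH] comm_up[of k "Suc j"] step assms by simp
qed

text \<open>For a word of one letter this is antisymmetry, the source of the sign. All further
  letters commute with \<open>x i\<close>, so the bracket with \<open>x i\<close> moves past
  them.\<close>

lemma e_left:
  assumes "1 \<le> i" "Suc i \<le> j" "j \<le> n"
  shows "br (e (Suc i) j) i (ns (e i j))"
  using assms(2,3)
proof (induction j rule: dec_induct)
  case base
  have "br (x (Suc i)) i (ns (e i (Suc i)))"
    using br_x_flip[of i "Suc i" "e i (Suc i)"] br_br0[OF e_step[of i i]] assms base by simp
  then show ?case by simp
next
  case (step j)
  have "br0 (ns (e i j)) (Suc j) (ns (e i (Suc j)))"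
    using br0_ns[OF br_br0[OF e_step]] assms step by simp
  then show ?case
    using br_exchange[OF e_step step.IH _ comm_up[of i "Suc j"]] step assms by simp
qed

text \<open>Lets the vanishing at the letter \<open>k\<close> be proved for the shortest relevant
  word and carried to smaller first letters.\<close>

lemma e_descend:
  assumes "1 \<le> i" "i + 2 \<le> k" "Suc i \<le> j" "j \<le> n" "br (e (Suc i) j) k zs"
  shows "br (e i j) k zs"
  by (rule br_exchange_ns[OF e_left]) (use assms brD(2)[OF assms(5)] comm_down[of i k] in auto)

lemma e_end:
  assumes "1 \<le> i" "i < j" "j < n"
  shows "br (e i j) j zs"
proof -
  obtain m where m: "j = Suc m" using assms by (cases j) auto
  have "i \<le> m" using assms m by simp
  then show ?thesis using assms(1)
  proof (induction i rule: inc_induct)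
    case base
    have b: "br (x m) j (e m j)" using e_step[of m m] base assms m by simp
    show ?case
      by (rule br_twice_zs[OF b]) (use serre2[of j m] base assms m in simp)
  next
    case (step i)
    then show ?case using e_descend[of i j j] assms m by simp
  qed
qed

lemma e_first:
  assumes "1 \<le> i" "Suc i \<le> j" "j \<le> n"
  shows "br (e i j) i zs"
  using assms(2,3)
proof (induction j rule: dec_induct)
  case base
  have b: "br (x (Suc i)) i (ns (e i (Suc i)))" using e_left[of i "Suc i"] assms base by simp
  have "br (ns (e i (Suc i))) i zs"
    by (rule br_twice_zs[OF b]) (use serre2[of i "Suc i"] assms base in simp)
  then show ?case using br_ns_zs by blast
next
  case (step j)
  show ?case using br_exchange_zs[OF e_step step.IH] comm_up[of i "Suc j"] step assms by simp
qed

text \<open>The critical word is \<open>k - 1, k, k + 1\<close>, where the Serre relation between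
  \<open>x k\<close> and \<open>x (k + 1)\<close> enters. Longer words only add letters that commute
  with \<open>x k\<close>.\<close>

lemma e_mid:
  assumes "1 \<le> i" "i < k" "Suc k \<le> j" "j \<le> n"
  shows "br (e i j) k zs"
  using assms(3,4)
proof (induction j rule: dec_induct)
  case base
  obtain m where m: "k = Suc m" using assms by (cases k) auto
  have "i \<le> m" using assms m by simp
  then show ?case using assms(1)
  proof (induction i rule: inc_induct)
    case base
    show ?case
    proof (rule br_serre_2[where X = "x m" and k = k and l = "Suc k" and Y = "e m k"])
      show "br (x m) k (e m k)" using e_step[of m m] base assms \<open>Suc k \<le> n\<close> m by simp
      show "br (x m) (Suc k) zs" using comm_down base m \<open>Suc k \<le> n\<close> by simp
      show "br (e m k) k zs" using e_end base m \<open>Suc k \<le> n\<close> by simp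
      show "br (e m k) (Suc k) (e m (Suc k))" using e_step base m \<open>Suc k \<le> n\<close> by simp
      show "C (C (x (Suc k) 0) (x k 0)) (x k 0) \<in> Z 0"
        using serre2[of k "Suc k"] base m \<open>Suc k \<le> n\<close> by simp
    qed
  next
    case (step i)
    then show ?case using e_descend[of i k "Suc k"] assms m \<open>Suc k \<le> n\<close> by simp
  qed
next
  case (step j)
  show ?case using br_exchange_zs[OF e_step step.IH] comm_up[of k "Suc j"] step assms by simp
qed

section \<open>Words that run up to \<open>n\<close> and back\<close>

lemma e_top:
  assumes "1 \<le> i" "i < n"
  shows "br (e i n) n (f i n)"
proof -
  obtain m where m: "n = Suc m" using assms by (cases n) auto
  show ?thesis using br_twice[OF e_step[of i m]] assms m f_ap_n[of i] by simp
qed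

text \<open>Joint induction from \<open>n\<close> downwards: to attach the letter \<open>j\<close>,
  \<open>br_sum\<close> needs that it kills the word two steps earlier, which is
  \<open>f i (j + 2)\<close>, or \<open>e i n\<close> when \<open>j + 1 = n\<close>.\<close>

lemma f_step_mid:
  assumes "1 \<le> i" "i < j" "j \<le> n"
  shows "(j < n \<longrightarrow> br (f i (Suc j)) j (f i j)) \<and> (\<forall>k. i < k \<and> k + 2 \<le> j \<longrightarrow> br (f i j) k zs)"
  using assms(2,3)
proof (induction "n - j" arbitrary: j rule: less_induct)
  case less
  have st: "br (f i (Suc j)) j (f i j)" if jn: "j < n"
  proof (cases "Suc j = n")
    case True
    have "br (e i n) j zs" using e_mid[of i j n] True less.prems assms by simp
    from br_sum[OF e_top this] show ?thesis
      using True f_ap[of i j] less.prems assms by simp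
  next
    case False
    have "br (f i (Suc (Suc j))) (Suc j) (f i (Suc j))" using less.hyps[of "Suc j"] less.prems jn False by simp
    moreover have "br (f i (Suc (Suc j))) j zs"
      using less.hyps[of "Suc (Suc j)"] less.prems jn False by simp
    ultimately show ?thesis using br_sum f_ap[of i j] jn less.prems assms by simp
  qed
  moreover have "br (f i j) k zs" if k: "i < k" "k + 2 \<le> j" for k
  proof (cases "j = n")
    case True
    show ?thesis
      using br_exchange_zs[OF e_top e_mid[of i k n] comm_up[of k n]] True k assms by simp
  next
    case False
    then have jn: "j < n" using less.prems by simp
    have "br (f i (Suc j)) k zs" using less.hyps[of "Suc j"] less.prems k jn by simp
    from br_exchange_zs[OF st[OF jn] this comm_up[of k j]] show ?thesis
      using k jn less.prems assms by simp
  qed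
  ultimately show ?case by blast
qed

lemma f_step: "1 \<le> i \<Longrightarrow> i < j \<Longrightarrow> j < n \<Longrightarrow> br (f i (Suc j)) j (f i j)"
  using f_step_mid[of i j] by auto

lemma f_mid: "1 \<le> i \<Longrightarrow> i < k \<Longrightarrow> k + 2 \<le> j \<Longrightarrow> j \<le> n \<Longrightarrow> br (f i j) k zs"
  using f_step_mid[of i j] by auto

lemma f_lowfar:
  assumes "1 \<le> k" "k + 2 \<le> i" "i < j" "j \<le> n"
  shows "br (f i j) k zs"
  using assms(4,3)
proof (induction j rule: inc_induct)
  case base
  then show ?case using br_exchange_zs[OF e_top e_low[of k i n] comm_up[of k n]] assms by simp
next
  case (step j)
  then show ?case using br_exchange_zs[OF f_step _ comm_up[of k j]] assms by simp
qed

lemma f_left: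
  assumes "1 \<le> i" "Suc i < j" "j \<le> n"
  shows "br (f (Suc i) j) i (ns (f i j))"
  using assms(3,2)
proof (induction j rule: inc_induct)
  case base
  have "br0 (ns (e i n)) n (ns (f i n))"
    using br0_ns[OF br_br0[OF e_top]] assms base by simp
  then show ?case
    using br_exchange[OF e_top e_left[of i n] _ comm_up[of i n]] assms base by simp
next
  case (step j)
  have "br0 (ns (f i (Suc j))) j (ns (f i j))"
    using br0_ns[OF br_br0[OF f_step]] assms step by simp
  then show ?case
    using br_exchange[OF f_step _ _ comm_up[of i j]] assms step by simp
qed

lemma f_descend:
  assumes "1 \<le> i" "i + 2 \<le> k" "Suc i < j" "j \<le> n" "br (f (Suc i) j) k zs"
  shows "br (f i j) k zs"
  by (rule br_exchange_ns[OF f_left]) (use assms brD(2)[OF assms(5)] comm_down[of i k] in auto)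

lemma f_n_n:
  assumes "1 \<le> i" "i < n"
  shows "br (f i n) n zs"
proof -
  obtain m where m: "n = Suc m" using assms by (cases n) auto
  have "i \<le> m" using assms m by simp
  then show ?thesis using assms(1)
  proof (induction i rule: inc_induct)
    case base
    show ?case
    proof (rule br_twice_zs)
      show "br (e m n) n (f m n)" using e_top[of m] base m by simp
      have "e m n = ap (x m) n" using e_ap[of m m] m by simp
      then show "C (C (e m n s) (x n 0)) (x n 0) \<in> Z s" for s using serre3[of s] m by simp
    qed
  next
    case (step i)
    then show ?case using f_descend[of i n n] m by simp
  qed
qed

text \<open>Adding alpha_i to eps_i + eps_{i+1} gives 2 eps_i, which is not a root. This case starts
  at the end of the diagram with \<open>br_self_bracket\<close> and descends by a string argument
  from eps_{i+1} + eps_{i+2}. For larger \<open>j\<close> commuting letters suffice.\<close>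

lemma f_first:
  assumes "1 \<le> i" "i < j" "j \<le> n"
  shows "br (f i j) i zs"
proof -
  have hi: "br (f i j) i zs" if "1 \<le> i" "i + 2 \<le> j" "j \<le> n" for i j
    using that(3,2)
  proof (induction j rule: inc_induct)
    case base
    then show ?case using br_exchange_zs[OF e_top e_first[of i n] comm_up[of i n]] that by simp
  next
    case (step j)
    then show ?case using br_exchange_zs[OF f_step _ comm_up[of i j]] that by simp
  qed
  have "br (f i (Suc i)) i zs"
  proof -
    obtain m where m: "n = Suc m" using assms by (cases n) auto
    have "i \<le> m" using assms m by simp
    then show ?thesis using assms(1)
    proof (induction i rule: inc_induct)
      case base
      have "br (x m) n (e m n)" using e_step[of m m] base m by simp
      moreover have "br (e m n) m zs" using e_first[of m n] base m by simp
      moreover have "br (e m n) n (f m n)" using e_top[of m] base m by simp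
      ultimately show ?case using br_self_bracket m by metis
    next
      case (step i)
      have "br (ns (f i (Suc i))) i zs"
      proof (rule br_serre_2[where X = "f (Suc i) (Suc (Suc i))" and k = i and l = "Suc i"
            and Y = "ns (f i (Suc (Suc i)))"])
        show "br (f (Suc i) (Suc (Suc i))) i (ns (f i (Suc (Suc i))))"
          using f_left[of i "Suc (Suc i)"] step m by simp
        show "br (f (Suc i) (Suc (Suc i))) (Suc i) zs" using step.IH by simp
        show "br (ns (f i (Suc (Suc i)))) i zs"
          using hi[of i "Suc (Suc i)"] br_ns_zs step m by simp
        show "br (ns (f i (Suc (Suc i)))) (Suc i) (ns (f i (Suc i)))"
          using br_ns[OF f_step[of i "Suc i"]] step m by simp
        show "C (C (x (Suc i) 0) (x i 0)) (x i 0) \<in> Z 0"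
          using serre2[of i "Suc i"] step m by simp
      qed
      then show ?case using br_ns_zs by blast
    qed
  qed
  then show ?thesis using hi[of i j] assms by (cases "j = Suc i") auto
qed

text \<open>For \<open>i = j - 1\<close> this is a string argument from eps_j + eps_{j+1}, which
  \<open>f_first\<close> shows to be killed by the letter \<open>j\<close>. Smaller \<open>i\<close>
  follow by \<open>f_descend\<close>.\<close>

lemma f_end:
  assumes "1 \<le> i" "i < j" "j < n"
  shows "br (f i j) j zs"
proof -
  obtain m where m: "j = Suc m" using assms by (cases j) auto
  have "i \<le> m" using assms m by simp
  then show ?thesis using assms(1)
  proof (induction i rule: inc_induct)
    case base
    have "br (ns (f m j)) j zs"
    proof (rule br_serre_2'[where X = "f j (Suc j)" and k = m and l = j and Y = "ns (f m (Suc j))"])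
      show "br (f j (Suc j)) m (ns (f m (Suc j)))" using f_left[of m "Suc j"] m base assms by simp
      show "br (f j (Suc j)) j zs" using f_first[of j "Suc j"] assms by simp
      show "br (ns (f m (Suc j))) j (ns (f m j))"
        using br_ns[OF f_step[of m j]] m base assms by simp
      show "C (C (x m 0) (x j 0)) (x j 0) \<in> Z 0" using serre2[of j m] m base assms by simp
    qed
    then show ?case using br_ns_zs by blast
  next
    case (step i)
    then show ?case using f_descend[of i j j] assms m by simp
  qed
qed

text \<open>Commuting letters reduce everything to \<open>j = k - 1\<close>. There the string
  through the letter \<open>k\<close> uses the double Serre relation, or the triple one if
  \<open>k = n\<close>.\<close>

lemma f_up:
  assumes "1 \<le> i" "i < j" "j < k" "k \<le> n"
  shows "br (f i j) k zs"
proof -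
  obtain m where m: "k = Suc m" using assms by (cases k) auto
  have "j \<le> m" using assms m by simp
  then show ?thesis using assms(2)
  proof (induction j rule: inc_induct)
    case base
    show ?case
    proof (cases "k = n")
      case False
      show ?thesis
      proof (rule br_serre_2[where X = "f i (Suc k)" and k = k and l = m and Y = "f i k"])
        show "br (f i (Suc k)) k (f i k)" using f_step[of i k] assms False m base by simp
        show "br (f i (Suc k)) m zs" using f_mid[of i m "Suc k"] assms False m base by simp
        show "br (f i k) k zs" using f_end[of i k] assms False m base by simp
        show "br (f i k) m (f i m)" using f_step[of i m] assms False m base by simp
        show "C (C (x m 0) (x k 0)) (x k 0) \<in> Z 0" using serre2[of k m] assms False m base by simp
      qed
    next
      case True
      show ?thesis
      proof (rule br_serre_3[where P = "e i m" and k = k and l = m and Q = "e i n" and R = "f i n"])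
        show "br (e i m) k (e i n)" using e_step[of i m] assms True m base by simp
        show "br (e i m) m zs" using e_end[of i m] assms True m base by simp
        show "br (e i n) m zs" using e_mid[of i m n] assms True m base by simp
        show "br (e i n) k (f i n)" using e_top[of i] assms True m base by simp
        show "br (f i n) k zs" using f_n_n[of i] assms True m base by simp
        show "br (f i n) m (f i m)" using f_step[of i m] assms True m base by simp
        show "C (C (C (x m 0) (x k 0)) (x k 0)) (x k 0) \<in> Z 0" using serre3[of 0] True m by auto
      qed
    qed
  next
    case (step j)
    then show ?case using br_exchange_zs[OF f_step _ comm_down[of j k]] assms m by simp
  qed
qed

section \<open>The table of brackets with simple letters in type B\<close>

lemma table_e:
  assumes "1 \<le> i" "i \<le> j" "j \<le> n" "1 \<le> k" "k \<le> n"
  shows "\<exists>Y. br (e i j) k Y \<and> (Y = zs \<or> (\<exists>\<gamma>\<in>set (pos_roots (B n)). Y = wd \<gamma> \<or> Y = ns (wd \<gamma>)))"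
proof -
  consider "k + 2 \<le> i" | "Suc k = i" | "k = i" "i = j" | "k = i" "i < j" | "i < k" "k < j"
    | "i < k" "k = j" "j < n" | "i < k" "k = j" "j = n" | "k = Suc j" | "j + 2 \<le> k"
    using assms by linarith
  then show ?thesis
  proof cases
    case 1 then show ?thesis using e_low assms by blast
  next
    case 2
    then have "br (e i j) k (ns (e k j))" using e_left[of k j] assms by simp
    moreover have "[k..<Suc j] \<in> set (pos_roots (B n))"
      unfolding roots_B using assms 2 by (intro disjI1 exI[of _ k] exI[of _ j]) auto
    ultimately show ?thesis unfolding e_def f_def by blast
  next
    case 3 then show ?thesis using br_x_self[of i] assms by auto
  next
    case 4 then show ?thesis using e_first[of i j] assms by auto
  next
    case 5 then show ?thesis using e_mid[of i k j] assms by auto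
  next
    case 6 then show ?thesis using e_end[of i j] assms by auto
  next
    case 7
    then have "br (e i j) k (f i n)" using e_top[of i] assms by simp
    moreover have "[i..<Suc n] @ rev [n..<Suc n] \<in> set (pos_roots (B n))"
      unfolding roots_B using assms 7 by (intro disjI2 exI[of _ i] exI[of _ n]) auto
    ultimately show ?thesis unfolding e_def f_def by blast
  next
    case 8
    then have "br (e i j) k (e i k)" using e_step[of i j] assms by simp
    moreover have "[i..<Suc k] \<in> set (pos_roots (B n))"
      unfolding roots_B using assms 8 by (intro disjI1 exI[of _ i] exI[of _ k]) auto
    ultimately show ?thesis unfolding e_def f_def by blast
  next
    case 9 then show ?thesis using e_far[of i j k] assms by auto
  qed
qed

lemma table_f:
  assumes "1 \<le> i" "i < j" "j \<le> n" "1 \<le> k" "k \<le> n"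
  shows "\<exists>Y. br (f i j) k Y \<and> (Y = zs \<or> (\<exists>\<gamma>\<in>set (pos_roots (B n)). Y = wd \<gamma> \<or> Y = ns (wd \<gamma>)))"
proof -
  consider "k + 2 \<le> i" | "Suc k = i" | "k = i" | "i < k" "k + 2 \<le> j"
    | "i < k" "Suc k = j" | "k = j" "j < n" | "k = j" "j = n" | "j < k"
    using assms by linarith
  then show ?thesis
  proof cases
    case 1 then show ?thesis using f_lowfar assms by blast
  next
    case 2
    then have "br (f i j) k (ns (f k j))" using f_left[of k j] assms by simp
    moreover have "[k..<Suc n] @ rev [j..<Suc n] \<in> set (pos_roots (B n))"
      unfolding roots_B using assms 2 by (intro disjI2 exI[of _ k] exI[of _ j]) auto
    ultimately show ?thesis unfolding e_def f_def by blast
  next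
    case 3 then show ?thesis using f_first[of i j] assms by blast
  next
    case 4 then show ?thesis using f_mid[of i k j] assms by blast
  next
    case 5
    then have "br (f i j) k (f i k)" using f_step[of i k] assms by auto
    moreover have "[i..<Suc n] @ rev [k..<Suc n] \<in> set (pos_roots (B n))"
      unfolding roots_B using assms 5 by (intro disjI2 exI[of _ i] exI[of _ k]) auto
    ultimately show ?thesis unfolding e_def f_def by blast
  next
    case 6 then show ?thesis using f_end[of i j] assms by blast
  next
    case 7 then show ?thesis using f_n_n[of i] assms by blast
  next
    case 8 then show ?thesis using f_up[of i j k] assms by blast
  qed
qed

lemma table_B:
  assumes "\<beta> \<in> set (pos_roots (B n))" "k \<in> {1..n}"
  shows "\<exists>Y. br (wd \<beta>) k Y \<and> (Y = zs \<or> (\<exists>\<gamma>\<in>set (pos_roots (B n)). Y = wd \<gamma> \<or> Y = ns (wd \<gamma>)))"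
  using assms(1) unfolding roots_B
proof (elim disjE exE conjE)
  fix i j assume *: "1 \<le> i" "i \<le> j" "j \<le> n" "\<beta> = [i..<Suc j]"
  show ?thesis unfolding *(4) by (rule table_e[unfolded e_def]) (use * assms(2) in auto)
next
  fix i j assume *: "1 \<le> i" "i < j" "j \<le> n" "\<beta> = [i..<Suc n] @ rev [j..<Suc n]"
  show ?thesis unfolding *(4) by (rule table_f[unfolded f_def]) (use * assms(2) in auto)
qed

lemma chain_B:
  assumes "\<beta> \<in> set (pos_roots (B n))"
  shows "chain \<beta>"
proof -
  have ch: "chain [i..<Suc j]" if "1 \<le> i" "i \<le> j" "j \<le> n" for i j
    using that(2,3)
  proof (induction j rule: dec_induct)
    case base
    then show ?case using chain_single[of i] by simp
  next
    case (step j)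
    have "[i..<Suc (Suc j)] = [i..<Suc j] @ [Suc j]" using step by simp
    then show ?case using chain_snoc[of "[i..<Suc j]" "Suc j"] e_step[of i j, unfolded e_def] step that by simp
  qed
  have "chain ([i..<Suc n] @ rev [j..<Suc n])" if "1 \<le> i" "i < j" "j \<le> n" for i j
    using that(3,2)
  proof (induction j rule: inc_induct)
    case base
    have "[i..<Suc n] @ rev [n..<Suc n] = [i..<Suc n] @ [n]" by simp
    then show ?case using chain_snoc[OF ch[of i n], of n] e_top[of i, unfolded e_def f_def] base that by simp
  next
    case (step j)
    have "[i..<Suc n] @ rev [j..<Suc n] = ([i..<Suc n] @ rev [Suc j..<Suc n]) @ [j]"
      using step by (simp add: upt_conv_Cons[of j])
    then show ?case
      using chain_snoc[of "[i..<Suc n] @ rev [Suc j..<Suc n]" j] f_step[of i j, unfolded f_def] step that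
      by (simp del: upt_Suc)
  qed
  then show ?thesis using assms ch unfolding roots_B by (auto simp del: upt_Suc)
qed

end

section \<open>Positive roots of type \<open>G\<^sub>2\<close>\<close>

locale loop_lie_G = loop_lie Z L x "{1, 2}"
  for Z :: "nat \<Rightarrow> 'a::ring_1 set" and L and x +
  assumes serre_1: "commutator (commutator (x 2 r) (x 1 0)) (x 1 0) \<in> Z r"
    and serre_2: "commutator (commutator (commutator (commutator (x 1 r) (x 2 0)) (x 2 0)) (x 2 0)) (x 2 0) \<in> Z r"
begin

lemma b12: "br (wd [1]) 2 (wd [1, 2])"
  using br_x[of 1 2] by (simp add: wd_snoc[of "[1]", simplified])

lemma b12x: "br (x 1) 2 (wd [1, 2])"
  using b12 by (simp only: wd_single)

lemma b121: "br (wd [1, 2]) 1 zs"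
proof -
  have 1: "br (x 2) 1 (ns (wd [1, 2]))" by (rule br_x_flip[OF _ _ br_br0[OF b12x]]) simp_all
  have "br (ns (wd [1, 2])) 1 zs" by (rule br_twice_zs[OF 1]) (rule serre_1)
  then show ?thesis using br_ns_zs by blast
qed

lemma b122: "br (wd [1, 2]) 2 (wd [1, 2, 2])"
  using br_twice[OF b12] by (simp add: wd_snoc[of "[1, 2]", simplified])

lemma b1222: "br (wd [1, 2, 2]) 2 (wd [1, 2, 2, 2])"
  using br_twice[OF b122] by (simp add: wd_snoc[of "[1, 2, 2]", simplified])

lemma b12222: "br (wd [1, 2, 2, 2]) 2 zs"
  by (rule br_twice_zs[OF b1222])
    (use serre_2 in \<open>simp add: wd_snoc[of "[1, 2]", simplified] wd_snoc[of "[1]", simplified]\<close>)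

text \<open>The sum is 2(alpha_1 + alpha_2), twice a root; it is excluded by antisymmetry of the
  bracket of \<open>wd [1, 2]\<close> with itself.\<close>

lemma b1221: "br (wd [1, 2, 2]) 1 zs"
  using br_self_bracket[of 1 2 "wd [1, 2]" "wd [1, 2, 2]"] b12 b121 b122 by simp

text \<open>The highest root. A left-nested bracket along its word would be negligible, because the
  letter 1 already kills \<open>wd [1, 2]\<close>.\<close>

definition th :: "nat \<Rightarrow> 'a" where
  "th s = C (wd [1, 2] s) (wd [1, 2, 2] 0)"

lemma wd_L: "wd [1] s \<in> L s" "wd [1, 2] s \<in> L s" "wd [1, 2, 2] s \<in> L s" "wd [1, 2, 2, 2] s \<in> L s"
  using brD(3)[OF b12] brD(3)[OF b122] brD(3)[OF b1222] brD(3)[OF b12222] by auto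

lemma b12221: "br (wd [1, 2, 2, 2]) 1 (ap (wd [1, 2, 2, 2]) 1)"
  by (rule br_sum[OF b1222 b1221])

text \<open>The highest root vector does not depend on how the loop degree is distributed, because it is also
  \<open>[1222, 1]\<close>.\<close>

lemma th_eqv: "eqv (a + b) (C (wd [1, 2] a) (wd [1, 2, 2] b)) (C (wd [1, 2, 2, 2] (a + b)) (x 1 0))"
proof -
  have 1: "eqv a (wd [1, 2] a) (C (x 1 a) (x 2 0))" using br_eqv0[OF b12] by simp
  have "C (wd [1, 2] a) (wd [1, 2, 2] b) = - C (wd [1, 2, 2] b) (wd [1, 2] a)"
    by (rule commutator_antisym)
  also have "eqv (a + b) \<dots> (- C (wd [1, 2, 2] b) (C (x 1 a) (x 2 0)))"
    using eqv_uminus[OF eqv_C'[OF 1 wd_L(3)[of b]]] .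
  also have "- C (wd [1, 2, 2] b) (C (x 1 a) (x 2 0)) =
      C (C (wd [1, 2, 2] b) (x 2 0)) (x 1 a) - C (C (wd [1, 2, 2] b) (x 1 a)) (x 2 0)"
    by (simp add: commutator_def algebra_simps)
  also have "eqv (a + b) \<dots> (C (wd [1, 2, 2, 2] (a + b)) (x 1 0) - 0)"
  proof (rule eqv_diff)
    have "eqv (a + b) (C (C (wd [1, 2, 2] b) (x 2 0)) (x 1 a)) (C (wd [1, 2, 2, 2] b) (x 1 a))"
      using eqv_C[OF brD(1)[OF b1222, of b 0] L_x[of 1 a]] by (simp add: add.commute)
    also have "eqv (a + b) \<dots> (C (wd [1, 2, 2, 2] (a + b)) (x 1 0))"
      using brD(1)[OF b12221, of b a] by (simp add: add.commute)
    finally show "eqv (a + b) (C (C (wd [1, 2, 2] b) (x 2 0)) (x 1 a)) (C (wd [1, 2, 2, 2] (a + b)) (x 1 0))" .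
    have "eqv (b + a) (C (wd [1, 2, 2] b) (x 1 a)) 0" using brD(1)[OF b1221, of b a] .
    from eqv_C0[OF this, of 2]
    show "eqv (a + b) (C (C (wd [1, 2, 2] b) (x 1 a)) (x 2 0)) 0"
      by (simp add: commutator_simps add.commute)
  qed
  finally show ?thesis by simp
qed

lemma bth: "br (wd [1, 2, 2, 2]) 1 th"
proof (rule br_replace[OF b12221])
  show "br0 (wd [1, 2, 2, 2]) 1 th" unfolding br0_def
  proof (intro allI conjI)
    fix s
    show "th s \<in> L s" unfolding th_def using L_br[OF wd_L(2)[of s] wd_L(3)[of 0]] by simp
    show "eqv s (C (wd [1, 2, 2, 2] s) (x 1 0)) (th s)"
      unfolding th_def using eqv_sym[OF th_eqv[of s 0]] by simp
  qed
qed

lemma th_eqv': "eqv (a + b) (C (wd [1, 2] a) (wd [1, 2, 2] b)) (th (a + b))"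
  using eqv_trans[OF th_eqv eqv_sym[OF th_eqv[of "a + b" 0, unfolded add_0_right]]] by (simp add: th_def)

lemma bth1: "br th 1 zs"
proof (rule br_replace[OF br_twice[OF bth]])
  show "br0 th 1 zs" unfolding br0_def
  proof (intro allI conjI)
    fix s
    have "C (th s) (x 1 0) = C (C (wd [1, 2] s) (x 1 0)) (wd [1, 2, 2] 0)
        + C (wd [1, 2] s) (C (wd [1, 2, 2] 0) (x 1 0))"
      unfolding th_def by (rule jacobi)
    moreover have "C (C (wd [1, 2] s) (x 1 0)) (wd [1, 2, 2] 0) \<in> Z s"
      using Z_br[OF br_Z[OF b121, of s] wd_L(3)[of 0]] by simp
    moreover have "C (wd [1, 2] s) (C (wd [1, 2, 2] 0) (x 1 0)) \<in> Z s"
      using Z_br'[OF br_Z[OF b1221, of 0] wd_L(2)[of s]] by simp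
    ultimately show "eqv s (C (th s) (x 1 0)) 0" by (simp add: eqv_0 Z_add)
  qed (rule L_0)
qed

text \<open>The sum is 2(alpha_1 + 2 alpha_2), again twice a root. With
  \<open>W = [th, x 2]\<close>, expanding \<open>th\<close> gives \<open>[122, 122] = 2 W\<close>
  modulo \<open>Z\<close> for every splitting of the degree, and antisymmetry then makes
  \<open>4 W\<close> negligible.\<close>

lemma bth2: "br th 2 zs"
proof -
  have st: "br th 2 (ap th 2)" by (rule br_sum[OF bth b12222])
  let ?W = "ap th 2"
  have A: "eqv (a + b) (C (wd [1, 2] a) (wd [1, 2, 2, 2] b)) (- ?W (a + b))" for a b
  proof -
    have 1: "eqv a (wd [1, 2] a) (C (x 1 a) (x 2 0))" using br_eqv0[OF b12] by simp
    have "C (wd [1, 2] a) (wd [1, 2, 2, 2] b) = - C (wd [1, 2, 2, 2] b) (wd [1, 2] a)"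
      by (rule commutator_antisym)
    also have "eqv (a + b) \<dots> (- C (wd [1, 2, 2, 2] b) (C (x 1 a) (x 2 0)))"
      using eqv_uminus[OF eqv_C'[OF 1 wd_L(4)[of b]]] .
    also have "- C (wd [1, 2, 2, 2] b) (C (x 1 a) (x 2 0)) =
        C (C (wd [1, 2, 2, 2] b) (x 2 0)) (x 1 a) - C (C (wd [1, 2, 2, 2] b) (x 1 a)) (x 2 0)"
      by (simp add: commutator_def algebra_simps)
    also have "eqv (a + b) \<dots> (0 - ?W (a + b))"
    proof (rule eqv_diff)
      show "eqv (a + b) (C (C (wd [1, 2, 2, 2] b) (x 2 0)) (x 1 a)) 0"
        using Z_br[OF br_Z[OF b12222, of b] L_x[of 1 a]] by (simp add: eqv_0 add.commute)
      show "eqv (a + b) (C (C (wd [1, 2, 2, 2] b) (x 1 a)) (x 2 0)) (?W (a + b))"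
        using eqv_C0[OF brD(1)[OF bth, of b a], of 2] by (simp add: add.commute)
    qed
    finally show ?thesis by simp
  qed
  have Bq: "eqv (a + b) (C (wd [1, 2, 2] a) (wd [1, 2, 2] b)) (?W (a + b) + ?W (a + b))" for a b
  proof -
    have "eqv (a + b) (?W (a + b)) (C (C (wd [1, 2] a) (wd [1, 2, 2] b)) (x 2 0))"
      using eqv_C0[OF eqv_sym[OF th_eqv'[of a b]], of 2] by simp
    also have "C (C (wd [1, 2] a) (wd [1, 2, 2] b)) (x 2 0) =
        C (C (wd [1, 2] a) (x 2 0)) (wd [1, 2, 2] b) + C (wd [1, 2] a) (C (wd [1, 2, 2] b) (x 2 0))"
      by (rule jacobi)
    also have "eqv (a + b) \<dots> (C (wd [1, 2, 2] a) (wd [1, 2, 2] b) + - ?W (a + b))"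
    proof (rule eqv_add)
      show "eqv (a + b) (C (C (wd [1, 2] a) (x 2 0)) (wd [1, 2, 2] b)) (C (wd [1, 2, 2] a) (wd [1, 2, 2] b))"
        using eqv_C[OF brD(1)[OF b122, of a 0] wd_L(3)[of b]] by simp
      have "eqv (a + b) (C (wd [1, 2] a) (C (wd [1, 2, 2] b) (x 2 0))) (C (wd [1, 2] a) (wd [1, 2, 2, 2] b))"
        using eqv_C'[OF brD(1)[OF b1222, of b 0] wd_L(2)[of a]] by (simp add: add.commute)
      also have "eqv (a + b) \<dots> (- ?W (a + b))" by (rule A)
      finally show "eqv (a + b) (C (wd [1, 2] a) (C (wd [1, 2, 2] b) (x 2 0))) (- ?W (a + b))" .
    qed
    finally have "eqv (a + b) (?W (a + b) + ?W (a + b))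
        (C (wd [1, 2, 2] a) (wd [1, 2, 2] b) + - ?W (a + b) + ?W (a + b))"
      by (rule eqv_add) simp
    then show ?thesis using eqv_sym by simp
  qed
  have "?W s \<in> Z s" for s
  proof -
    have "eqv s (C (wd [1, 2, 2] s) (wd [1, 2, 2] 0) + C (wd [1, 2, 2] 0) (wd [1, 2, 2] s))
       ((?W s + ?W s) + (?W s + ?W s))"
      using eqv_add[OF Bq[of s 0, unfolded add_0_right] Bq[of 0 s, unfolded add_0_left]] .
    moreover have "C (wd [1, 2, 2] s) (wd [1, 2, 2] 0) + C (wd [1, 2, 2] 0) (wd [1, 2, 2] s) = 0"
      by (simp add: commutator_def)
    ultimately have "(?W s + ?W s) + (?W s + ?W s) \<in> Z s"
      using eqv_sym by (metis eqv_0)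
    then show ?thesis by (blast dest: Z_double)
  qed
  then show ?thesis using br_replace[OF st] by (auto simp: br0_def L_0 eqv_0)
qed

definition wdG :: "nat list \<Rightarrow> nat \<Rightarrow> 'a" where
  "wdG \<beta> = (if \<beta> = [1,2,1,2,2] then th else wd \<beta>)"

lemma table_G:
  assumes "\<beta> \<in> set (pos_roots G2)" "k \<in> {1, 2}"
  shows "\<exists>Y. br (wdG \<beta>) k Y \<and> (Y = zs \<or> (\<exists>\<gamma>\<in>set (pos_roots G2). Y = wdG \<gamma> \<or> Y = ns (wdG \<gamma>)))"
proof -
  have w: "wdG [1] = wd [1]" "wdG [1,2] = wd [1,2]" "wdG [1,2,2] = wd [1,2,2]"
    "wdG [1,2,2,2] = wd [1,2,2,2]" "wdG [2] = wd [2]" "wdG [1,2,1,2,2] = th"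
    by (simp_all add: wdG_def)
  have g: "[1] \<in> set (pos_roots G2)" "[1,2] \<in> set (pos_roots G2)" "[1,2,2] \<in> set (pos_roots G2)"
    "[1,2,2,2] \<in> set (pos_roots G2)" "[1,2,1,2,2] \<in> set (pos_roots G2)"
    by simp_all
  have 11: "br (wd [1]) 1 zs" "br (wd [2]) 2 zs" using br_x_self[of 1] br_x_self[of 2] by simp_all
  have 21: "br (wd [2]) 1 (ns (wd [1, 2]))" unfolding wd_single by (rule br_x_flip[OF _ _ br_br0[OF b12x]]) simp_all
  from assms consider "\<beta> = [1]" "k = 1" | "\<beta> = [1]" "k = 2" | "\<beta> = [1,2]" "k = 1" | "\<beta> = [1,2]" "k = 2"
    | "\<beta> = [1,2,2]" "k = 1" | "\<beta> = [1,2,2]" "k = 2" | "\<beta> = [1,2,2,2]" "k = 1" | "\<beta> = [1,2,2,2]" "k = 2"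
    | "\<beta> = [1,2,1,2,2]" "k = 1" | "\<beta> = [1,2,1,2,2]" "k = 2" | "\<beta> = [2]" "k = 1" | "\<beta> = [2]" "k = 2"
    by auto
  then show ?thesis
  proof cases
    case 1 then show ?thesis using 11 w by metis
  next
    case 2 then show ?thesis using b12 w g by metis
  next
    case 3 then show ?thesis using b121 w by metis
  next
    case 4 then show ?thesis using b122 w g by metis
  next
    case 5 then show ?thesis using b1221 w by metis
  next
    case 6 then show ?thesis using b1222 w g by metis
  next
    case 7 then show ?thesis using bth w g by metis
  next
    case 8 then show ?thesis using b12222 w by metis
  next
    case 9 then show ?thesis using bth1 w by metis
  next
    case 10 then show ?thesis using bth2 w by metis
  next
    case 11 then show ?thesis using 21 w g by metis
  next
    case 12 then show ?thesis using \<open>br (wd [2]) 2 zs\<close> w by metis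
  qed
qed

lemma chain_G:
  assumes "\<beta> \<in> set (pos_roots G2)" "\<beta> \<noteq> [1,2,1,2,2]"
  shows "chain \<beta>"
proof -
  have "chain [1]" "chain [2]" by (rule chain_single)+
  moreover from this have c2: "chain [1, 2]" using chain_snoc[of "[1]" 2] b12 by simp
  moreover from this have c3: "chain [1, 2, 2]" using chain_snoc[of "[1, 2]" 2] b122 by simp
  moreover from this have "chain [1, 2, 2, 2]" using chain_snoc[of "[1, 2, 2]" 2] b1222 by simp
  ultimately show ?thesis using assms by auto
qed

lemma theta_eqv:
  "eqv (a + b + (c + d + e)) (C (C (x 1 a) (x 2 b)) (C (C (x 1 c) (x 2 d)) (x 2 e))) (th (a + b + (c + d + e)))"
proof -
  have 1: "eqv (a + b) (C (x 1 a) (x 2 b)) (wd [1, 2] (a + b))" for a b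
    using brD(1)[OF b12, of a b] by simp
  have L2: "C (C (x 1 c) (x 2 d)) (x 2 e) \<in> L (c + d + e)" by (intro L_br L_x) auto
  have "eqv (c + d + e) (C (C (x 1 c) (x 2 d)) (x 2 e)) (C (wd [1, 2] (c + d)) (x 2 e))"
    by (rule eqv_C[OF 1 L_x]) simp
  also have "eqv (c + d + e) \<dots> (wd [1, 2, 2] (c + d + e))" by (rule brD(1)[OF b122])
  finally have 2: "eqv (c + d + e) (C (C (x 1 c) (x 2 d)) (x 2 e)) (wd [1, 2, 2] (c + d + e))" .
  have "eqv (a + b + (c + d + e)) (C (C (x 1 a) (x 2 b)) (C (C (x 1 c) (x 2 d)) (x 2 e)))
     (C (wd [1, 2] (a + b)) (C (C (x 1 c) (x 2 d)) (x 2 e)))"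
    by (rule eqv_C[OF 1 L2])
  also have "eqv (a + b + (c + d + e)) \<dots> (C (wd [1, 2] (a + b)) (wd [1, 2, 2] (c + d + e)))"
    using eqv_C'[OF 2 wd_L(2)[of "a + b"]] by (simp add: add.commute add.left_commute)
  also have "eqv (a + b + (c + d + e)) \<dots> (th (a + b + (c + d + e)))" by (rule th_eqv')
  finally show ?thesis .
qed

end

section \<open>The free algebra\<close>

lemma scal_0 [simp]: "scal 0 = 0"
  by (simp add: scal_def)

lemma scal_1 [simp]: "scal 1 = 1"
  by (simp add: scal_def)

lemma scal_add: "scal (a + b) = scal a + scal b"
  by (simp add: scal_def single_add)

lemma scal_mult: "scal (a * b) = scal a * scal b"
  by (simp add: scal_def mult_single)

lemma poly_mapping_single_induct [case_names single add]:
  fixes f :: "'k \<Rightarrow>\<^sub>0 'b::ab_group_add"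
  assumes s: "\<And>k c. P (Poly_Mapping.single k c)" and a: "\<And>f g. P f \<Longrightarrow> P g \<Longrightarrow> P (f + g)"
  shows "P f"
proof (induction f rule: update_induct)
  case const
  then show ?case using s[of undefined 0] by simp
next
  case (update f k v)
  have "Poly_Mapping.update k v f = f + Poly_Mapping.single k v"
    using update(1) by (intro poly_mapping_eqI)
      (auto simp: lookup_update lookup_add lookup_single when_def not_in_keys_iff_lookup_eq_zero)
  then show ?case using a s update by metis
qed

lemma scal_central: "f * scal c = scal c * f"
  by (induction f rule: poly_mapping_single_induct)
    (simp_all add: scal_def mult_single algebra_simps)

lemma scal_left_commute: "f * (scal c * g) = scal c * (f * g)"
  by (metis mult.assoc scal_central)

text \<open>Rational scalars are kept apart from those in Q[hbar]: congruences modulo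
  \<open>Zs\<close> respect the former, whereas a factor \<open>hbar\<close> counts towards the
  degree.\<close>

definition Qscale :: "rat \<Rightarrow> free_elem \<Rightarrow> free_elem" where
  "Qscale q f = scal [:q:] * f"

global_interpretation fm: Modules.module "\<lambda>c f. scal c * f"
  by unfold_locales (simp_all add: algebra_simps scal_add scal_mult)

global_interpretation qv: vector_space Qscale
proof
  fix a b :: rat and x y :: free_elem
  show "Qscale a (x + y) = Qscale a x + Qscale a y" by (simp add: Qscale_def algebra_simps)
  have "[:a + b:] = [:a:] + [:b:]" by simp
  then show "Qscale (a + b) x = Qscale a x + Qscale b x"
    unfolding Qscale_def by (metis distrib_right scal_add)
  have "[:a * b:] = [:a:] * [:b:]" by simp
  then show "Qscale a (Qscale b x) = Qscale (a * b) x"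
    unfolding Qscale_def by (metis mult.assoc scal_mult)
  show "Qscale 1 x = x" by (simp add: Qscale_def flip: one_pCons)
qed

lemma univ_ring_simps [simp]:
  "carrier univ_ring = UNIV" "mult univ_ring = (*)" "one univ_ring = 1"
  "zero univ_ring = 0" "add univ_ring = (+)"
  by (simp_all add: univ_ring_def)

lemma free_alg_simps [simp]:
  "mult (free_alg I) = (*)" "one (free_alg I) = 1" "zero (free_alg I) = 0" "add (free_alg I) = (+)"
  by (simp_all add: free_alg_def univ_ring_def)

abbreviation falg :: "nat set \<Rightarrow> free_elem set" where
  "falg I \<equiv> carrier (free_alg I)"

lemma falg_iff: "f \<in> falg I \<longleftrightarrow> Poly_Mapping.keys f \<subseteq> Word ` lists (I \<times> UNIV)"
  by (simp add: free_alg_def)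

lemma falg_add: "f \<in> falg I \<Longrightarrow> g \<in> falg I \<Longrightarrow> f + g \<in> falg I"
  unfolding falg_iff using Poly_Mapping.keys_add[of f g] by blast

lemma falg_uminus: "f \<in> falg I \<Longrightarrow> - f \<in> falg I"
  by (simp add: falg_iff subset_iff in_keys_iff)

lemma falg_diff: "f \<in> falg I \<Longrightarrow> g \<in> falg I \<Longrightarrow> f - g \<in> falg I"
  using falg_add[of f I "- g"] falg_uminus by simp

lemma falg_mult: "f \<in> falg I \<Longrightarrow> g \<in> falg I \<Longrightarrow> f * g \<in> falg I"
proof -
  assume f: "f \<in> falg I" and g: "g \<in> falg I"
  show ?thesis unfolding falg_iff
  proof
    fix w assume "w \<in> Poly_Mapping.keys (f * g)"
    then obtain a b where w: "w = a + b" "a \<in> Poly_Mapping.keys f" "b \<in> Poly_Mapping.keys g"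
      using keys_mult[of f g] by blast
    obtain a' b' where "a = Word a'" "a' \<in> lists (I \<times> UNIV)" "b = Word b'" "b' \<in> lists (I \<times> UNIV)"
      using w f g unfolding falg_iff by blast
    then have "w = Word (a' @ b')" "a' @ b' \<in> lists (I \<times> UNIV)" using w(1) by auto
    then show "w \<in> Word ` lists (I \<times> UNIV)" by blast
  qed
qed

lemma falg_scal: "scal c \<in> falg I"
proof -
  have "Word [] \<in> Word ` lists (I \<times> UNIV)" by (rule imageI) simp
  moreover have "Poly_Mapping.keys (scal c) \<subseteq> {Word []}"
    by (simp add: scal_def zero_word_def)
  ultimately show ?thesis unfolding falg_iff by blast
qed

lemma falg_0: "0 \<in> falg I" and falg_1: "1 \<in> falg I"
  using falg_scal[of 0 I] falg_scal[of 1 I] by simp_all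

lemma falg_gen: "i \<in> I \<Longrightarrow> gen i r \<in> falg I"
proof -
  assume "i \<in> I"
  then have "Word [(i, r)] \<in> Word ` lists (I \<times> UNIV)" by (intro imageI) simp
  moreover have "Poly_Mapping.keys (gen i r) \<subseteq> {Word [(i, r)]}"
    by (simp add: gen_def)
  ultimately show ?thesis unfolding falg_iff by blast
qed

lemma falg_commutator: "f \<in> falg I \<Longrightarrow> g \<in> falg I \<Longrightarrow> commutator f g \<in> falg I"
  by (simp add: commutator_def falg_diff falg_mult)

lemma falg_sum: "(\<And>x. x \<in> S \<Longrightarrow> F x \<in> falg I) \<Longrightarrow> sum F S \<in> falg I"
  by (induction S rule: infinite_finite_induct) (auto simp: falg_0 falg_add)

lemmas falg_intros = falg_add falg_uminus falg_diff falg_mult falg_scal falg_0 falg_1 falg_gen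
  falg_commutator falg_sum

lemma free_alg_ring: "ring (free_alg I)"
proof (rule ringI)
  show "abelian_group (free_alg I)"
  proof (rule abelian_groupI)
    fix x assume "x \<in> carrier (free_alg I)"
    then show "\<exists>y\<in>carrier (free_alg I). y \<oplus>\<^bsub>free_alg I\<^esub> x = \<zero>\<^bsub>free_alg I\<^esub>"
      by (intro bexI[of _ "- x"]) (auto simp: falg_uminus)
  qed (auto simp: falg_intros algebra_simps)
  show "monoid (free_alg I)"
    by (rule monoidI) (auto simp: falg_intros algebra_simps)
qed (auto simp: algebra_simps)

lemma free_alg_a_inv: "f \<in> falg I \<Longrightarrow> \<ominus>\<^bsub>free_alg I\<^esub> f = - f"
proof -
  assume f: "f \<in> falg I"
  interpret ring "free_alg I" by (rule free_alg_ring)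
  show ?thesis using f by (intro minus_equality) (auto simp: falg_uminus)
qed

section \<open>The Yangian as a quotient\<close>

lemma yangian_relators_falg: "yangian_relators T \<subseteq> falg (index_set T)"
proof -
  have fold: "foldr (\<lambda>k. commutator (gen i (s (\<sigma> k)))) ks (gen j r) \<in> falg I"
    if "i \<in> I" "j \<in> I" for i j I s r \<sigma> ks
    using that by (induction ks) (auto intro!: falg_intros)
  then show ?thesis
    unfolding yangian_relators_def quadratic_relator_def serre_relator_def Let_def
    by (auto intro!: falg_intros)
qed

lemma yangian_ideal_ideal: "ideal (yangian_ideal T) (free_alg (index_set T))"
proof -
  interpret ring "free_alg (index_set T)" by (rule free_alg_ring)
  show ?thesis unfolding yangian_ideal_def by (rule genideal_ideal) (rule yangian_relators_falg)
qed

lemma yangian_relators_ideal: "yangian_relators T \<subseteq> yangian_ideal T"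
proof -
  interpret ring "free_alg (index_set T)" by (rule free_alg_ring)
  show ?thesis unfolding yangian_ideal_def by (rule genideal_self) (rule yangian_relators_falg)
qed

lemma yangian_ideal_minimal:
  "ideal K (free_alg (index_set T)) \<Longrightarrow> yangian_relators T \<subseteq> K \<Longrightarrow> yangian_ideal T \<subseteq> K"
proof -
  interpret ring "free_alg (index_set T)" by (rule free_alg_ring)
  show "ideal K (free_alg (index_set T)) \<Longrightarrow> yangian_relators T \<subseteq> K \<Longrightarrow> yangian_ideal T \<subseteq> K"
    unfolding yangian_ideal_def by (rule genideal_minimal)
qed

context
  fixes T :: cartan_type
begin

interpretation R: ring "free_alg (index_set T)" by (rule free_alg_ring)
interpretation J: ideal "yangian_ideal T" "free_alg (index_set T)" by (rule yangian_ideal_ideal)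

lemma ideal_falg: "f \<in> yangian_ideal T \<Longrightarrow> f \<in> falg (index_set T)"
  using J.a_subset by blast

lemma ideal_0: "0 \<in> yangian_ideal T"
  using J.zero_closed by simp

lemma ideal_add: "f \<in> yangian_ideal T \<Longrightarrow> g \<in> yangian_ideal T \<Longrightarrow> f + g \<in> yangian_ideal T"
  using J.a_closed[of f g] by simp

lemma ideal_mult_left: "f \<in> falg (index_set T) \<Longrightarrow> g \<in> yangian_ideal T \<Longrightarrow> f * g \<in> yangian_ideal T"
  using J.I_l_closed[of g f] by simp

lemma ideal_mult_right: "f \<in> falg (index_set T) \<Longrightarrow> g \<in> yangian_ideal T \<Longrightarrow> g * f \<in> yangian_ideal T"
  using J.I_r_closed[of g f] by simp

lemma ideal_scal: "g \<in> yangian_ideal T \<Longrightarrow> scal c * g \<in> yangian_ideal T"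
  by (simp add: ideal_mult_left falg_intros)

lemma ideal_uminus: "g \<in> yangian_ideal T \<Longrightarrow> - g \<in> yangian_ideal T"
  using ideal_mult_left[of "- 1" g] by (simp add: falg_intros)

lemma proj_eq: "proj T f = {j + f | j. j \<in> yangian_ideal T}"
  by (auto simp: proj_def a_r_coset_def r_coset_def)

lemma proj_eq_iff: "proj T f = proj T g \<longleftrightarrow> f - g \<in> yangian_ideal T"
proof
  assume "proj T f = proj T g"
  moreover have "f \<in> proj T f" using ideal_0 unfolding proj_eq by force
  ultimately show "f - g \<in> yangian_ideal T" unfolding proj_eq by auto
next
  assume *: "f - g \<in> yangian_ideal T"
  have sub: "proj T a \<subseteq> proj T b" if "a - b \<in> yangian_ideal T" for a b
  proof
    fix x assume "x \<in> proj T a"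
    then obtain j where "j \<in> yangian_ideal T" "x = j + a" unfolding proj_eq by blast
    then have "j + (a - b) \<in> yangian_ideal T" "x = (j + (a - b)) + b"
      using that ideal_add by auto
    then show "x \<in> proj T b" unfolding proj_eq by blast
  qed
  have "g - f \<in> yangian_ideal T" using ideal_uminus[OF *] by simp
  then show "proj T f = proj T g" using sub * by blast
qed

text \<open>Computation in the quotient on representatives; from here on cosets are handled through
  \<open>proj\<close> only.\<close>

lemma yangian_simps:
  "carrier (yangian T) = proj T ` falg (index_set T)"
  "one (yangian T) = proj T 1" "zero (yangian T) = proj T 0"
  "f \<in> falg (index_set T) \<Longrightarrow> g \<in> falg (index_set T) \<Longrightarrow>
     proj T f \<otimes>\<^bsub>yangian T\<^esub> proj T g = proj T (f * g)"
  "f \<in> falg (index_set T) \<Longrightarrow> g \<in> falg (index_set T) \<Longrightarrow>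
     proj T f \<oplus>\<^bsub>yangian T\<^esub> proj T g = proj T (f + g)"
  "f \<in> falg (index_set T) \<Longrightarrow> c \<odot>\<^bsub>yangian T\<^esub> proj T f = proj T (scal c * f)"
proof -
  have z: "yangian_ideal T = proj T 0"
    unfolding proj_eq by simp
  show "carrier (yangian T) = proj T ` falg (index_set T)"
    by (auto simp: yangian_def FactRing_def A_RCOSETS_def RCOSETS_def a_r_coset_def proj_def Let_def)
  show "one (yangian T) = proj T 1" "zero (yangian T) = proj T 0"
    using z by (simp_all add: yangian_def FactRing_def Let_def) (simp add: proj_def)
  show m: "proj T f \<otimes>\<^bsub>yangian T\<^esub> proj T g = proj T (f * g)"
    if "f \<in> falg (index_set T)" "g \<in> falg (index_set T)" for f g
    using J.rcoset_mult_add[OF that] by (simp add: yangian_def FactRing_def Let_def proj_def)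
  show "proj T f \<oplus>\<^bsub>yangian T\<^esub> proj T g = proj T (f + g)"
    if "f \<in> falg (index_set T)" "g \<in> falg (index_set T)"
    using J.a_rcos_sum[OF that] by (simp add: yangian_def FactRing_def Let_def proj_def)
  show "c \<odot>\<^bsub>yangian T\<^esub> proj T f = proj T (scal c * f)" if "f \<in> falg (index_set T)"
    using m[OF falg_scal that] by (simp add: yangian_def Let_def)
qed

lemma yangian_carrierE:
  assumes "X \<in> carrier (yangian T)"
  obtains f where "f \<in> falg (index_set T)" "X = proj T f"
  using assms yangian_simps(1) by blast

lemma proj_carrier: "f \<in> falg (index_set T) \<Longrightarrow> proj T f \<in> carrier (yangian T)"
  by (simp add: yangian_simps)

lemma yangian_ring: "ring (yangian T)"
proof -
  have q: "ring (free_alg (index_set T) Quot yangian_ideal T)"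
    by (rule J.quotient_is_ring)
  show ?thesis
  proof (rule ringI)
    show "abelian_group (yangian T)"
    proof (rule abelian_groupI)
      fix x assume "x \<in> carrier (yangian T)"
      then obtain f where f: "f \<in> falg (index_set T)" "x = proj T f" by (rule yangian_carrierE)
      show "\<exists>y\<in>carrier (yangian T). y \<oplus>\<^bsub>yangian T\<^esub> x = \<zero>\<^bsub>yangian T\<^esub>"
        by (rule bexI[of _ "proj T (- f)"])
          (simp_all add: f yangian_simps(2-) proj_carrier falg_uminus)
    qed (((elim yangian_carrierE)?; simp add: yangian_simps(2-) proj_carrier falg_intros algebra_simps)+)
    show "monoid (yangian T)"
      by (rule monoidI; (elim yangian_carrierE)?;
        simp add: yangian_simps(2-) proj_carrier falg_intros algebra_simps)
  qed (elim yangian_carrierE;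
      simp add: yangian_simps(2-) proj_carrier falg_intros algebra_simps)+
qed

lemma yangian_a_inv: "f \<in> falg (index_set T) \<Longrightarrow> \<ominus>\<^bsub>yangian T\<^esub> proj T f = proj T (- f)"
proof -
  assume f: "f \<in> falg (index_set T)"
  interpret Y: ring "yangian T" by (rule yangian_ring)
  show ?thesis using f
    by (intro Y.minus_equality) (auto simp: yangian_simps(2-) proj_carrier falg_intros)
qed

lemma yangian_lie:
  "f \<in> falg (index_set T) \<Longrightarrow> g \<in> falg (index_set T) \<Longrightarrow>
   lie (yangian T) (proj T f) (proj T g) = proj T (commutator f g)"
  by (simp add: lie_def a_minus_def yangian_simps yangian_a_inv falg_intros commutator_def)

lemma Q_hbar_cring: "cring Q_hbar"
proof (rule cringI)
  show "abelian_group Q_hbar"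
  proof (rule abelian_groupI)
    fix x :: "rat poly"
    show "\<exists>y\<in>carrier Q_hbar. y \<oplus>\<^bsub>Q_hbar\<^esub> x = \<zero>\<^bsub>Q_hbar\<^esub>"
      by (rule bexI[of _ "- x"]) simp_all
  qed (simp_all add: algebra_simps)
  show "Group.comm_monoid Q_hbar"
    by (rule comm_monoidI) (auto simp: algebra_simps)
qed (auto simp: algebra_simps)

lemma yangian_module: "module Q_hbar (yangian T)"
proof (rule moduleI[OF Q_hbar_cring])
  interpret Y: ring "yangian T" by (rule yangian_ring)
  show "abelian_group (yangian T)" by (rule Y.abelian_group_axioms)
  fix a b x y assume x: "x \<in> carrier (yangian T)" and y: "y \<in> carrier (yangian T)"
  obtain f where f: "f \<in> falg (index_set T)" "x = proj T f" using x by (rule yangian_carrierE)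
  obtain g where g: "g \<in> falg (index_set T)" "y = proj T g" using y by (rule yangian_carrierE)
  note s = yangian_simps(2-) proj_carrier falg_scal falg_mult falg_add f g
  show "a \<odot>\<^bsub>yangian T\<^esub> x \<in> carrier (yangian T)" by (simp add: s)
  show "(a \<oplus>\<^bsub>Q_hbar\<^esub> b) \<odot>\<^bsub>yangian T\<^esub> x = a \<odot>\<^bsub>yangian T\<^esub> x \<oplus>\<^bsub>yangian T\<^esub> b \<odot>\<^bsub>yangian T\<^esub> x"
    by (simp add: s scal_add distrib_right)
  show "a \<odot>\<^bsub>yangian T\<^esub> (x \<oplus>\<^bsub>yangian T\<^esub> y) = a \<odot>\<^bsub>yangian T\<^esub> x \<oplus>\<^bsub>yangian T\<^esub> a \<odot>\<^bsub>yangian T\<^esub> y"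
    unfolding f(2) g(2) by (simp only: yangian_simps(5,6) falg_scal falg_mult falg_add f(1) g(1) distrib_left)
  show "(a \<otimes>\<^bsub>Q_hbar\<^esub> b) \<odot>\<^bsub>yangian T\<^esub> x = a \<odot>\<^bsub>yangian T\<^esub> (b \<odot>\<^bsub>yangian T\<^esub> x)"
    unfolding f(2) univ_ring_simps
    by (simp only: yangian_simps(6) falg_scal falg_mult f(1) scal_mult mult.assoc)
  show "\<one>\<^bsub>Q_hbar\<^esub> \<odot>\<^bsub>yangian T\<^esub> x = x" by (simp add: s)
qed

end

section \<open>Lifts of root vectors and monomials to the free algebra\<close>

definition lnest :: "free_elem list \<Rightarrow> free_elem" where
  "lnest xs = foldl commutator (hd xs) (tl xs)"

text \<open>Root vectors are lifted to the free algebra, where type class arithmetic is available;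
  congruence modulo the ideal replaces equality in the Yangian.\<close>

definition rvec :: "cartan_type \<Rightarrow> (nat list \<Rightarrow> nat \<Rightarrow> nat list) \<Rightarrow> nat list \<times> nat \<Rightarrow> free_elem" where
  "rvec T \<delta> = (\<lambda>(\<beta>, s).
    let xs = map2 gen \<beta> (\<delta> \<beta> s) in
    if T = G2 \<and> \<beta> = [1,2,1,2,2]
    then commutator (commutator (xs ! 0) (xs ! 1)) (commutator (commutator (xs ! 2) (xs ! 3)) (xs ! 4))
    else lnest xs)"

lemma pos_roots_ne: "\<beta> \<in> set (pos_roots T) \<Longrightarrow> \<beta> \<noteq> []"
  by (cases T) auto

lemma pos_roots_index: "\<beta> \<in> set (pos_roots T) \<Longrightarrow> set \<beta> \<subseteq> index_set T"
  by (cases T) auto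

lemma lnest_proj:
  assumes "xs \<noteq> []" "set xs \<subseteq> falg (index_set T)"
  shows "lnest xs \<in> falg (index_set T) \<and> left_nested (yangian T) (map (proj T) xs) = proj T (lnest xs)"
proof -
  have "foldl commutator x ys \<in> falg (index_set T) \<and>
      foldl (lie (yangian T)) (proj T x) (map (proj T) ys) = proj T (foldl commutator x ys)"
    if "x \<in> falg (index_set T)" "set ys \<subseteq> falg (index_set T)" for x ys
    using that by (induction ys arbitrary: x) (auto simp: yangian_lie falg_intros)
  then show ?thesis using assms by (cases xs) (auto simp: lnest_def left_nested_def)
qed

lemma root_vector_proj:
  assumes "decomposition T \<delta>" "\<beta> \<in> set (pos_roots T)"
  shows "rvec T \<delta> (\<beta>, s) \<in> falg (index_set T)"
    and "root_vector T \<delta> (\<beta>, s) = proj T (rvec T \<delta> (\<beta>, s))"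
proof -
  let ?xs = "map2 gen \<beta> (\<delta> \<beta> s)"
  have len: "length (\<delta> \<beta> s) = length \<beta>" using assms by (auto simp: decomposition_def)
  have m: "map2 (yangian_gen T) \<beta> (\<delta> \<beta> s) = map (proj T) ?xs"
    by (auto simp: yangian_gen_def)
  have sub: "set ?xs \<subseteq> falg (index_set T)"
    using pos_roots_index[OF assms(2)] by (auto dest!: set_zip_leftD intro!: falg_gen)
  have ne: "?xs \<noteq> []" using pos_roots_ne[OF assms(2)] len by auto
  have "rvec T \<delta> (\<beta>, s) \<in> falg (index_set T) \<and> root_vector T \<delta> (\<beta>, s) = proj T (rvec T \<delta> (\<beta>, s))"
  proof (cases "T = G2 \<and> \<beta> = [1,2,1,2,2]")
    case False
    then have "rvec T \<delta> (\<beta>, s) = lnest ?xs"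
      "root_vector T \<delta> (\<beta>, s) = left_nested (yangian T) (map (proj T) ?xs)"
      unfolding rvec_def root_vector_def Let_def by (simp_all only: prod.case if_False m)
    then show ?thesis using lnest_proj[OF ne sub] by simp
  next
    case True
    then have l5: "length ?xs = 5" using len by simp
    then have in5: "?xs ! k \<in> falg (index_set T)" if "k < 5" for k
      using sub nth_mem[of k ?xs] that by auto
    have X: "?xs ! 0 \<in> falg (index_set T)" "?xs ! 1 \<in> falg (index_set T)"
      "?xs ! 2 \<in> falg (index_set T)" "?xs ! 3 \<in> falg (index_set T)" "?xs ! 4 \<in> falg (index_set T)"
      by (rule in5; simp)+
    have map5: "map (proj T) ?xs ! k = proj T (?xs ! k)" if "k < 5" for k
      using l5 that by (intro nth_map) simp
    have M: "map (proj T) ?xs ! 0 = proj T (?xs ! 0)" "map (proj T) ?xs ! 1 = proj T (?xs ! 1)"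
      "map (proj T) ?xs ! 2 = proj T (?xs ! 2)" "map (proj T) ?xs ! 3 = proj T (?xs ! 3)"
      "map (proj T) ?xs ! 4 = proj T (?xs ! 4)"
      by (rule map5; simp)+
    have E: "rvec T \<delta> (\<beta>, s) = commutator (commutator (?xs ! 0) (?xs ! 1))
        (commutator (commutator (?xs ! 2) (?xs ! 3)) (?xs ! 4))"
      "root_vector T \<delta> (\<beta>, s) =
        lie (yangian T) (lie (yangian T) (map (proj T) ?xs ! 0) (map (proj T) ?xs ! 1))
          (lie (yangian T) (lie (yangian T) (map (proj T) ?xs ! 2) (map (proj T) ?xs ! 3))
            (map (proj T) ?xs ! 4))"
      unfolding rvec_def root_vector_def Let_def prod.case
      by (simp_all only: if_P[OF True] m)
    show ?thesis
      unfolding E M using X by (simp only: yangian_lie falg_commutator simp_thms)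
  qed
  then show "rvec T \<delta> (\<beta>, s) \<in> falg (index_set T)"
    "root_vector T \<delta> (\<beta>, s) = proj T (rvec T \<delta> (\<beta>, s))" by auto
qed

text \<open>As a list of factors a monomial can be sorted by adjacent swaps and compared as a
  multiset.\<close>

definition expand :: "cartan_type \<Rightarrow> (nat list \<times> nat \<Rightarrow> nat) \<Rightarrow> (nat list \<times> nat) list" where
  "expand T h = concat (map (\<lambda>p. replicate (h p) p) (ordered_support T h))"

definition root_mono :: "cartan_type \<Rightarrow> (nat list \<Rightarrow> nat \<Rightarrow> nat list) \<Rightarrow> (nat list \<times> nat) list \<Rightarrow> free_elem" where
  "root_mono T \<delta> ps = prod_list (map (rvec T \<delta>) ps)"

definition bmono :: "cartan_type \<Rightarrow> (nat list \<Rightarrow> nat \<Rightarrow> nat list) \<Rightarrow> (nat list \<times> nat) list \<Rightarrow> free_elem" where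
  "bmono T \<delta> ps = scal (hbar ^ length ps) * root_mono T \<delta> ps"

lemma bmono_Nil [simp]: "bmono T \<delta> [] = 1"
  by (simp add: bmono_def root_mono_def)

lemma bmono_append: "bmono T \<delta> (ps @ qs) = bmono T \<delta> ps * bmono T \<delta> qs"
proof -
  have "(scal a * x) * (scal b * y) = scal (a * b) * (x * y)" for a b x y
    unfolding scal_mult mult.assoc by (subst scal_left_commute[of x]) (rule refl)
  then show ?thesis by (simp add: bmono_def root_mono_def power_add)
qed

lemma set_ordered_support:
  assumes "h \<in> exponents T"
  shows "set (ordered_support T h) = {p. h p \<noteq> 0}"
proof -
  have "finite {s. h (\<beta>, s) \<noteq> 0}" for \<beta>
    using assms finite_vimageI[of "{p. h p \<noteq> 0}" "Pair \<beta>"]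
    by (auto simp: exponents_def vimage_def inj_on_def)
  then show ?thesis using assms by (auto simp: exponents_def ordered_support_def subset_iff)
qed

lemma mono_falg:
  assumes "decomposition T \<delta>" "set ps \<subseteq> set (pos_roots T) \<times> UNIV"
  shows "root_mono T \<delta> ps \<in> falg (index_set T)"
  using assms(2)
proof (induction ps)
  case (Cons p ps)
  then show ?case using root_vector_proj(1)[OF assms(1), of "fst p" "snd p"]
    by (auto simp: root_mono_def intro!: falg_mult)
qed (simp add: root_mono_def falg_1)

lemma bmono_falg:
  assumes "decomposition T \<delta>" "set ps \<subseteq> set (pos_roots T) \<times> UNIV"
  shows "bmono T \<delta> ps \<in> falg (index_set T)"
  unfolding bmono_def by (intro falg_intros mono_falg assms)

lemma bar_root_vector_proj:
  assumes "decomposition T \<delta>" "p \<in> set (pos_roots T) \<times> UNIV"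
  shows "bar_root_vector T \<delta> p = proj T (bmono T \<delta> [p])"
  using root_vector_proj[OF assms(1), of "fst p" "snd p"] assms(2)
  by (auto simp: bar_root_vector_def bmono_def root_mono_def yangian_simps)

lemma bar_power_proj:
  assumes "decomposition T \<delta>" "p \<in> set (pos_roots T) \<times> UNIV"
  shows "bar_root_vector T \<delta> p [^]\<^bsub>yangian T\<^esub> (k::nat) = proj T (bmono T \<delta> (replicate k p))"
proof (induction k)
  case 0
  interpret Y: ring "yangian T" by (rule yangian_ring)
  show ?case by (simp add: yangian_simps)
next
  case (Suc k)
  interpret Y: ring "yangian T" by (rule yangian_ring)
  have b: "bmono T \<delta> ps \<in> falg (index_set T)" if "set ps \<subseteq> {p}" for ps
    using bmono_falg[OF assms(1), of ps] assms(2) that by blast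
  have "bmono T \<delta> (replicate (Suc k) p) = bmono T \<delta> (replicate k p) * bmono T \<delta> [p]"
    by (simp flip: bmono_append replicate_append_same)
  then show ?case using Suc
    using b[of "replicate k p"] b[of "[p]"] set_replicate_conv_if[of k p]
    by (simp add: bar_root_vector_proj[OF assms] yangian_simps Y.nat_pow_Suc
        del: replicate_Suc set_replicate split: if_splits)
qed

lemma ordered_monomial_proj:
  assumes "decomposition T \<delta>" "h \<in> exponents T"
  shows "ordered_monomial T \<delta> h = proj T (bmono T \<delta> (expand T h))"
proof -
  have "foldr (\<lambda>p z. (bar_root_vector T \<delta> p [^]\<^bsub>yangian T\<^esub> h p) \<otimes>\<^bsub>yangian T\<^esub> z) ps \<one>\<^bsub>yangian T\<^esub>
      = proj T (bmono T \<delta> (concat (map (\<lambda>p. replicate (h p) p) ps)))"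
    if "set ps \<subseteq> set (pos_roots T) \<times> UNIV" for ps
    using that
  proof (induction ps)
    case (Cons p ps)
    have "bmono T \<delta> (replicate (h p) p) \<in> falg (index_set T)"
      using Cons(2) by (intro bmono_falg[OF assms(1)]) auto
    moreover have "bmono T \<delta> (concat (map (\<lambda>p. replicate (h p) p) ps)) \<in> falg (index_set T)"
      using Cons(2) by (intro bmono_falg[OF assms(1)]) auto
    ultimately show ?case using Cons by (simp add: bar_power_proj[OF assms(1)] yangian_simps bmono_append)
  qed (simp add: yangian_simps)
  then show ?thesis
    unfolding ordered_monomial_def expand_def
    using set_ordered_support[OF assms(2)] assms(2) by (auto simp: exponents_def)
qed

section \<open>The Rees-type subalgebra\<close>

text \<open>The degree labels a way of building the element and is not a function of it; zero, for
  instance, carries many degrees.\<close>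

inductive lw :: "nat set \<Rightarrow> nat \<Rightarrow> free_elem \<Rightarrow> bool" for I where
  gen: "i \<in> I \<Longrightarrow> lw I r (gen i r)"
| comm: "lw I d f \<Longrightarrow> lw I e g \<Longrightarrow> lw I (d + e) (commutator f g)"

inductive pw :: "nat set \<Rightarrow> nat \<Rightarrow> nat \<Rightarrow> free_elem \<Rightarrow> bool" for I where
  one: "pw I 0 0 1"
| mult: "lw I d f \<Longrightarrow> pw I k e g \<Longrightarrow> pw I (Suc k) (d + e) (f * g)"

lemma lw_falg: "lw I d f \<Longrightarrow> f \<in> falg I"
  by (induction rule: lw.induct) (auto intro: falg_gen falg_commutator)

lemma pw_falg: "pw I k e g \<Longrightarrow> g \<in> falg I"
  by (induction rule: pw.induct) (auto intro: falg_1 falg_mult lw_falg)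

lemma pw_lw: "lw I d f \<Longrightarrow> pw I 1 d f"
  using pw.mult[OF _ pw.one] by fastforce

lemma pw_mult: "pw I k e g \<Longrightarrow> pw I k' e' g' \<Longrightarrow> pw I (k + k') (e + e') (g * g')"
proof (induction rule: pw.induct)
  case (mult d f k e g)
  then show ?case using pw.mult[of I d f "k + k'" "e + e'" "g * g'"] by (simp add: mult.assoc add.assoc)
qed simp

lemma qspan_image:
  assumes "f \<in> qv.span A" and lin: "\<And>a b. F (a + b) = F a + F b" "\<And>q a. F (Qscale q a) = Qscale q (F a)"
    and "\<And>a. a \<in> A \<Longrightarrow> F a \<in> qv.span B'"
  shows "F f \<in> qv.span B'"
  using assms(1)
proof (induction rule: qv.span_induct_alt)
  case base
  have "F 0 = 0" using lin(2)[of 0 0] by simp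
  then show ?case by (simp add: qv.span_zero)
next
  case (step c a b)
  then show ?case using assms(4) by (simp add: lin qv.span_add qv.span_scale)
qed

lemma fspan_image:
  assumes "f \<in> fm.span A" and lin: "\<And>a b. F (a + b) = F a + F b" "\<And>q a. F (scal q * a) = scal q * F a"
    and "\<And>a. a \<in> A \<Longrightarrow> F a \<in> fm.span B'"
  shows "F f \<in> fm.span B'"
  using assms(1)
proof (induction rule: fm.span_induct_alt)
  case base
  have "F 0 = 0" using lin(2)[of 0 0] by simp
  then show ?case by (simp add: fm.span_zero)
next
  case (step c a b)
  then show ?case using assms(4) by (simp add: lin fm.span_add fm.span_scale)
qed

lemma qspan_fspan: "f \<in> qv.span A \<Longrightarrow> A \<subseteq> fm.span B' \<Longrightarrow> f \<in> fm.span B'"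
proof (induction rule: qv.span_induct_alt)
  case (step c a b)
  then show ?case by (auto simp: Qscale_def intro!: fm.span_add fm.span_scale)
qed (simp add: fm.span_zero)

lemma Qscale_mult: "a * Qscale q b = Qscale q (a * b)" "Qscale q b * a = Qscale q (b * a)"
  "scal c * Qscale q b = Qscale q (scal c * b)"
  by (simp_all only: Qscale_def mult.assoc scal_left_commute[of a] scal_left_commute[of "scal c"])

lemma commutator_Qscale: "commutator (Qscale q a) b = Qscale q (commutator a b)"
  "commutator b (Qscale q a) = Qscale q (commutator b a)"
  by (simp_all add: commutator_def Qscale_mult qv.scale_right_diff_distrib)

lemma commutator_scal: "commutator (scal c * a) b = scal c * commutator a b"
  by (simp add: commutator_def mult.assoc scal_left_commute[of b] right_diff_distrib)

lemma commutator_mult_left: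
  "commutator (f * g) b = f * commutator g b + commutator f b * g" for f :: "'a::ring_1"
  by (simp add: commutator_def algebra_simps)

text \<open>The derivation rule: bracketing a product with a Lie word turns one factor into a longer
  Lie word, so the number of factors stays the same. This is why brackets preserve negligible
  elements.\<close>

lemma pw_commutator:
  "pw I k d g \<Longrightarrow> lw I e b \<Longrightarrow> commutator g b \<in> qv.span {f. pw I k (d + e) f}"
proof (induction rule: pw.induct)
  case one
  then show ?case by (simp add: commutator_def qv.span_zero)
next
  case (mult d f k d' g)
  have "f * commutator g b \<in> qv.span {f. pw I (Suc k) (d + d' + e) f}"
  proof (rule qspan_image[OF mult.IH[OF mult.prems]])
    fix a assume "a \<in> {f. pw I k (d' + e) f}"
    then show "f * a \<in> qv.span {f. pw I (Suc k) (d + d' + e) f}"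
      using pw.mult[OF mult.hyps(1), of k "d' + e" a] by (auto intro!: qv.span_base simp: add.assoc)
  qed (simp_all add: distrib_left Qscale_mult)
  moreover have "pw I (Suc k) (d + e + d') (commutator f b * g)"
    using pw.mult[OF lw.comm[OF mult.hyps(1) mult.prems] mult.hyps(2)] .
  then have "commutator f b * g \<in> qv.span {f. pw I (Suc k) (d + d' + e) f}"
    by (auto intro!: qv.span_base simp: add.assoc add.left_commute add.commute)
  ultimately show ?case by (simp add: commutator_mult_left qv.span_add)
qed

text \<open>The bound \<open>k \<le> b + 1\<close> is what makes \<open>\<hbar>\<close> times such an element lie in the algebra generated by \<open>\<hbar>\<close> times
  Lie words; \<open>1 \<le> b\<close> lowers the loop degree \<open>e\<close>, so that inductions terminate.\<close>

definition Zgen :: "nat set \<Rightarrow> nat \<Rightarrow> free_elem set" where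
  "Zgen I d = {scal (hbar ^ b) * g | b k e g. pw I k e g \<and> 1 \<le> b \<and> k \<le> Suc b \<and> b + e = d}"

definition Zs :: "cartan_type \<Rightarrow> nat \<Rightarrow> free_elem set" where
  "Zs T d = qv.span (Zgen (index_set T) d \<union> yangian_ideal T)"

definition Lsp :: "cartan_type \<Rightarrow> nat \<Rightarrow> free_elem set" where
  "Lsp T d = qv.span {f. lw (index_set T) d f}"

lemma of_nat_scal: "of_nat m * f = Qscale (of_nat m) f" for f :: free_elem
proof -
  have "scal [:of_nat m:] = (of_nat m :: free_elem)"
    by (simp add: scal_def flip: of_nat_poly)
  then show ?thesis by (simp add: Qscale_def)
qed

lemma relators_Zs: "f \<in> yangian_relators T \<Longrightarrow> f \<in> Zs T d"
  unfolding Zs_def using yangian_relators_ideal[of T] by (blast intro: qv.span_base)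

lemma loop_lie_yangian: "loop_lie (Zs T) (Lsp T) gen (index_set T)"
proof
  let ?I = "index_set T"
  show "0 \<in> Zs T d" for d by (simp add: Zs_def qv.span_zero)
  show "a + b \<in> Zs T d" if "a \<in> Zs T d" "b \<in> Zs T d" for a b d
    using that by (simp add: Zs_def qv.span_add)
  show "- a \<in> Zs T d" if "a \<in> Zs T d" for a d
    using that by (simp add: Zs_def qv.span_neg)
  show "a \<in> Zs T d" if "of_nat (Suc k) * a \<in> Zs T d" for k a d
  proof -
    have "Qscale (1 / of_nat (Suc k)) (of_nat (Suc k) * a) \<in> Zs T d"
      using that unfolding Zs_def by (rule qv.span_scale)
    then show ?thesis by (simp add: of_nat_scal del: of_nat_Suc)
  qed
  show "0 \<in> Lsp T d" for d by (simp add: Lsp_def qv.span_zero)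
  show "- a \<in> Lsp T d" if "a \<in> Lsp T d" for a d
    using that by (simp add: Lsp_def qv.span_neg)
  show "gen i r \<in> Lsp T r" if "i \<in> ?I" for i r
    using that by (auto simp: Lsp_def intro!: qv.span_base lw.gen)
  show "commutator a b \<in> Lsp T (d + e)" if a: "a \<in> Lsp T d" and b: "b \<in> Lsp T e" for a b d e
  proof -
    have "commutator f b \<in> Lsp T (d + e)" if "lw ?I d f" for f
      unfolding Lsp_def
      by (rule qspan_image[OF b[unfolded Lsp_def]])
        (use that in \<open>auto simp: commutator_simps commutator_Qscale intro!: qv.span_base lw.comm\<close>)
    then show ?thesis
      unfolding Lsp_def
      by (intro qspan_image[OF a[unfolded Lsp_def], of "\<lambda>a. commutator a b"])
        (auto simp: commutator_simps commutator_Qscale)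
  qed
  show "commutator a b \<in> Zs T (d + e)" if a: "a \<in> Zs T d" and b: "b \<in> Lsp T e" for a b d e
  proof -
    have g: "commutator f c \<in> Zs T (d + e)"
      if f: "f \<in> Zgen ?I d \<union> yangian_ideal T" and c: "lw ?I e c" for f c
      using f
    proof
      assume "f \<in> yangian_ideal T"
      then have "commutator f c \<in> yangian_ideal T"
        using lw_falg[OF c] ideal_mult_left ideal_mult_right ideal_add ideal_uminus
        unfolding commutator_def diff_conv_add_uminus by blast
      then show ?thesis unfolding Zs_def by (auto intro: qv.span_base)
    next
      assume "f \<in> Zgen ?I d"
      then obtain b' k e' g where f: "f = scal (hbar ^ b') * g" "pw ?I k e' g" "1 \<le> b'" "k \<le> Suc b'"
        "b' + e' = d"
        unfolding Zgen_def by blast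
      have "scal (hbar ^ b') * commutator g c \<in> Zs T (d + e)"
        unfolding Zs_def
      proof (rule qspan_image[OF pw_commutator[OF f(2) c], of "\<lambda>a. scal (hbar ^ b') * a"])
        fix a assume "a \<in> {f. pw ?I k (e' + e) f}"
        then have "scal (hbar ^ b') * a \<in> Zgen ?I (d + e)"
          unfolding Zgen_def using f by fastforce
        then show "scal (hbar ^ b') * a \<in> qv.span (Zgen ?I (d + e) \<union> yangian_ideal T)"
          by (blast intro: qv.span_base)
      qed (simp_all add: distrib_left Qscale_mult)
      then show ?thesis unfolding f(1) commutator_scal .
    qed
    have "commutator f b \<in> Zs T (d + e)" if "f \<in> Zgen ?I d \<union> yangian_ideal T" for f
      unfolding Zs_def
      by (rule qspan_image[OF b[unfolded Lsp_def]])
        (use g[OF that] in \<open>auto simp: commutator_simps commutator_Qscale Zs_def\<close>)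
    then show ?thesis
      unfolding Zs_def
      by (intro qspan_image[OF a[unfolded Zs_def], of "\<lambda>a. commutator a b"])
        (auto simp: commutator_simps commutator_Qscale)
  qed
  show "commutator (gen i (Suc r)) (gen j s) - commutator (gen i r) (gen j (Suc s)) \<in> Zs T (Suc (r + s))"
    if "i \<in> ?I" "j \<in> ?I" for i j r s
  proof -
    define q where "q = (of_int (sym_d T i * cartan_a T i j) / 2 :: rat)"
    have "pw ?I (1 + 1) (r + s) (gen i r * gen j s)" "pw ?I (1 + 1) (s + r) (gen j s * gen i r)"
      using that by (intro pw_mult pw_lw lw.gen; simp)+
    \<comment> \<open>Here \<open>b = 1\<close> and \<open>k = 2\<close>, the boundary case of the
      bound \<open>k \<le> b + 1\<close>. The right side of the quadratic relation is what the
      definition of \<open>Zgen\<close> is made for.\<close>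
    then have "scal (hbar ^ 1) * (gen i r * gen j s) \<in> Zgen ?I (Suc (r + s))"
      "scal (hbar ^ 1) * (gen j s * gen i r) \<in> Zgen ?I (Suc (r + s))"
      unfolding Zgen_def by (fastforce simp: add.commute)+
    then have "Qscale q (scal (hbar ^ 1) * (gen i r * gen j s) + scal (hbar ^ 1) * (gen j s * gen i r))
        \<in> Zs T (Suc (r + s))"
      unfolding Zs_def by (intro qv.span_scale qv.span_add qv.span_base) auto
    moreover have "quadratic_relator T i j r s \<in> Zs T (Suc (r + s))"
      using that by (intro relators_Zs) (unfold yangian_relators_def, blast)
    moreover have "commutator (gen i (Suc r)) (gen j s) - commutator (gen i r) (gen j (Suc s)) =
        quadratic_relator T i j r s
        + Qscale q (scal (hbar ^ 1) * (gen i r * gen j s) + scal (hbar ^ 1) * (gen j s * gen i r))"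
      by (simp add: quadratic_relator_def q_def Qscale_def scal_mult distrib_left mult.assoc)
    ultimately show ?thesis unfolding Zs_def by (metis qv.span_add)
  qed
qed

lemma foldr_const_funpow: "foldr (\<lambda>k. F) xs a = (F ^^ length xs) a"
  by (induction xs) simp_all

text \<open>For equal arguments the \<open>m!\<close> summands of the Serre relator coincide, and
  \<open>m!\<close> may be divided out. Turning left brackets into right ones costs only a
  sign.\<close>

lemma serre_zero_modes:
  assumes "i \<in> index_set T" "j \<in> index_set T" "i \<noteq> j" "m = nat (1 - cartan_a T i j)"
  shows "((\<lambda>y. commutator y (gen i 0)) ^^ m) (gen j r) \<in> Zs T r"
proof -
  interpret loop_lie "Zs T" "Lsp T" gen "index_set T" by (rule loop_lie_yangian)
  have f: "foldr (\<lambda>k. commutator (gen i 0)) [0..<m] (gen j r) = ((commutator (gen i 0)) ^^ m) (gen j r)"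
    using foldr_const_funpow[of "commutator (gen i 0)" "[0..<m]" "gen j r"] by simp
  have "serre_relator T i j (\<lambda>_. 0) r \<in> Zs T r"
    using assms by (intro relators_Zs) (unfold yangian_relators_def, blast)
  moreover have "serre_relator T i j (\<lambda>_. 0) r = of_nat (fact m) * ((commutator (gen i 0)) ^^ m) (gen j r)"
    unfolding serre_relator_def Let_def f assms(4)[symmetric]
    using card_permutations[of "{..<m}" m] by simp
  moreover obtain k where "fact m = Suc k" by (metis fact_nonzero not0_implies_Suc)
  ultimately have "((commutator (gen i 0)) ^^ m) (gen j r) \<in> Zs T r" using Z_div by metis
  moreover have "((\<lambda>y. commutator y b) ^^ m) a = ((commutator b) ^^ m) a \<or>
      ((\<lambda>y. commutator y b) ^^ m) a = - ((commutator b) ^^ m) a" for a b :: free_elem and m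
  proof (induction m)
    case (Suc m)
    then show ?case by (auto simp: commutator_simps commutator_antisym[of "(commutator b ^^ m) a" b])
  qed simp
  ultimately show ?thesis using Z_uminus by metis
qed

lemma loop_lie_G_yangian: "loop_lie_G (Zs G2) (Lsp G2) gen"
proof -
  interpret loop_lie "Zs G2" "Lsp G2" gen "{1, 2}" using loop_lie_yangian[of G2] by simp
  have c: "cartan_a G2 1 2 = - 1" "cartan_a G2 2 1 = - 3"
    by (simp_all add: cartan_a_def sym_d_def)
  show ?thesis
  proof
    fix r
    show "commutator (commutator (gen 2 r) (gen 1 0)) (gen 1 0) \<in> Zs G2 r"
      using serre_zero_modes[of 1 G2 2 2 r] c
      by (simp add: eval_nat_numeral)
    show "commutator (commutator (commutator (commutator (gen 1 r) (gen 2 0)) (gen 2 0)) (gen 2 0)) (gen 2 0) \<in> Zs G2 r"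
      using serre_zero_modes[of 2 G2 1 4 r] c
      by (simp add: eval_nat_numeral)
  qed
qed

lemma loop_lie_B_yangian:
  assumes "n \<ge> 2"
  shows "loop_lie_B (Zs (B n)) (Lsp (B n)) gen n"
proof -
  interpret loop_lie "Zs (B n)" "Lsp (B n)" gen "{1..n}" using loop_lie_yangian[of "B n"] by simp
  show ?thesis
  proof
    show "commutator (gen j r) (gen i 0) \<in> Zs (B n) r"
      if "i \<in> {1..n}" "j \<in> {1..n}" "i + 2 \<le> j" for i j r
    proof -
      have "cartan_a (B n) i j = 0" using that by (simp add: cartan_a_def)
      then show ?thesis using serre_zero_modes[of i "B n" j 1 r] that by simp
    qed
    show "commutator (commutator (gen j r) (gen i 0)) (gen i 0) \<in> Zs (B n) r"
      if "i \<in> {1..<n}" "j \<in> {1..n}" "j = Suc i \<or> i = Suc j" for i j r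
    proof -
      have "cartan_a (B n) i j = - 1" using that by (auto simp: cartan_a_def sym_d_def)
      then show ?thesis
        using serre_zero_modes[of i "B n" j 2 r] that
        by (auto simp: eval_nat_numeral)
    qed
    show "commutator (commutator (commutator (gen (n - 1) r) (gen n 0)) (gen n 0)) (gen n 0) \<in> Zs (B n) r" for r
    proof -
      have "cartan_a (B n) n (n - 1) = - 2" using assms by (auto simp: cartan_a_def sym_d_def)
      then have "((\<lambda>y. commutator y (gen n 0)) ^^ 3) (gen (n - 1) r) \<in> Zs (B n) r"
        using serre_zero_modes[of n "B n" "n - 1" 3 r] assms by auto
      then show ?thesis by (simp add: numeral_3_eq_3)
    qed
  qed (rule assms)
qed

definition valid :: "cartan_type \<Rightarrow> bool" where
  "valid T \<longleftrightarrow> T = G2 \<or> (\<exists>n \<ge> 2. T = B n)"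

lemma decompositionD:
  "decomposition T \<delta> \<Longrightarrow> \<beta> \<in> set (pos_roots T) \<Longrightarrow> length (\<delta> \<beta> s) = length \<beta> \<and> sum_list (\<delta> \<beta> s) = s"
  unfolding decomposition_def by blast

text \<open>Hides the type from the rest of the spanning argument. \<open>W\<close> is the reference
  root vector, namely \<open>wd\<close> in type B and \<open>wdG\<close> in type G2.\<close>

lemma root_table:
  assumes "valid T"
  obtains W where
    "\<And>i s. i \<in> index_set T \<Longrightarrow> [i] \<in> set (pos_roots T) \<and> W [i] s = gen i s"
    "\<And>\<beta> \<delta> s. \<beta> \<in> set (pos_roots T) \<Longrightarrow> decomposition T \<delta> \<Longrightarrow> rvec T \<delta> (\<beta>, s) - W \<beta> s \<in> Zs T s"
    "\<And>\<beta> k s r. \<beta> \<in> set (pos_roots T) \<Longrightarrow> k \<in> index_set T \<Longrightarrow>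
      \<exists>w. commutator (W \<beta> s) (gen k r) - w \<in> Zs T (s + r) \<and>
        (w = 0 \<or> (\<exists>\<gamma>\<in>set (pos_roots T). w = W \<gamma> (s + r) \<or> w = - W \<gamma> (s + r)))"
proof -
  consider "T = G2" | n where "n \<ge> 2" "T = B n" using assms by (auto simp: valid_def)
  then show thesis
  proof cases
    case 1
    interpret loop_lie_G "Zs G2" "Lsp G2" gen by (rule loop_lie_G_yangian)
    show thesis
    proof (rule that[of wdG], unfold 1)
      fix i s assume "i \<in> index_set G2"
      then show "[i] \<in> set (pos_roots G2) \<and> wdG [i] s = gen i s" by (auto simp: wdG_def)
    next
      fix \<beta> \<delta> s assume \<beta>: "\<beta> \<in> set (pos_roots G2)" and \<delta>: "decomposition G2 \<delta>"
      have len: "length (\<delta> \<beta> s) = length \<beta>" "sum_list (\<delta> \<beta> s) = s"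
        using decompositionD[OF \<delta> \<beta>] by auto
      show "rvec G2 \<delta> (\<beta>, s) - wdG \<beta> s \<in> Zs G2 s"
      proof (cases "\<beta> = [1,2,1,2,2]")
        case False
        have hd: "hd \<beta> \<in> {1, 2}" using \<beta> by auto
        have "eqv s (rvec G2 \<delta> (\<beta>, s)) (wd \<beta> s)"
          using chain_eqv[OF chain_G[OF \<beta> False] pos_roots_ne[OF \<beta>] len(1) hd] False
          by (simp only: rvec_def Let_def lnest_def len(2) prod.case simp_thms if_False)
        then show ?thesis using False by (simp add: wdG_def eqv_def)
      next
        case True
        have "\<exists>a b c d e. \<delta> \<beta> s = [a, b, c, d, e]"
          using len(1) True by (simp add: length_Suc_conv) blast
        then obtain a b c d e where abc: "\<delta> \<beta> s = [a, b, c, d, e]" by blast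
        then have s: "s = a + b + (c + d + e)" using len(2) by simp
        have "rvec G2 \<delta> (\<beta>, s) = C (C (gen 1 a) (gen 2 b)) (C (C (gen 1 c) (gen 2 d)) (gen 2 e))"
          using abc True by (simp add: rvec_def Let_def)
        then show ?thesis
          using theta_eqv[of a b c d e] True s by (simp add: eqv_def wdG_def)
      qed
    next
      fix \<beta> k s r assume \<beta>: "\<beta> \<in> set (pos_roots G2)" and "k \<in> index_set G2"
      then have k: "k \<in> {1, 2}" by simp
      obtain Y where Y: "br (wdG \<beta>) k Y" "Y = zs \<or> (\<exists>\<gamma>\<in>set (pos_roots G2). Y = wdG \<gamma> \<or> Y = ns (wdG \<gamma>))"
        using table_G[OF \<beta> k] by blast
      show "\<exists>w. commutator (wdG \<beta> s) (gen k r) - w \<in> Zs G2 (s + r) \<and>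
        (w = 0 \<or> (\<exists>\<gamma>\<in>set (pos_roots G2). w = wdG \<gamma> (s + r) \<or> w = - wdG \<gamma> (s + r)))"
        using brD(1)[OF Y(1), of s r] Y(2) unfolding eqv_def by (intro exI[of _ "Y (s + r)"]) blast
    qed
  next
    case 2
    interpret loop_lie_B "Zs (B n)" "Lsp (B n)" gen n by (rule loop_lie_B_yangian[OF 2(1)])
    show thesis
    proof (rule that[of wd], unfold 2(2))
      fix i s assume i: "i \<in> index_set (B n)"
      have "[i] = [i..<Suc i]" by simp
      then have "[i] \<in> set (pos_roots (B n))"
        unfolding roots_B using i by (intro disjI1 exI[of _ i]) auto
      moreover have "wd [i] s = gen i s" by simp
      ultimately show "[i] \<in> set (pos_roots (B n)) \<and> wd [i] s = gen i s" by (rule conjI)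
    next
      fix \<beta> \<delta> s assume \<beta>: "\<beta> \<in> set (pos_roots (B n))" and \<delta>: "decomposition (B n) \<delta>"
      have len: "length (\<delta> \<beta> s) = length \<beta>" "sum_list (\<delta> \<beta> s) = s"
        using decompositionD[OF \<delta> \<beta>] by auto
      have hd: "hd \<beta> \<in> {1..n}" using pos_roots_index[OF \<beta>] pos_roots_ne[OF \<beta>] by (cases \<beta>) auto
      have "eqv s (rvec (B n) \<delta> (\<beta>, s)) (wd \<beta> s)"
        using chain_eqv[OF chain_B[OF \<beta>] pos_roots_ne[OF \<beta>] len(1) hd]
        by (simp add: rvec_def Let_def lnest_def len(2))
      then show "rvec (B n) \<delta> (\<beta>, s) - wd \<beta> s \<in> Zs (B n) s" by (simp add: eqv_def)
    next
      fix \<beta> k s r assume \<beta>: "\<beta> \<in> set (pos_roots (B n))" and "k \<in> index_set (B n)"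
      then have k: "k \<in> {1..n}" by simp
      obtain Y where Y: "br (wd \<beta>) k Y" "Y = zs \<or> (\<exists>\<gamma>\<in>set (pos_roots (B n)). Y = wd \<gamma> \<or> Y = ns (wd \<gamma>))"
        using table_B[OF \<beta> k] by blast
      show "\<exists>w. commutator (wd \<beta> s) (gen k r) - w \<in> Zs (B n) (s + r) \<and>
        (w = 0 \<or> (\<exists>\<gamma>\<in>set (pos_roots (B n)). w = wd \<gamma> (s + r) \<or> w = - wd \<gamma> (s + r)))"
        using brD(1)[OF Y(1), of s r] Y(2) unfolding eqv_def by (intro exI[of _ "Y (s + r)"]) blast
    qed
  qed
qed

lemma lw_foldl:
  assumes "lw I d f" "list_all2 (\<lambda>e g. lw I e g) es gs"
  shows "lw I (d + sum_list es) (foldl commutator f gs)"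
  using assms(2,1)
proof (induction arbitrary: d f rule: list_all2_induct)
  case (Cons e es g gs)
  then show ?case using lw.comm[of I d f e g] by (simp add: add.assoc[symmetric])
qed simp

lemma rvec_lw:
  assumes "decomposition T \<delta>" "\<beta> \<in> set (pos_roots T)"
  shows "lw (index_set T) s (rvec T \<delta> (\<beta>, s))"
proof -
  have len: "length (\<delta> \<beta> s) = length \<beta>" "sum_list (\<delta> \<beta> s) = s"
    using decompositionD[OF assms] by auto
  have sub: "set \<beta> \<subseteq> index_set T" by (rule pos_roots_index[OF assms(2)])
  show ?thesis
  proof (cases "T = G2 \<and> \<beta> = [1,2,1,2,2]")
    case True
    have "\<exists>a b c d e. \<delta> \<beta> s = [a, b, c, d, e]"
      using len(1) True by (simp add: length_Suc_conv) blast
    then obtain a b c d e where abc: "\<delta> \<beta> s = [a, b, c, d, e]" by blast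
    then have s: "s = (a + b) + ((c + d) + e)" using len(2) by simp
    have "rvec T \<delta> (\<beta>, s) = commutator (commutator (gen 1 a) (gen 2 b))
       (commutator (commutator (gen 1 c) (gen 2 d)) (gen 2 e))"
      using abc True by (simp add: rvec_def Let_def)
    then show ?thesis unfolding s using True by (auto intro!: lw.intros)
  next
    case False
    obtain k \<beta>' where \<beta>: "\<beta> = k # \<beta>'" using pos_roots_ne[OF assms(2)] by (cases \<beta>) auto
    obtain t ts where ts: "\<delta> \<beta> s = t # ts" "length ts = length \<beta>'" using len(1) \<beta> by (cases "\<delta> \<beta> s") auto
    have "list_all2 (\<lambda>e g. lw (index_set T) e g) ts (map2 gen \<beta>' ts)"
      using ts(2) sub \<beta> by (auto simp: list_all2_conv_all_nth intro!: lw.gen)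
    moreover have "lw (index_set T) t (gen k t)" using sub \<beta> by (auto intro: lw.gen)
    ultimately have "lw (index_set T) (t + sum_list ts) (foldl commutator (gen k t) (map2 gen \<beta>' ts))"
      by (rule lw_foldl[rotated])
    moreover have "t + sum_list ts = s" using ts len(2) by simp
    moreover have "rvec T \<delta> (\<beta>, s) = lnest (map2 gen \<beta> (\<delta> \<beta> s))"
      unfolding rvec_def Let_def using False by (simp only: prod.case if_False)
    ultimately show ?thesis using \<beta> ts by (simp add: lnest_def)
  qed
qed

lemma mono_pw:
  assumes "decomposition T \<delta>" "set ps \<subseteq> set (pos_roots T) \<times> UNIV"
  shows "pw (index_set T) (length ps) (sum_list (map snd ps)) (root_mono T \<delta> ps)"
  using assms(2)
proof (induction ps)
  case (Cons p ps)
  then show ?case using pw.mult[OF rvec_lw[OF assms(1), of "fst p" "snd p"]] by (auto simp: root_mono_def)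
qed (simp add: root_mono_def pw.one)

definition Ksp :: "cartan_type \<Rightarrow> (nat list \<Rightarrow> nat \<Rightarrow> nat list) \<Rightarrow> nat \<Rightarrow> free_elem set" where
  "Ksp T \<delta> d = qv.span ((\<lambda>\<beta>. rvec T \<delta> (\<beta>, d)) ` set (pos_roots T) \<union> Zs T d)"

text \<open>By the table the spans are stable under right brackets with letters, and by
  \<open>[f, [a, b]] = [[f, a], b] - [[f, b], a]\<close> under right brackets with all Lie words. As
  they contain the letters, they contain every Lie word.\<close>

lemma lw_Ksp:
  assumes T: "valid T" and \<delta>: "decomposition T \<delta>" and c: "lw (index_set T) d c"
  shows "c \<in> Ksp T \<delta> d"
proof -
  interpret loop_lie "Zs T" "Lsp T" gen "index_set T" by (rule loop_lie_yangian)
  obtain W where W: "\<And>i s. i \<in> index_set T \<Longrightarrow> [i] \<in> set (pos_roots T) \<and> W [i] s = gen i s"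
    "\<And>\<beta> s. \<beta> \<in> set (pos_roots T) \<Longrightarrow> rvec T \<delta> (\<beta>, s) - W \<beta> s \<in> Zs T s"
    "\<And>\<beta> k s r. \<beta> \<in> set (pos_roots T) \<Longrightarrow> k \<in> index_set T \<Longrightarrow>
      \<exists>w. commutator (W \<beta> s) (gen k r) - w \<in> Zs T (s + r) \<and>
        (w = 0 \<or> (\<exists>\<gamma>\<in>set (pos_roots T). w = W \<gamma> (s + r) \<or> w = - W \<gamma> (s + r)))"
    using root_table[OF T] \<delta> by metis
  have ZK: "f \<in> Ksp T \<delta> d" if "f \<in> Zs T d" for f d
    using that unfolding Ksp_def by (auto intro: qv.span_base)
  have K_add: "f + g \<in> Ksp T \<delta> d" if "f \<in> Ksp T \<delta> d" "g \<in> Ksp T \<delta> d" for f g d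
    using that unfolding Ksp_def by (rule qv.span_add)
  have K_diff: "f - g \<in> Ksp T \<delta> d" if "f \<in> Ksp T \<delta> d" "g \<in> Ksp T \<delta> d" for f g d
    using that unfolding Ksp_def by (rule qv.span_diff)
  have K_neg: "- f \<in> Ksp T \<delta> d" if "f \<in> Ksp T \<delta> d" for f d
    using that unfolding Ksp_def by (rule qv.span_neg)
  have WK: "W \<beta> s \<in> Ksp T \<delta> s" if "\<beta> \<in> set (pos_roots T)" for \<beta> s
  proof -
    have "rvec T \<delta> (\<beta>, s) \<in> Ksp T \<delta> s" using that unfolding Ksp_def by (auto intro: qv.span_base)
    from K_diff[OF this ZK[OF W(2)[OF that, of s]]] show ?thesis by simp
  qed
  have gen_stable: "commutator f (gen k r) \<in> Ksp T \<delta> (d + r)"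
    if f: "f \<in> Ksp T \<delta> d" and k: "k \<in> index_set T" for f k r d
  proof -
    have Zc: "commutator g (gen k r) \<in> Zs T (d + r)" if "g \<in> Zs T d" for g
      using Z_br[OF that L_x[OF k]] .
    have "commutator (rvec T \<delta> (\<beta>, d)) (gen k r) \<in> Ksp T \<delta> (d + r)" if \<beta>: "\<beta> \<in> set (pos_roots T)" for \<beta>
    proof -
      obtain w where w: "commutator (W \<beta> d) (gen k r) - w \<in> Zs T (d + r)"
        "w = 0 \<or> (\<exists>\<gamma>\<in>set (pos_roots T). w = W \<gamma> (d + r) \<or> w = - W \<gamma> (d + r))"
        using W(3)[OF \<beta> k] by blast
      have "w \<in> Ksp T \<delta> (d + r)"
        using w(2) WK[of _ "d + r"] K_neg ZK[OF Z_0] by auto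
      from K_add[OF ZK[OF w(1)] this] have "commutator (W \<beta> d) (gen k r) \<in> Ksp T \<delta> (d + r)" by simp
      moreover have "commutator (rvec T \<delta> (\<beta>, d) - W \<beta> d) (gen k r) \<in> Ksp T \<delta> (d + r)"
        by (intro ZK Zc W \<beta>)
      ultimately have "commutator (W \<beta> d) (gen k r) + commutator (rvec T \<delta> (\<beta>, d) - W \<beta> d) (gen k r)
          \<in> Ksp T \<delta> (d + r)"
        by (rule K_add)
      then show ?thesis by (simp add: commutator_simps)
    qed
    then show ?thesis
      using ZK Zc unfolding Ksp_def
      by (intro qspan_image[OF f[unfolded Ksp_def], of "\<lambda>f. commutator f (gen k r)"])
        (auto simp: commutator_simps commutator_Qscale)
  qed
  have stable: "f \<in> Ksp T \<delta> d' \<Longrightarrow> commutator f c \<in> Ksp T \<delta> (d' + d)" if "lw (index_set T) d c" for c d f d'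
    using that
  proof (induction arbitrary: f d' rule: lw.induct)
    case (gen i r)
    then show ?case using gen_stable by blast
  next
    case (comm d a e b)
    have "commutator (commutator f a) b \<in> Ksp T \<delta> (d' + d + e)"
      "commutator (commutator f b) a \<in> Ksp T \<delta> (d' + e + d)"
      using comm by blast+
    then have "commutator (commutator f a) b - commutator (commutator f b) a \<in> Ksp T \<delta> (d' + (d + e))"
      by (intro K_diff) (simp_all add: ac_simps)
    then show ?case by (simp add: jacobi[of f a b])
  qed
  show ?thesis using c
  proof (induction rule: lw.induct)
    case (gen i r)
    then show ?case using WK[of "[i]" r] W(1)[OF gen, of r] by simp
  next
    case (comm d f e g)
    then show ?case using stable by blast
  qed
qed

section \<open>Ordered monomials span\<close>

definition sorted_span :: "cartan_type \<Rightarrow> (nat list \<Rightarrow> nat \<Rightarrow> nat list) \<Rightarrow> free_elem set" where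
  "sorted_span T \<delta> = fm.span ((\<lambda>h. bmono T \<delta> (expand T h)) ` exponents T \<union> yangian_ideal T)"

text \<open>In type B the first letter separates the blocks of the list, and the length separates
  the words within a block.\<close>

lemma distinct_pos_roots: "valid T \<Longrightarrow> distinct (pos_roots T)"
proof -
  have "distinct (pos_roots (B n))" for n
  proof -
    let ?F = "\<lambda>i. map (\<lambda>j. [i..<Suc j]) [i..<Suc n] @ map (\<lambda>j. [i..<Suc n] @ rev [j..<Suc n]) (rev [Suc i..<Suc n])"
    have hd: "hd \<beta> = i" if "\<beta> \<in> set (?F i)" "i \<le> n" for i \<beta>
      using that by (auto simp del: upt_Suc simp: hd_append)
    have ne: "?F i \<noteq> []" if "i \<le> n" for i using that by simp
    have "distinct (?F i)" if "i \<le> n" for i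
    proof -
      have "inj_on (\<lambda>j. [i..<Suc j]) {i..<Suc n}"
        by (rule inj_onI) (drule arg_cong[of _ _ length], simp del: upt_Suc, linarith)
      moreover have "inj_on (\<lambda>j. [i..<Suc n] @ rev [j..<Suc n]) {Suc i..<Suc n}"
        by (rule inj_onI) (drule arg_cong[of _ _ length], simp del: upt_Suc, linarith)
      moreover have "[i..<Suc j] \<noteq> [i..<Suc n] @ rev [k..<Suc n]" if "j < Suc n" "k < Suc n" "i \<le> j" for j k
        using that by (intro notI) (drule arg_cong[of _ _ length], simp del: upt_Suc)
      ultimately show ?thesis
        by (auto simp del: upt_Suc simp: distinct_map)
    qed
    note dist = this
    define F where "F = ?F"
    have hdF: "hd \<beta> = i" if "\<beta> \<in> set (F i)" "i \<in> {1..<Suc n}" for i \<beta>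
      using hd that unfolding F_def by auto
    have "inj_on F (set [1..<Suc n])"
    proof (rule inj_onI)
      fix i j assume *: "i \<in> set [1..<Suc n]" "j \<in> set [1..<Suc n]" "F i = F j"
      then have ij: "i \<in> {1..<Suc n}" "j \<in> {1..<Suc n}" by (simp_all only: set_upt)
      then have "F i \<noteq> []" using ne[of i] unfolding F_def by auto
      then have "hd (F i) \<in> set (F i)" by (rule hd_in_set)
      then show "i = j" using hdF[of "hd (F i)" i] hdF[of "hd (F i)" j] *(3) ij by metis
    qed
    moreover have "distinct (F i)" if "i \<in> {1..<Suc n}" for i
      using dist[of i] that unfolding F_def by auto
    moreover have "set (F i) \<inter> set (F j) = {}" if "i \<in> {1..<Suc n}" "j \<in> {1..<Suc n}" "F i \<noteq> F j" for i j
      using hdF[OF _ that(1)] hdF[OF _ that(2)] that(3) by blast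
    ultimately have "distinct (concat (map F [1..<Suc n]))"
      by (intro distinct_concat) (auto simp only: distinct_map set_map set_upt distinct_upt)
    then show ?thesis unfolding F_def pos_roots.simps .
  qed
  then show "valid T \<Longrightarrow> distinct (pos_roots T)"
    by (auto simp: valid_def simp del: pos_roots.simps(2))
qed

lemma mset_expand:
  assumes "valid T" "h \<in> exponents T"
  shows "count (mset (expand T h)) p = h p"
proof -
  have fin: "finite {s. h (\<beta>, s) \<noteq> 0}" for \<beta>
    using assms(2) finite_vimageI[of "{p. h p \<noteq> 0}" "Pair \<beta>"]
    by (auto simp: exponents_def vimage_def inj_on_def)
  have dist: "distinct (ordered_support T h)"
    unfolding ordered_support_def
  proof -
    have "distinct (concat (map (\<lambda>\<beta>. map (Pair \<beta>) (sorted_list_of_set {s. h (\<beta>, s) \<noteq> 0})) bs))"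
      if "distinct bs" for bs
      using that by (induction bs) (auto simp: distinct_map inj_on_def)
    then show "distinct (concat (map (\<lambda>\<beta>. map (Pair \<beta>) (sorted_list_of_set {s. h (\<beta>, s) \<noteq> 0})) (pos_roots T)))"
      using distinct_pos_roots[OF assms(1)] by blast
  qed
  have "count (mset (concat (map (\<lambda>p. replicate (h p) p) ps))) p = (if p \<in> set ps then h p else 0)"
    if "distinct ps" for ps
    using that by (induction ps) auto
  then show ?thesis
    using dist set_ordered_support[OF assms(2)] unfolding expand_def by simp
qed

lemma set_expand:
  assumes "h \<in> exponents T"
  shows "set (expand T h) \<subseteq> set (pos_roots T) \<times> UNIV"
  using set_ordered_support[OF assms] assms unfolding expand_def exponents_def by auto

lemma expand_exists:
  assumes "valid T" "set ps \<subseteq> set (pos_roots T) \<times> UNIV"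
  obtains h where "h \<in> exponents T" "mset (expand T h) = mset ps"
proof -
  have "count (mset ps) \<in> exponents T"
    using assms(2) by (auto simp: exponents_def)
  moreover have "mset (expand T (count (mset ps))) = mset ps"
    using mset_expand[OF assms(1) calculation] by (intro multiset_eqI) simp
  ultimately show thesis using that by blast
qed

text \<open>Rearrangement by adjacent swaps. Fixing the multiset \<open>M\<close> means that the
  swap hypothesis is used only for lists with the length and the total degree of the monomial at
  hand.\<close>

lemma permute_congruence:
  assumes swap: "\<And>us vs p q. mset (us @ p # q # vs) = M \<Longrightarrow> D (us @ p # q # vs) - D (us @ q # p # vs) \<in> S"
    and S: "0 \<in> S" "\<And>a b. a \<in> S \<Longrightarrow> b \<in> S \<Longrightarrow> a + b \<in> S"
    and xs: "mset (us @ xs @ vs) = M" "mset xs = mset ys"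
  shows "D (us @ xs @ vs) - D (us @ ys @ vs) \<in> (S :: 'b::ab_group_add set)"
  using xs
proof (induction xs arbitrary: ys us)
  case Nil
  then show ?case using S by simp
next
  case (Cons x xs)
  have "x \<in> set ys" using Cons.prems(2) by (metis list.set_intros(1) mset_eq_setD)
  then obtain ys1 ys2 where ys: "ys = ys1 @ x # ys2" by (meson split_list)
  then have m: "mset xs = mset (ys1 @ ys2)" using Cons.prems(2) by simp
  have 1: "D ((us @ [x]) @ xs @ vs) - D ((us @ [x]) @ (ys1 @ ys2) @ vs) \<in> S"
    using Cons.IH[of "us @ [x]" "ys1 @ ys2"] Cons.prems(1) m by simp
  have flip: "D (us @ x # zs @ ws) - D (us @ zs @ x # ws) \<in> S" if "mset (us @ x # zs @ ws) = M" for us zs ws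
    using that
  proof (induction zs arbitrary: us)
    case Nil
    then show ?case using S by simp
  next
    case (Cons z zs)
    have "D ((us @ [z]) @ x # zs @ ws) - D ((us @ [z]) @ zs @ x # ws) \<in> S"
      using Cons.IH[of "us @ [z]"] Cons.prems by (simp add: add_mset_commute)
    moreover have "D (us @ x # z # (zs @ ws)) - D (us @ z # x # (zs @ ws)) \<in> S"
      using swap[of us x z "zs @ ws"] Cons.prems by (simp add: add_mset_commute)
    ultimately show ?case using S(2) by fastforce
  qed
  have "D (us @ x # ys1 @ (ys2 @ vs)) - D (us @ ys1 @ x # (ys2 @ vs)) \<in> S"
    using flip[of us ys1 "ys2 @ vs"] Cons.prems(1) m by (simp add: ac_simps)
  from S(2)[OF 1 this[simplified]] show ?case using ys by simp
qed

text \<open>Induction on the loop degree first and the number of factors second. Replacing a factor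
  by root vectors leaves negligible terms: they trade one factor for at most \<open>b + 1\<close>,
  which the extra \<open>hbar ^ b\<close> pays for, and they lower the degree by
  \<open>b \<ge> 1\<close>. Swapping two root vectors leaves a term in which they are merged into
  one commutator, with one factor fewer.\<close>

lemma pw_sorted_span:
  assumes T: "valid T" and \<delta>: "decomposition T \<delta>"
  shows "pw (index_set T) k e g \<Longrightarrow> k \<le> a \<Longrightarrow> scal (hbar ^ a) * g \<in> sorted_span T \<delta>"
proof (induction "(e, k)" arbitrary: e k g a rule: wf_induct[OF wf_lex_prod[OF wf_less_than wf_less_than]])
  case (1 e k)
  let ?I = "index_set T" and ?S = "sorted_span T \<delta>"
  have IH1: "scal (hbar ^ a') * g' \<in> ?S" if "pw ?I k' e' g'" "e' < e" "k' \<le> a'" for a' e' k' g'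
    using 1(1) that by auto
  have IH2: "scal (hbar ^ a') * g' \<in> ?S" if "pw ?I k' e g'" "k' < k" "k' \<le> a'" for a' k' g'
    using 1(1) that by auto
  have S0: "0 \<in> ?S" and S_add: "\<And>f g. f \<in> ?S \<Longrightarrow> g \<in> ?S \<Longrightarrow> f + g \<in> ?S"
    and S_scale: "\<And>c f. f \<in> ?S \<Longrightarrow> scal c * f \<in> ?S"
    and S_J: "\<And>f. f \<in> yangian_ideal T \<Longrightarrow> f \<in> ?S"
    unfolding sorted_span_def
    by (simp_all add: fm.span_zero fm.span_add fm.span_scale fm.span_base)
  have sortd: "scal (hbar ^ a') * root_mono T \<delta> ps \<in> ?S"
    if ps: "set ps \<subseteq> set (pos_roots T) \<times> UNIV" "length ps = k" "sum_list (map snd ps) = e" "k \<le> a'" for ps a'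
  proof -
    obtain h where h: "h \<in> exponents T" "mset (expand T h) = mset ps" using expand_exists[OF T ps(1)] .
    have "scal (hbar ^ a') * root_mono T \<delta> ([] @ ps @ []) - scal (hbar ^ a') * root_mono T \<delta> ([] @ expand T h @ []) \<in> ?S"
    proof (rule permute_congruence[where M = "mset ps" and D = "\<lambda>qs. scal (hbar ^ a') * root_mono T \<delta> qs"])
      fix us vs p q assume m: "mset (us @ p # q # vs) = mset ps"
      then have sub: "set (us @ p # q # vs) \<subseteq> set (pos_roots T) \<times> UNIV"
        using ps(1) mset_eq_setD by blast
      have l: "length (us @ p # q # vs) = k" using m ps(2) by (metis size_mset)
      have "sum_list (map snd (us @ p # q # vs)) = e"
        using m ps(3) by (metis mset_map sum_mset_sum_list)
      then have tot: "sum_list (map snd us) + ((snd p + snd q) + sum_list (map snd vs)) = e" by simp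
      have c: "lw ?I (snd p + snd q) (commutator (rvec T \<delta> p) (rvec T \<delta> q))"
        using rvec_lw[OF \<delta>, of "fst p" "snd p"] rvec_lw[OF \<delta>, of "fst q" "snd q"] sub
        by (auto intro!: lw.comm)
      have "pw ?I (length us + Suc (length vs))
          (sum_list (map snd us) + ((snd p + snd q) + sum_list (map snd vs)))
          (root_mono T \<delta> us * (commutator (rvec T \<delta> p) (rvec T \<delta> q) * root_mono T \<delta> vs))"
        using sub by (intro pw_mult pw.mult c mono_pw[OF \<delta>]) auto
      from this[unfolded tot]
      have "scal (hbar ^ a') * (root_mono T \<delta> us * (commutator (rvec T \<delta> p) (rvec T \<delta> q) * root_mono T \<delta> vs)) \<in> ?S"
        by (rule IH2) (use l ps(4) in auto)
      then show "scal (hbar ^ a') * root_mono T \<delta> (us @ p # q # vs) - scal (hbar ^ a') * root_mono T \<delta> (us @ q # p # vs) \<in> ?S"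
        by (simp add: root_mono_def commutator_def algebra_simps)
    qed (use S0 S_add h in auto)
    moreover have "scal (hbar ^ a') * root_mono T \<delta> (expand T h) \<in> ?S"
    proof -
      have "length (expand T h) = k" using h(2) ps(2) by (metis size_mset)
      then have "scal (hbar ^ a') * root_mono T \<delta> (expand T h) = scal (hbar ^ (a' - k)) * bmono T \<delta> (expand T h)"
        using ps(4) by (simp add: bmono_def mult.assoc[symmetric] scal_mult[symmetric] power_add[symmetric])
      moreover have "bmono T \<delta> (expand T h) \<in> ?S"
        unfolding sorted_span_def using h(1) by (auto intro: fm.span_base)
      ultimately show ?thesis using S_scale by simp
    qed
    ultimately show ?thesis using S_add by fastforce
  qed
  \<comment> \<open>The prefix \<open>ps\<close> already consists of root vectors; the Lie words in
    \<open>f\<close> are still to be replaced, from left to right.\<close>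
  have mix: "scal (hbar ^ a') * (root_mono T \<delta> ps * f) \<in> ?S"
    if "pw ?I m e' f" "set ps \<subseteq> set (pos_roots T) \<times> UNIV" "length ps + m = k"
      "sum_list (map snd ps) + e' = e" "k \<le> a'" for m e' f ps a'
    using that
  proof (induction arbitrary: ps rule: pw.induct)
    case one
    then show ?case using sortd[of ps a'] by simp
  next
    case (mult d c m e' f)
    let ?G = "\<lambda>c. scal (hbar ^ a') * (root_mono T \<delta> ps * (c * f))"
    have G_add: "?G (c + c') = ?G c + ?G c'" for c c' by (simp add: distrib_left distrib_right)
    have G_scal: "?G (scal q * c) = scal q * ?G c" for q c
      unfolding mult.assoc scal_left_commute[of "root_mono T \<delta> ps"] by (rule scal_left_commute)
    have "c \<in> Ksp T \<delta> d" using lw_Ksp[OF T \<delta> mult.hyps(1)] .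
    moreover have "?G c \<in> ?S" if im: "c \<in> (\<lambda>\<beta>. rvec T \<delta> (\<beta>, d)) ` set (pos_roots T)" for c
    proof -
      obtain \<beta> where \<beta>: "\<beta> \<in> set (pos_roots T)" "c = rvec T \<delta> (\<beta>, d)" using im by blast
      have "scal (hbar ^ a') * (root_mono T \<delta> (ps @ [(\<beta>, d)]) * f) \<in> ?S"
        using mult.prems \<beta> by (intro mult.IH) auto
      then show ?thesis by (simp add: root_mono_def \<beta> mult.assoc)
    qed
    moreover have "?G c \<in> ?S" if c: "c \<in> Zs T d" for c
    proof -
      have "?G c \<in> ?S" if "c \<in> Zgen ?I d" for c
      proof -
        obtain b l e'' g' where c: "c = scal (hbar ^ b) * g'" "pw ?I l e'' g'" "1 \<le> b" "l \<le> Suc b" "b + e'' = d"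
          using \<open>c \<in> Zgen ?I d\<close> unfolding Zgen_def by blast
        have "pw ?I (length ps + (l + m)) (sum_list (map snd ps) + (e'' + e')) (root_mono T \<delta> ps * (g' * f))"
          by (intro pw_mult mono_pw[OF \<delta>] mult.prems c mult.hyps)
        then have "scal (hbar ^ (a' + b)) * (root_mono T \<delta> ps * (g' * f)) \<in> ?S"
          by (rule IH1) (use c mult.prems in auto)
        moreover have "?G c = scal (hbar ^ (a' + b)) * (root_mono T \<delta> ps * (g' * f))"
          unfolding c(1) power_add scal_mult mult.assoc by (subst scal_left_commute[of "root_mono T \<delta> ps"]) (rule refl)
        ultimately show ?thesis by simp
      qed
      moreover have "?G c \<in> ?S" if "c \<in> yangian_ideal T" for c
        using that mono_falg[OF \<delta> mult.prems(1)] pw_falg[OF mult.hyps(2)]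
        by (intro S_J ideal_scal ideal_mult_left ideal_mult_right)
      moreover have "c \<in> fm.span (Zgen ?I d \<union> yangian_ideal T)"
        by (rule qspan_fspan[OF c[unfolded Zs_def]]) (auto intro: fm.span_base)
      ultimately show ?thesis
        unfolding sorted_span_def
        by (intro fspan_image[of c _ ?G]) (use G_add G_scal in auto)
    qed
    moreover have "c \<in> fm.span ((\<lambda>\<beta>. rvec T \<delta> (\<beta>, d)) ` set (pos_roots T) \<union> Zs T d)"
      by (rule qspan_fspan[OF \<open>c \<in> Ksp T \<delta> d\<close>[unfolded Ksp_def]]) (auto intro: fm.span_base)
    ultimately show ?case
      unfolding sorted_span_def
      by (intro fspan_image[of c _ ?G]) (use G_add G_scal in auto)
  qed
  show ?case using mix[of k e g "[]" a] 1(2,3) by (simp add: root_mono_def)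
qed

text \<open>The preimage in the free algebra of the algebra generated by \<open>hbar\<close> times
  all Lie words: each Lie factor is accompanied by at least one power of
  \<open>hbar\<close>.\<close>

definition rees :: "cartan_type \<Rightarrow> free_elem set" where
  "rees T = fm.span ({scal (hbar ^ a) * g | a k e g. pw (index_set T) k e g \<and> k \<le> a} \<union> yangian_ideal T)"

lemma rees_sorted_span:
  assumes "valid T" "decomposition T \<delta>"
  shows "rees T \<subseteq> sorted_span T \<delta>"
  unfolding rees_def
proof (rule fm.span_minimal)
  show "{scal (hbar ^ a) * g | a k e g. pw (index_set T) k e g \<and> k \<le> a} \<union> yangian_ideal T \<subseteq> sorted_span T \<delta>"
    using pw_sorted_span[OF assms] by (auto simp: sorted_span_def intro: fm.span_base)
qed (simp add: sorted_span_def)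

lemma falg_subspace: "fm.subspace (falg I)"
  by (intro fm.subspaceI) (auto intro: falg_0 falg_add falg_mult falg_scal)

lemma rees_falg: "rees T \<subseteq> falg (index_set T)"
  unfolding rees_def
  by (rule fm.span_minimal[OF _ falg_subspace])
    (auto intro!: falg_mult falg_scal dest: pw_falg ideal_falg)

lemma rees_base: "pw (index_set T) k e g \<Longrightarrow> k \<le> a \<Longrightarrow> scal (hbar ^ a) * g \<in> rees T"
  unfolding rees_def by (intro fm.span_base) auto

lemma rees_ideal: "f \<in> yangian_ideal T \<Longrightarrow> f \<in> rees T"
  unfolding rees_def by (intro fm.span_base) auto

lemma rees_ops: "0 \<in> rees T" "f \<in> rees T \<Longrightarrow> g \<in> rees T \<Longrightarrow> f + g \<in> rees T"
  "f \<in> rees T \<Longrightarrow> scal c * f \<in> rees T" "f \<in> rees T \<Longrightarrow> - f \<in> rees T"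
  unfolding rees_def by (simp_all add: fm.span_zero fm.span_add fm.span_scale fm.span_neg)

lemma rees_mult:
  assumes "f \<in> rees T" "g \<in> rees T"
  shows "f * g \<in> rees T"
proof -
  let ?I = "index_set T"
  let ?G = "{scal (hbar ^ a) * g | a k e g. pw ?I k e g \<and> k \<le> a}"
  have base: "a * b \<in> rees T" if "a \<in> ?G \<union> yangian_ideal T" "b \<in> ?G \<union> yangian_ideal T" for a b
  proof (cases "a \<in> yangian_ideal T \<or> b \<in> yangian_ideal T")
    case True
    have "x \<in> falg ?I" if "x \<in> ?G \<union> yangian_ideal T" for x
      using that fm.span_base[OF that] rees_falg[of T] unfolding rees_def by blast
    from this[OF that(1)] this[OF that(2)] show ?thesis
      using True by (blast intro: rees_ideal ideal_mult_left ideal_mult_right)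
  next
    case False
    then have "a \<in> ?G" "b \<in> ?G" using that by auto
    obtain n k e x where a: "a = scal (hbar ^ n) * x" "pw ?I k e x" "k \<le> n" using \<open>a \<in> ?G\<close> by blast
    obtain n' k' e' x' where b: "b = scal (hbar ^ n') * x'" "pw ?I k' e' x'" "k' \<le> n'" using \<open>b \<in> ?G\<close> by blast
    have "a * b = scal (hbar ^ (n + n')) * (x * x')"
      unfolding a(1) b(1) power_add scal_mult mult.assoc by (subst scal_left_commute[of x]) (rule refl)
    then show ?thesis using rees_base[OF pw_mult[OF a(2) b(2)], of "n + n'"] a(3) b(3) by simp
  qed
  have "a * g \<in> rees T" if a: "a \<in> ?G \<union> yangian_ideal T" for a
    unfolding rees_def
    by (rule fspan_image[OF assms(2)[unfolded rees_def]])
      (use base[OF a] in \<open>auto simp: distrib_left scal_left_commute[of a] rees_def\<close>)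
  then show ?thesis
    unfolding rees_def
    by (intro fspan_image[OF assms(1)[unfolded rees_def], of "\<lambda>f. f * g"])
      (auto simp: distrib_right mult.assoc)
qed

lemma bmono_rees:
  assumes "decomposition T \<delta>" "set ps \<subseteq> set (pos_roots T) \<times> UNIV"
  shows "bmono T \<delta> ps \<in> rees T"
  unfolding bmono_def using rees_base[OF mono_pw[OF assms]] by simp

lemma rees_subring: "subring (proj T ` rees T) (yangian T)"
  and rees_submodule: "submodule (proj T ` rees T) Q_hbar (yangian T)"
proof -
  interpret Y: ring "yangian T" by (rule yangian_ring)
  interpret M: Module.module Q_hbar "yangian T" by (rule yangian_module)
  have car: "proj T ` rees T \<subseteq> carrier (yangian T)" using rees_falg by (auto simp: yangian_simps)
  have fa: "f \<in> falg (index_set T)" if "f \<in> rees T" for f using that rees_falg by blast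
  have "pw (index_set T) 0 0 1" by (rule pw.one)
  from rees_base[OF this, of 0] have one: "1 \<in> rees T" by simp
  have neg: "\<ominus>\<^bsub>yangian T\<^esub> X \<in> proj T ` rees T" if "X \<in> proj T ` rees T" for X
    using that by (auto simp: yangian_a_inv fa intro!: imageI rees_ops)
  have add: "X \<oplus>\<^bsub>yangian T\<^esub> X' \<in> proj T ` rees T" if "X \<in> proj T ` rees T" "X' \<in> proj T ` rees T" for X X'
    using that by (auto simp: yangian_simps fa intro!: imageI rees_ops)
  show "subring (proj T ` rees T) (yangian T)"
  proof (rule Y.subringI[OF car])
    show "\<one>\<^bsub>yangian T\<^esub> \<in> proj T ` rees T" using one by (auto simp: yangian_simps)
    show "X \<otimes>\<^bsub>yangian T\<^esub> X' \<in> proj T ` rees T" if "X \<in> proj T ` rees T" "X' \<in> proj T ` rees T" for X X'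
      using that by (auto simp: yangian_simps fa intro!: imageI rees_mult)
  qed (use neg add in auto)
  show "submodule (proj T ` rees T) Q_hbar (yangian T)"
  proof (rule M.submoduleI[OF car])
    show "\<zero>\<^bsub>yangian T\<^esub> \<in> proj T ` rees T" using rees_ops(1) by (auto simp: yangian_simps)
    show "c \<odot>\<^bsub>yangian T\<^esub> X \<in> proj T ` rees T" if "X \<in> proj T ` rees T" for c X
      using that by (auto simp: yangian_simps fa intro!: imageI rees_ops)
  qed (use neg add in auto)
qed

lemma bmono_subalgebra:
  assumes \<delta>: "decomposition T \<delta>" and S: "subring S (yangian T)"
    and gens: "bar_root_vector T \<delta> ` (set (pos_roots T) \<times> UNIV) \<subseteq> S"
    and ps: "set ps \<subseteq> set (pos_roots T) \<times> UNIV"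
  shows "proj T (bmono T \<delta> ps) \<in> S"
  using ps
proof (induction ps)
  case Nil
  then show ?case using subringE(3)[OF S] by (simp add: yangian_simps)
next
  case (Cons p ps)
  then have p: "p \<in> set (pos_roots T) \<times> UNIV" and ps: "set ps \<subseteq> set (pos_roots T) \<times> UNIV" by auto
  have "proj T (bmono T \<delta> [p]) \<in> S" using gens bar_root_vector_proj[OF \<delta> p] p by blast
  then have "proj T (bmono T \<delta> [p]) \<otimes>\<^bsub>yangian T\<^esub> proj T (bmono T \<delta> ps) \<in> S"
    using Cons.IH[OF ps] subringE(6)[OF S] by blast
  moreover have "bmono T \<delta> (p # ps) = bmono T \<delta> [p] * bmono T \<delta> ps"
    using bmono_append[of T \<delta> "[p]" ps] by simp
  ultimately show ?case
    using bmono_falg[OF \<delta>, of "[p]"] bmono_falg[OF \<delta> ps] p by (simp add: yangian_simps)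
qed

text \<open>One inclusion holds because root vectors are Lie words, the other because modulo the
  ideal \<open>rees\<close> is spanned by ordered monomials. The choice of \<delta> has disappeared
  from the right side, which is the first half of the theorem.\<close>

lemma dg_dual_rees:
  assumes T: "valid T" and \<delta>: "decomposition T \<delta>"
  shows "dg_dual T \<delta> = proj T ` rees T"
proof
  let ?G = "bar_root_vector T \<delta> ` (set (pos_roots T) \<times> UNIV)"
  have "?G \<subseteq> proj T ` rees T"
    using bar_root_vector_proj[OF \<delta>] bmono_rees[OF \<delta>] by fastforce
  then show "dg_dual T \<delta> \<subseteq> proj T ` rees T"
    unfolding dg_dual_def generated_subalgebra_def using rees_subring rees_submodule by blast
  have "proj T ` rees T \<subseteq> S"
    if S: "subring S (yangian T)" "submodule S Q_hbar (yangian T)" "?G \<subseteq> S" for S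
  proof -
    interpret S: submodule S Q_hbar "yangian T" by (rule S(2))
    have z: "proj T 0 \<in> S" using subringE(2)[OF S(1)] by (simp add: yangian_simps)
    have "fm.subspace {f \<in> falg (index_set T). proj T f \<in> S}"
    proof (rule fm.subspaceI)
      show "0 \<in> {f \<in> falg (index_set T). proj T f \<in> S}" using z by (simp add: falg_0)
      show "f + g \<in> {f \<in> falg (index_set T). proj T f \<in> S}"
        if "f \<in> {f \<in> falg (index_set T). proj T f \<in> S}" "g \<in> {f \<in> falg (index_set T). proj T f \<in> S}" for f g
      proof -
        have "proj T f \<oplus>\<^bsub>yangian T\<^esub> proj T g \<in> S" using subringE(7)[OF S(1)] that by blast
        then show ?thesis using that by (simp add: yangian_simps falg_add)
      qed
      show "scal c * f \<in> {f \<in> falg (index_set T). proj T f \<in> S}"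
        if "f \<in> {f \<in> falg (index_set T). proj T f \<in> S}" for c f
      proof -
        have "c \<odot>\<^bsub>yangian T\<^esub> proj T f \<in> S" using S.smult_closed[of c] that by simp
        then show ?thesis using that by (simp add: yangian_simps falg_mult falg_scal)
      qed
    qed
    moreover have "bmono T \<delta> (expand T h) \<in> {f \<in> falg (index_set T). proj T f \<in> S}"
      if "h \<in> exponents T" for h
      using bmono_subalgebra[OF \<delta> S(1,3) set_expand[OF that]] bmono_falg[OF \<delta> set_expand[OF that]] by simp
    moreover have "f \<in> {f \<in> falg (index_set T). proj T f \<in> S}" if "f \<in> yangian_ideal T" for f
    proof -
      have "proj T f = proj T 0" using that by (simp add: proj_eq_iff)
      then show ?thesis using z that by (simp add: ideal_falg)
    qed
    ultimately have "sorted_span T \<delta> \<subseteq> {f \<in> falg (index_set T). proj T f \<in> S}"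
      unfolding sorted_span_def by (intro fm.span_minimal) auto
    then show ?thesis using rees_sorted_span[OF T \<delta>] by blast
  qed
  then show "proj T ` rees T \<subseteq> dg_dual T \<delta>"
    unfolding dg_dual_def generated_subalgebra_def by blast
qed

lemma sorted_span_sum:
  assumes "f \<in> sorted_span T \<delta>"
  obtains S c where "finite S" "S \<subseteq> exponents T"
    "f - (\<Sum>h\<in>S. scal (c h) * bmono T \<delta> (expand T h)) \<in> yangian_ideal T"
proof -
  let ?b = "\<lambda>h. bmono T \<delta> (expand T h)"
  have "\<exists>c. finite {h. c h \<noteq> 0} \<and> {h. c h \<noteq> 0} \<subseteq> exponents T \<and>
      f - (\<Sum>h | c h \<noteq> 0. scal (c h) * ?b h) \<in> yangian_ideal T"
    using assms unfolding sorted_span_def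
  proof (induction rule: fm.span_induct_alt)
    case base
    then show ?case by (intro exI[of _ "\<lambda>_. 0"]) (simp add: ideal_0)
  next
    case (step r x y)
    then obtain c where c: "finite {h. c h \<noteq> 0}" "{h. c h \<noteq> 0} \<subseteq> exponents T"
      "y - (\<Sum>h | c h \<noteq> 0. scal (c h) * ?b h) \<in> yangian_ideal T" by blast
    show ?case
    proof (cases "x \<in> yangian_ideal T")
      case True
      have "scal r * x + (y - (\<Sum>h | c h \<noteq> 0. scal (c h) * ?b h)) \<in> yangian_ideal T"
        by (intro ideal_add ideal_scal True c)
      then show ?thesis using c by (intro exI[of _ c]) (simp add: algebra_simps)
    next
      case False
      then obtain k where k: "k \<in> exponents T" "x = ?b k" using step by blast
      define c' where "c' = c(k := c k + r)"
      let ?S = "insert k {h. c h \<noteq> 0}"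
      have sub: "{h. c' h \<noteq> 0} \<subseteq> ?S" by (auto simp: c'_def)
      have sum_c: "(\<Sum>h | c h \<noteq> 0. scal (c h) * ?b h) = (\<Sum>h\<in>?S. scal (c h) * ?b h)"
        using c(1) by (intro sum.mono_neutral_left) auto
      have "(\<Sum>h | c' h \<noteq> 0. scal (c' h) * ?b h) = (\<Sum>h\<in>?S. scal (c' h) * ?b h)"
        using c(1) sub by (intro sum.mono_neutral_left) auto
      also have "\<dots> = (\<Sum>h\<in>?S. scal (c h) * ?b h + (if h = k then scal r * ?b k else 0))"
        by (intro sum.cong refl) (simp add: c'_def scal_add distrib_right)
      also have "\<dots> = (\<Sum>h | c h \<noteq> 0. scal (c h) * ?b h) + scal r * x"
        unfolding sum_c k(2) using c(1) by (simp add: sum.distrib)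
      finally have "scal r * x + y - (\<Sum>h | c' h \<noteq> 0. scal (c' h) * ?b h) \<in> yangian_ideal T"
        using c(3) by simp
      moreover have "finite {h. c' h \<noteq> 0}" using sub c(1) finite_subset by blast
      moreover have "{h. c' h \<noteq> 0} \<subseteq> exponents T" using sub c(2) k(1) by blast
      ultimately show ?thesis by blast
    qed
  qed
  then show thesis using that by blast
qed

text \<open>Reduces the module statement to independence modulo the ideal in the free algebra;
  spanning comes from \<open>rees_sorted_span\<close>.\<close>

lemma basis_from_independence:
  assumes T: "valid T" and \<delta>: "decomposition T \<delta>"
    and indep: "\<And>S c. finite S \<Longrightarrow> S \<subseteq> exponents T \<Longrightarrow>
      (\<Sum>h\<in>S. scal (c h) * bmono T \<delta> (expand T h)) \<in> yangian_ideal T \<Longrightarrow> \<forall>h\<in>S. c h = 0"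
  shows "module_basis Q_hbar (yangian T\<lparr>carrier := dg_dual T \<delta>\<rparr>) (ordered_monomial T \<delta>) (exponents T)"
proof -
  let ?M = "yangian T\<lparr>carrier := dg_dual T \<delta>\<rparr>"
  let ?b = "\<lambda>h. bmono T \<delta> (expand T h)"
  have mod: "Module.module Q_hbar ?M"
    unfolding dg_dual_rees[OF T \<delta>]
    by (rule submodule.submodule_is_module[OF rees_submodule yangian_module])
  interpret M: Module.module Q_hbar ?M by (rule mod)
  have bfa: "?b h \<in> falg (index_set T)" if "h \<in> exponents T" for h
    by (rule bmono_falg[OF \<delta> set_expand[OF that]])
  have bre: "?b h \<in> rees T" if "h \<in> exponents T" for h
    by (rule bmono_rees[OF \<delta> set_expand[OF that]])
  have om: "ordered_monomial T \<delta> h = proj T (?b h)" if "h \<in> exponents T" for h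
    by (rule ordered_monomial_proj[OF \<delta> that])
  have car: "ordered_monomial T \<delta> h \<in> carrier ?M" if "h \<in> exponents T" for h
    using bre[OF that] om[OF that] by (simp add: dg_dual_rees[OF T \<delta>])
  have sum: "(\<Oplus>\<^bsub>?M\<^esub> h \<in> S. c h \<odot>\<^bsub>?M\<^esub> ordered_monomial T \<delta> h) = proj T (\<Sum>h\<in>S. scal (c h) * ?b h)"
    if "finite S" "S \<subseteq> exponents T" for S c
    using that
  proof (induction S rule: finite_induct)
    case empty
    then show ?case by (simp add: yangian_simps)
  next
    case (insert h S)
    have "(\<Oplus>\<^bsub>?M\<^esub> h \<in> insert h S. c h \<odot>\<^bsub>?M\<^esub> ordered_monomial T \<delta> h) =
        c h \<odot>\<^bsub>?M\<^esub> ordered_monomial T \<delta> h \<oplus>\<^bsub>?M\<^esub> (\<Oplus>\<^bsub>?M\<^esub> h \<in> S. c h \<odot>\<^bsub>?M\<^esub> ordered_monomial T \<delta> h)"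
    proof (rule M.finsum_insert)
      show "(\<lambda>h. c h \<odot>\<^bsub>?M\<^esub> ordered_monomial T \<delta> h) \<in> S \<rightarrow> carrier ?M"
        using car insert.prems M.smult_closed by (auto simp del: partial_object.simps)
      show "c h \<odot>\<^bsub>?M\<^esub> ordered_monomial T \<delta> h \<in> carrier ?M"
        using car[of h] insert.prems by (intro M.smult_closed) auto
    qed (use insert in auto)
    also have "\<dots> = proj T (scal (c h) * ?b h) \<oplus>\<^bsub>yangian T\<^esub> proj T (\<Sum>h\<in>S. scal (c h) * ?b h)"
      using insert om bfa by (simp add: yangian_simps)
    also have "\<dots> = proj T (\<Sum>h\<in>insert h S. scal (c h) * ?b h)"
      using insert bfa by (subst yangian_simps) (auto intro!: falg_mult falg_scal falg_sum)
    finally show ?case .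
  qed
  show ?thesis
    unfolding module_basis_def
  proof (intro conjI ballI allI impI)
    show "Module.module Q_hbar ?M" by (rule mod)
    show "ordered_monomial T \<delta> \<in> exponents T \<rightarrow> carrier ?M" using car by blast
  next
    fix X assume "X \<in> carrier ?M"
    then have "X \<in> proj T ` rees T" by (simp add: dg_dual_rees[OF T \<delta>])
    then obtain f where f: "f \<in> rees T" "X = proj T f" by (rule imageE)
    obtain S c where S: "finite S" "S \<subseteq> exponents T" "f - (\<Sum>h\<in>S. scal (c h) * ?b h) \<in> yangian_ideal T"
      using subsetD[OF rees_sorted_span[OF T \<delta>] f(1)] by (rule sorted_span_sum)
    have "X = (\<Oplus>\<^bsub>?M\<^esub> h \<in> S. c h \<odot>\<^bsub>?M\<^esub> ordered_monomial T \<delta> h)"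
      unfolding sum[OF S(1,2)] f(2) proj_eq_iff by (rule S(3))
    then show "\<exists>S c. finite S \<and> S \<subseteq> exponents T \<and> c \<in> S \<rightarrow> carrier Q_hbar \<and>
        X = (\<Oplus>\<^bsub>?M\<^esub> h \<in> S. c h \<odot>\<^bsub>?M\<^esub> ordered_monomial T \<delta> h)"
      using S by (intro exI[of _ S] exI[of _ c]) simp
  next
    fix S c h
    assume *: "finite S \<and> S \<subseteq> exponents T \<and> c \<in> S \<rightarrow> carrier Q_hbar \<and>
      (\<Oplus>\<^bsub>?M\<^esub> h \<in> S. c h \<odot>\<^bsub>?M\<^esub> ordered_monomial T \<delta> h) = \<zero>\<^bsub>?M\<^esub>" and h: "h \<in> S"
    then have "proj T (\<Sum>h\<in>S. scal (c h) * ?b h) = proj T 0"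
      using sum[of S c] by (simp add: yangian_simps)
    then have "(\<Sum>h\<in>S. scal (c h) * ?b h) \<in> yangian_ideal T"
      unfolding proj_eq_iff by simp
    then show "c h = \<zero>\<^bsub>Q_hbar\<^esub>" using indep[of S c] * h by simp
  qed
qed

section \<open>Two rational identities\<close>

text \<open>Partial fractions in \<open>w\<close>: the poles \<open>p u\<close> are simple, the
  residue at \<open>p u\<close> is \<open>c\<close> times the product over the other points, and the
  value at infinity is 1.\<close>

lemma prod_partial_fraction:
  fixes p :: "'a \<Rightarrow> 'b::field"
  assumes "finite Z" "inj_on p Z" "w \<notin> p ` Z"
  shows "(\<Prod>z\<in>Z. 1 + c / (w - p z)) =
    1 + (\<Sum>u\<in>Z. c / (w - p u) * (\<Prod>z\<in>Z - {u}. 1 + c / (p u - p z)))"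
  using assms
proof (induction Z arbitrary: w rule: finite_induct)
  case (insert v Z)
  let ?P = "\<lambda>w. \<Prod>z\<in>Z. 1 + c / (w - p z)"
  let ?R = "\<lambda>u. \<Prod>z\<in>Z - {u}. 1 + c / (p u - p z)"
  have ne: "p u \<noteq> p v" if "u \<in> Z" for u using insert that by (auto simp: inj_on_def)
  have wv: "w \<noteq> p v" using insert by auto
  have wu: "w \<noteq> p u" if "u \<in> Z" for u using insert that by auto
  have IHw: "(\<Sum>u\<in>Z. c / (w - p u) * ?R u) = ?P w - 1"
    using insert.IH[of w] insert.prems by (simp add: inj_on_def)
  have IHv: "(\<Sum>u\<in>Z. c / (p v - p u) * ?R u) = ?P (p v) - 1"
  proof -
    have "p v \<notin> p ` Z" using ne by force
    then show ?thesis using insert.IH[of "p v"] insert.prems by (simp add: inj_on_def)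
  qed
  have split: "c / (w - p u) * (c / (p u - p v)) = c / (w - p v) * (c / (w - p u) - c / (p v - p u))"
    if "u \<in> Z" for u
    using ne[OF that] wu[OF that] wv by (simp add: divide_simps) (simp add: algebra_simps)
  have "(\<Sum>u\<in>insert v Z. c / (w - p u) * (\<Prod>z\<in>insert v Z - {u}. 1 + c / (p u - p z))) =
      c / (w - p v) * ?P (p v) + (\<Sum>u\<in>Z. c / (w - p u) * ((1 + c / (p u - p v)) * ?R u))"
  proof -
    have "insert v Z - {v} = Z" using insert by auto
    moreover have "insert v Z - {u} = insert v (Z - {u})" "v \<notin> Z - {u}" if "u \<in> Z" for u
      using insert that by auto
    ultimately show ?thesis using insert by (simp cong: sum.cong)
  qed
  also have "(\<Sum>u\<in>Z. c / (w - p u) * ((1 + c / (p u - p v)) * ?R u)) =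
      (\<Sum>u\<in>Z. c / (w - p u) * ?R u + c / (w - p v) * (c / (w - p u) * ?R u - c / (p v - p u) * ?R u))"
  proof (rule sum.cong[OF refl])
    fix u assume "u \<in> Z"
    have "c / (w - p u) * ((1 + c / (p u - p v)) * ?R u) =
        c / (w - p u) * ?R u + (c / (w - p u) * (c / (p u - p v))) * ?R u"
      by (simp add: algebra_simps)
    then show "c / (w - p u) * ((1 + c / (p u - p v)) * ?R u) =
        c / (w - p u) * ?R u + c / (w - p v) * (c / (w - p u) * ?R u - c / (p v - p u) * ?R u)"
      unfolding split[OF \<open>u \<in> Z\<close>] by (simp only: algebra_simps)
  qed
  also have "\<dots> = (?P w - 1) + c / (w - p v) * ((?P w - 1) - (?P (p v) - 1))"
    unfolding sum.distrib sum_distrib_left[symmetric] sum_subtractf IHw IHv ..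
  finally have sum: "(\<Sum>u\<in>insert v Z. c / (w - p u) * (\<Prod>z\<in>insert v Z - {u}. 1 + c / (p u - p z))) =
      c / (w - p v) * ?P (p v) + ((?P w - 1) + c / (w - p v) * ((?P w - 1) - (?P (p v) - 1)))" .
  have "(1 + K) * A = 1 + (K * V + ((A - 1) + K * ((A - 1) - (V - 1))))" for K A V :: 'b
    by (simp add: algebra_simps)
  from this[of "c / (w - p v)" "?P w" "?P (p v)"]
  show ?case unfolding sum prod.insert[OF insert(1,2)] .
qed simp

text \<open>Up to a factor \<open>c\<close> these are the coefficients of 1/w and 1/w^2 at infinity
  in the partial fraction expansion of the product.\<close>

lemma sum_prod_shift:
  fixes p :: "'a \<Rightarrow> 'b::field_char_0"
  assumes "finite Z" "inj_on p Z"
  shows "(\<Sum>u\<in>Z. \<Prod>z\<in>Z - {u}. 1 + c / (p u - p z)) = of_nat (card Z)"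
    and "(\<Sum>u\<in>Z. p u * (\<Prod>z\<in>Z - {u}. 1 + c / (p u - p z))) =
      (\<Sum>u\<in>Z. p u) + c * of_nat (card Z) * (of_nat (card Z) - 1) / 2"
proof -
  have "(\<Sum>u\<in>Z. \<Prod>z\<in>Z - {u}. 1 + c / (p u - p z)) = of_nat (card Z) \<and>
    (\<Sum>u\<in>Z. p u * (\<Prod>z\<in>Z - {u}. 1 + c / (p u - p z))) =
      (\<Sum>u\<in>Z. p u) + c * of_nat (card Z) * (of_nat (card Z) - 1) / 2"
    using assms
  proof (induction Z rule: finite_induct)
    case (insert w Z)
    let ?R = "\<lambda>u. \<Prod>z\<in>Z - {u}. 1 + c / (p u - p z)"
    have ne: "p u \<noteq> p w" if "u \<in> Z" for u using insert that by (auto simp: inj_on_def)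
    have IH: "(\<Sum>u\<in>Z. ?R u) = of_nat (card Z)"
      "(\<Sum>u\<in>Z. p u * ?R u) = (\<Sum>u\<in>Z. p u) + c * of_nat (card Z) * (of_nat (card Z) - 1) / 2"
      using insert by (auto simp: inj_on_def)
    have pf: "(\<Prod>z\<in>Z. 1 + c / (p w - p z)) = 1 + (\<Sum>u\<in>Z. c / (p w - p u) * ?R u)"
      using insert ne by (intro prod_partial_fraction) (auto simp: inj_on_def)
    have sp: "(\<Sum>u\<in>insert w Z. f u * (\<Prod>z\<in>insert w Z - {u}. 1 + c / (p u - p z))) =
        f w * (\<Prod>z\<in>Z. 1 + c / (p w - p z)) + (\<Sum>u\<in>Z. f u * ((1 + c / (p u - p w)) * ?R u))" for f
    proof -
      have "insert w Z - {w} = Z" using insert by auto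
      moreover have "insert w Z - {u} = insert w (Z - {u})" "w \<notin> Z - {u}" if "u \<in> Z" for u
        using insert that by auto
      ultimately show ?thesis using insert by (simp cong: sum.cong)
    qed
    have "(\<Sum>u\<in>insert w Z. 1 * (\<Prod>z\<in>insert w Z - {u}. 1 + c / (p u - p z))) =
        1 + (\<Sum>u\<in>Z. c / (p w - p u) * ?R u + (1 + c / (p u - p w)) * ?R u)"
      unfolding sp pf by (simp add: sum.distrib)
    also have "\<dots> = 1 + (\<Sum>u\<in>Z. ?R u)"
    proof (rule arg_cong2[of _ _ _ _ "(+)", OF refl sum.cong[OF refl]])
      fix u assume "u \<in> Z"
      then have "c / (p w - p u) + (1 + c / (p u - p w)) = 1"
      proof -
        have m: "c / (p w - p u) = - (c / (p u - p w))" using minus_divide_right[of c "p u - p w"] by simp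
        show ?thesis unfolding m by simp
      qed
      then show "c / (p w - p u) * ?R u + (1 + c / (p u - p w)) * ?R u = ?R u"
        using arg_cong[of _ _ "\<lambda>t. t * ?R u"] by (simp only: distrib_right[symmetric] mult_1_left)
    qed
    finally have 1: "(\<Sum>u\<in>insert w Z. \<Prod>z\<in>insert w Z - {u}. 1 + c / (p u - p z)) = of_nat (card (insert w Z))"
      using IH insert by simp
    have "(\<Sum>u\<in>insert w Z. p u * (\<Prod>z\<in>insert w Z - {u}. 1 + c / (p u - p z))) =
        p w + (\<Sum>u\<in>Z. p w * (c / (p w - p u) * ?R u) + p u * ((1 + c / (p u - p w)) * ?R u))"
      unfolding sp pf by (simp add: sum.distrib distrib_left sum_distrib_left)
    also have "\<dots> = p w + (\<Sum>u\<in>Z. p u * ?R u + c * ?R u)"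
    proof (rule arg_cong2[of _ _ _ _ "(+)", OF refl sum.cong[OF refl]])
      fix u assume "u \<in> Z"
      then have q: "(p u - p w) * (c / (p u - p w)) = c" using ne[of u] by simp
      have m: "c / (p w - p u) = - (c / (p u - p w))" using minus_divide_right[of c "p u - p w"] by simp
      have "b * (- q) + a * (1 + q) = a + (a - b) * q" for a b q :: 'b by (simp add: algebra_simps)
      from this[of "p w" "c / (p u - p w)" "p u"]
      have "p w * (c / (p w - p u)) + p u * (1 + c / (p u - p w)) = p u + c"
        unfolding m q .
      from arg_cong[OF this, of "\<lambda>t. t * ?R u"]
      show "p w * (c / (p w - p u) * ?R u) + p u * ((1 + c / (p u - p w)) * ?R u) = p u * ?R u + c * ?R u"
        by (simp only: distrib_right mult.assoc)
    qed
    also have "\<dots> = p w + ((\<Sum>u\<in>Z. p u) + c * of_nat (card Z) * (of_nat (card Z) - 1) / 2 + c * of_nat (card Z))"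
      unfolding sum.distrib IH sum_distrib_left[symmetric] ..
    finally show ?case using 1 insert by (simp add: field_simps)
  qed simp
  then show "(\<Sum>u\<in>Z. \<Prod>z\<in>Z - {u}. 1 + c / (p u - p z)) = of_nat (card Z)"
    "(\<Sum>u\<in>Z. p u * (\<Prod>z\<in>Z - {u}. 1 + c / (p u - p z))) =
      (\<Sum>u\<in>Z. p u) + c * of_nat (card Z) * (of_nat (card Z) - 1) / 2" by auto
qed

section \<open>Polarization\<close>

lemma sum_lists_Suc:
  assumes "finite S"
  shows "(\<Sum>l | set l \<subseteq> S \<and> length l = Suc m. f l) =
    (\<Sum>k\<in>S. \<Sum>l | set l \<subseteq> S \<and> length l = m. (f (k # l) :: 'b::comm_monoid_add))"
proof -
  have "(\<Sum>l | set l \<subseteq> S \<and> length l = Suc m. f l) =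
      sum f ((\<lambda>(l, k). k # l) ` ({l. set l \<subseteq> S \<and> length l = m} \<times> S))"
    by (simp only: lists_length_Suc_eq)
  also have "\<dots> = (\<Sum>(l, k)\<in>{l. set l \<subseteq> S \<and> length l = m} \<times> S. f (k # l))"
    by (subst sum.reindex) (auto simp: inj_on_def intro!: sum.cong)
  also have "\<dots> = (\<Sum>l | set l \<subseteq> S \<and> length l = m. \<Sum>k\<in>S. f (k # l))"
    by (rule sum.cartesian_product[symmetric])
  also have "\<dots> = (\<Sum>k\<in>S. \<Sum>l | set l \<subseteq> S \<and> length l = m. f (k # l))"
    by (rule sum.swap)
  finally show ?thesis .
qed

lemma sum_Pow_sign:
  assumes "finite C"
  shows "(\<Sum>R\<in>Pow C. (- 1) ^ card R) = (if C = {} then 1 else (0 :: real))"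
proof -
  have "(\<Sum>R\<in>Pow C. (- 1) ^ card R) = (\<Sum>R\<in>Pow C. (\<Prod>x\<in>R. - 1) * (\<Prod>x\<in>C - R. (1::real)))"
    by simp
  also have "\<dots> = (\<Prod>x\<in>C. - 1 + 1)" using prod_add[OF assms, of "\<lambda>_. - 1" "\<lambda>_. 1 :: real"] by simp
  finally show ?thesis using assms by (simp add: power_0_left)
qed

text \<open>Inclusion-exclusion over \<open>S\<close>: the signs cancel on every list that misses an
  index, and a list of length \<open>m\<close> that misses none is a permutation.\<close>

lemma polarization_lists:
  fixes X :: "nat list \<Rightarrow> real"
  assumes "\<And>S. S \<subseteq> {..<m} \<Longrightarrow> (\<Sum>l | set l \<subseteq> S \<and> length l = m. X l) = 0"
  shows "(\<Sum>\<sigma> | \<sigma> permutes {..<m}. X (map \<sigma> [0..<m])) = 0"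
proof -
  let ?L = "{l. set l \<subseteq> {..<m} \<and> length l = m}"
  have fin: "finite ?L" by (rule finite_lists_length_eq) simp
  have "0 = (\<Sum>S\<in>Pow {..<m}. (- 1) ^ card S * (\<Sum>l | set l \<subseteq> S \<and> length l = m. X l))"
    using assms by simp
  also have "\<dots> = (\<Sum>S\<in>Pow {..<m}. \<Sum>l\<in>?L. if set l \<subseteq> S then (- 1) ^ card S * X l else 0)"
  proof (rule sum.cong[OF refl])
    fix S assume "S \<in> Pow {..<m}"
    then have "{l. set l \<subseteq> S \<and> length l = m} = {l \<in> ?L. set l \<subseteq> S}" by auto
    then show "(- 1) ^ card S * (\<Sum>l | set l \<subseteq> S \<and> length l = m. X l) =
        (\<Sum>l\<in>?L. if set l \<subseteq> S then (- 1) ^ card S * X l else 0)"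
      using fin by (simp add: sum_distrib_left sum.If_cases Int_def)
  qed
  also have "\<dots> = (\<Sum>l\<in>?L. \<Sum>S\<in>Pow {..<m}. if set l \<subseteq> S then (- 1) ^ card S * X l else 0)"
    by (rule sum.swap)
  also have "\<dots> = (\<Sum>l\<in>?L. if set l = {..<m} then (- 1) ^ m * X l else 0)"
  proof (rule sum.cong[OF refl])
    fix l assume l: "l \<in> ?L"
    have "(\<Sum>S\<in>Pow {..<m}. if set l \<subseteq> S then (- 1) ^ card S * X l else 0) =
        (\<Sum>S\<in>{S \<in> Pow {..<m}. set l \<subseteq> S}. (- 1) ^ card S * X l)"
      by (subst sum.inter_filter[symmetric]) auto
    also have "\<dots> = (\<Sum>R\<in>Pow ({..<m} - set l). (- 1) ^ card (set l) * (- 1) ^ card R * X l)"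
    proof (rule sum.reindex_bij_witness[where i = "\<lambda>R. set l \<union> R" and j = "\<lambda>S. S - set l"])
      fix S assume S: "S \<in> {S \<in> Pow {..<m}. set l \<subseteq> S}"
      then have "finite S" using finite_subset by auto
      then have "card S = card (set l) + card (S - set l)" using S
        by (metis (no_types, lifting) List.finite_set card_Un_disjoint Diff_disjoint Un_Diff_cancel
            finite_Diff mem_Collect_eq sup.absorb2)
      then show "(- 1) ^ card (set l) * (- 1) ^ card (S - set l) * X l = (- 1) ^ card S * X l"
        by (simp add: power_add)
    qed (use l in auto)
    also have "\<dots> = (- 1) ^ card (set l) * (\<Sum>R\<in>Pow ({..<m} - set l). (- 1) ^ card R) * X l"
      by (simp add: sum_distrib_left sum_distrib_right)
    also have "\<dots> = (if set l = {..<m} then (- 1) ^ m * X l else 0)"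
      using l by (auto simp: sum_Pow_sign)
    finally show "(\<Sum>S\<in>Pow {..<m}. if set l \<subseteq> S then (- 1) ^ card S * X l else 0) =
        (if set l = {..<m} then (- 1) ^ m * X l else 0)" .
  qed
  also have "\<dots> = (- 1) ^ m * (\<Sum>l\<in>{l \<in> ?L. set l = {..<m}}. X l)"
    unfolding sum_distrib_left by (rule sum.inter_filter[OF fin, symmetric])
  also have "(\<Sum>l\<in>{l \<in> ?L. set l = {..<m}}. X l) = (\<Sum>\<sigma> | \<sigma> permutes {..<m}. X (map \<sigma> [0..<m]))"
  proof (rule sum.reindex_bij_witness[where i = "\<lambda>\<sigma>. map \<sigma> [0..<m]"
        and j = "\<lambda>l k. if k < m then l ! k else k"])
    fix l assume "l \<in> {l \<in> ?L. set l = {..<m}}"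
    then have l: "set l = {..<m}" "length l = m" by auto
    have "distinct l" by (rule card_distinct) (simp add: l)
    then have b: "bij_betw ((!) l) {..<m} {..<m}" by (rule bij_betw_nth) (simp_all only: l)
    have "bij_betw (\<lambda>k. if k < m then l ! k else k) {..<m} {..<m} \<longleftrightarrow> bij_betw ((!) l) {..<m} {..<m}"
      by (rule bij_betw_cong) simp
    with b have "bij_betw (\<lambda>k. if k < m then l ! k else k) {..<m} {..<m}" by blast
    then have "(\<lambda>k. if k < m then l ! k else k) permutes {..<m}"
      by (rule bij_imp_permutes) simp
    then show "(\<lambda>k. if k < m then l ! k else k) \<in> {\<sigma>. \<sigma> permutes {..<m}}" unfolding mem_Collect_eq .
    show eq: "map (\<lambda>k. if k < m then l ! k else k) [0..<m] = l"
      using l by (intro nth_equalityI) auto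
    show "X (map (\<lambda>k. if k < m then l ! k else k) [0..<m]) = X l" unfolding eq ..
  next
    fix \<sigma> assume "\<sigma> \<in> {\<sigma>. \<sigma> permutes {..<m}}"
    then have p: "\<sigma> permutes {..<m}" by simp
    show "(\<lambda>k. if k < m then map \<sigma> [0..<m] ! k else k) = \<sigma>"
      using permutes_not_in[OF p] by (auto simp: fun_eq_iff)
    show "map \<sigma> [0..<m] \<in> {l \<in> ?L. set l = {..<m}}"
      using permutes_image[OF p] by (auto simp: atLeast0LessThan)
  qed
  finally show ?thesis by simp
qed

text \<open>Turns the symmetrised Serre relation into the vanishing of the \<open>m\<close>-th power
  of one operator, the sum of the \<open>D k\<close> over \<open>k\<close> in
  \<open>S\<close>.\<close>

lemma polarization:
  fixes D :: "nat \<Rightarrow> ('b \<Rightarrow> real) \<Rightarrow> 'b \<Rightarrow> real"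
  assumes add: "\<And>k A F. finite A \<Longrightarrow> D k (\<lambda>\<mu>. \<Sum>g\<in>(A::nat list set). F g \<mu>) = (\<lambda>\<mu>. \<Sum>g\<in>A. D k (F g) \<mu>)"
    and van: "\<And>S. S \<subseteq> {..<m} \<Longrightarrow> ((\<lambda>F \<mu>. \<Sum>k\<in>S. D k F \<mu>) ^^ m) G = (\<lambda>_. 0)"
  shows "(\<Sum>\<sigma> | \<sigma> permutes {..<m}. foldr (\<lambda>k. D (\<sigma> k)) [0..<m] G \<mu>) = 0"
proof -
  have expand: "((\<lambda>F \<mu>. \<Sum>k\<in>S. D k F \<mu>) ^^ j) G = (\<lambda>\<mu>. \<Sum>l | set l \<subseteq> S \<and> length l = j. foldr D l G \<mu>)"
    if "finite S" for S j
  proof (induction j)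
    case 0
    have "{l. set l \<subseteq> S \<and> length l = 0} = {[]}" by auto
    then show ?case by simp
  next
    case (Suc j)
    have "finite {l. set l \<subseteq> S \<and> length l = j}" using that by (rule finite_lists_length_eq)
    then show ?case unfolding sum_lists_Suc[OF that] by (simp add: Suc add)
  qed
  have "(\<Sum>\<sigma> | \<sigma> permutes {..<m}. foldr D (map \<sigma> [0..<m]) G \<mu>) = 0"
  proof (rule polarization_lists)
    fix S assume S: "S \<subseteq> {..<m}"
    then have "finite S" using finite_subset by auto
    show "(\<Sum>l | set l \<subseteq> S \<and> length l = m. foldr D l G \<mu>) = 0"
      using van[OF S] expand[OF \<open>finite S\<close>, of m] by (metis (no_types, lifting))
  qed
  then show ?thesis by (simp add: foldr_map comp_def)
qed

section \<open>A quantum shuffle algebra\<close>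

definition ev :: "real \<Rightarrow> rat poly \<Rightarrow> real" where
  "ev \<eta> p = poly (map_poly of_rat p) \<eta>"

lemma ev_0 [simp]: "ev \<eta> 0 = 0"
  by (simp add: ev_def)

lemma ev_pCons [simp]: "ev \<eta> (pCons a p) = of_rat a + \<eta> * ev \<eta> p"
  by (simp add: ev_def map_poly_pCons)

lemma ev_1 [simp]: "ev \<eta> 1 = 1"
  by (simp add: one_pCons)

lemma ev_hbar [simp]: "ev \<eta> hbar = \<eta>"
  by (simp add: hbar_def)

lemma ev_add: "ev \<eta> (p + q) = ev \<eta> p + ev \<eta> q"
  by (induction p q rule: poly_induct2) (simp_all add: of_rat_add algebra_simps)

lemma ev_smult: "ev \<eta> (Polynomial.smult a p) = of_rat a * ev \<eta> p"
  by (induction p) (simp_all add: of_rat_mult algebra_simps)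

lemma ev_mult: "ev \<eta> (p * q) = ev \<eta> p * ev \<eta> q"
  by (induction p) (simp_all add: ev_add ev_smult algebra_simps)

lemma ev_power: "ev \<eta> (p ^ k) = ev \<eta> p ^ k"
  by (induction k) (simp_all add: ev_mult)

locale shuffle =
  fixes PP :: "'p set" and om :: "'p \<Rightarrow> 'p \<Rightarrow> real"
  assumes fin: "finite PP"
begin

abbreviation Om :: "'p set \<Rightarrow> 'p set \<Rightarrow> real" where
  "Om A B' \<equiv> \<Prod>Q\<in>A. \<Prod>P\<in>B'. om Q P"

text \<open>The shuffle product of symmetric functions, of which only the values on sets of points
  of \<open>PP\<close> are kept: a shuffle becomes a splitting of the set.\<close>

definition conv :: "('p set \<Rightarrow> real) \<Rightarrow> ('p set \<Rightarrow> real) \<Rightarrow> 'p set \<Rightarrow> real" where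
  "conv F G \<mu> = (if \<mu> \<subseteq> PP then \<Sum>A\<in>Pow \<mu>. F A * G (\<mu> - A) * Om A (\<mu> - A) else 0)"

definition one_fn :: "'p set \<Rightarrow> real" where
  "one_fn \<mu> = (if \<mu> = {} then 1 else 0)"

definition sing :: "('p \<Rightarrow> real) \<Rightarrow> 'p set \<Rightarrow> real" where
  "sing \<phi> \<mu> = (if \<mu> \<subseteq> PP \<and> is_singleton \<mu> then \<phi> (the_elem \<mu>) else 0)"

lemma sub_fin: "\<mu> \<subseteq> PP \<Longrightarrow> finite \<mu>"
  using fin finite_subset by blast

lemma Om_Un_left: "finite A \<Longrightarrow> finite A' \<Longrightarrow> A \<inter> A' = {} \<Longrightarrow> Om (A \<union> A') C = Om A C * Om A' C"
  by (rule prod.union_disjoint)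

lemma Om_Un_right: "finite C \<Longrightarrow> finite C' \<Longrightarrow> C \<inter> C' = {} \<Longrightarrow> Om A (C \<union> C') = Om A C * Om A C'"
  by (simp add: prod.union_disjoint prod.distrib)

text \<open>Both sides sum over the ordered partitions of \<mu> into three blocks; the weights agree
  because \<open>Om\<close> is multiplicative in each argument.\<close>

lemma conv_assoc: "conv (conv F G) H = conv F (conv G H)"
proof
  fix \<mu>
  show "conv (conv F G) H \<mu> = conv F (conv G H) \<mu>"
  proof (cases "\<mu> \<subseteq> PP")
    case True
    note f = sub_fin[OF True]
    have "conv (conv F G) H \<mu> = (\<Sum>A\<in>Pow \<mu>. \<Sum>B'\<in>Pow A.
        F B' * G (A - B') * Om B' (A - B') * H (\<mu> - A) * Om A (\<mu> - A))"
      using True by (auto simp: conv_def sum_distrib_right intro!: sum.cong)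
    also have "\<dots> = (\<Sum>(A, B')\<in>Sigma (Pow \<mu>) Pow.
        F B' * G (A - B') * Om B' (A - B') * H (\<mu> - A) * Om A (\<mu> - A))"
      using f by (subst sum.Sigma) (auto intro: finite_subset)
    also have "\<dots> = (\<Sum>(B', C)\<in>Sigma (Pow \<mu>) (\<lambda>B'. Pow (\<mu> - B')).
        F B' * (G C * H (\<mu> - B' - C) * Om C (\<mu> - B' - C)) * Om B' (\<mu> - B'))"
    proof (rule sum.reindex_bij_witness[where i = "\<lambda>(B', C). (B' \<union> C, B')" and j = "\<lambda>(A, B'). (B', A - B')"])
      fix x assume "x \<in> Sigma (Pow \<mu>) Pow"
      then obtain A B' where x: "x = (A, B')" "B' \<subseteq> A" "A \<subseteq> \<mu>" by auto
      have fA: "finite A" "finite B'" "finite (A - B')" "finite (\<mu> - A)"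
        using x f by (auto intro: finite_subset)
      have 1: "\<mu> - B' - (A - B') = \<mu> - A" using x by auto
      have "A = B' \<union> (A - B')" using x by auto
      then have 2: "Om A (\<mu> - A) = Om B' (\<mu> - A) * Om (A - B') (\<mu> - A)"
        using Om_Un_left[of B' "A - B'" "\<mu> - A"] fA by (metis Diff_disjoint)
      have "\<mu> - B' = (A - B') \<union> (\<mu> - A)" "(A - B') \<inter> (\<mu> - A) = {}" using x by auto
      then have 3: "Om B' (\<mu> - B') = Om B' (A - B') * Om B' (\<mu> - A)"
        using Om_Un_right[of "A - B'" "\<mu> - A" B'] fA by metis
      show "(case case x of (A, B') \<Rightarrow> (B', A - B') of (B', C) \<Rightarrow>
          F B' * (G C * H (\<mu> - B' - C) * Om C (\<mu> - B' - C)) * Om B' (\<mu> - B')) =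
        (case x of (A, B') \<Rightarrow> F B' * G (A - B') * Om B' (A - B') * H (\<mu> - A) * Om A (\<mu> - A))"
        unfolding x(1) prod.case 1 2 3 by (simp only: ac_simps)
    qed auto
    also have "\<dots> = (\<Sum>B'\<in>Pow \<mu>. \<Sum>C\<in>Pow (\<mu> - B').
        F B' * (G C * H (\<mu> - B' - C) * Om C (\<mu> - B' - C)) * Om B' (\<mu> - B'))"
      using f by (subst sum.Sigma) (auto intro: finite_subset)
    also have "\<dots> = conv F (conv G H) \<mu>"
      using True by (auto simp: conv_def sum_distrib_left sum_distrib_right intro!: sum.cong)
    finally show ?thesis .
  qed (simp add: conv_def)
qed

lemma conv_add_left: "conv (\<lambda>\<mu>. F \<mu> + F' \<mu>) G = (\<lambda>\<mu>. conv F G \<mu> + conv F' G \<mu>)"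
  by (auto simp: conv_def fun_eq_iff sum.distrib algebra_simps)

lemma conv_add_right: "conv F (\<lambda>\<mu>. G \<mu> + G' \<mu>) = (\<lambda>\<mu>. conv F G \<mu> + conv F G' \<mu>)"
  by (auto simp: conv_def fun_eq_iff sum.distrib algebra_simps)

lemma conv_scale: "conv (\<lambda>\<mu>. a * F \<mu>) G = (\<lambda>\<mu>. a * conv F G \<mu>)"
  "conv F (\<lambda>\<mu>. a * G \<mu>) = (\<lambda>\<mu>. a * conv F G \<mu>)"
  by (auto simp: conv_def fun_eq_iff sum_distrib_left algebra_simps)

lemma conv_0: "conv (\<lambda>_. 0) G = (\<lambda>_. 0)" "conv F (\<lambda>_. 0) = (\<lambda>_. 0)"
  by (auto simp: conv_def fun_eq_iff)

lemma conv_sum: "finite A \<Longrightarrow> conv F (\<lambda>\<mu>. \<Sum>g\<in>A. G g \<mu>) = (\<lambda>\<mu>. \<Sum>g\<in>A. conv F (G g) \<mu>)"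
  "finite A \<Longrightarrow> conv (\<lambda>\<mu>. \<Sum>g\<in>A. G g \<mu>) F = (\<lambda>\<mu>. \<Sum>g\<in>A. conv (G g) F \<mu>)"
  by (induction A rule: finite_induct) (simp_all add: conv_0 conv_add_left conv_add_right)

lemma conv_one: "(\<And>\<mu>. \<not> \<mu> \<subseteq> PP \<Longrightarrow> F \<mu> = 0) \<Longrightarrow> conv one_fn F = F"
proof
  fix \<mu>
  assume out: "\<And>\<mu>. \<not> \<mu> \<subseteq> PP \<Longrightarrow> F \<mu> = 0"
  show "conv one_fn F \<mu> = F \<mu>"
  proof (cases "\<mu> \<subseteq> PP")
    case True
    have "(\<Sum>A\<in>Pow \<mu>. one_fn A * F (\<mu> - A) * Om A (\<mu> - A)) = (\<Sum>A\<in>{{}}. one_fn A * F (\<mu> - A) * Om A (\<mu> - A))"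
      using sub_fin[OF True] by (intro sum.mono_neutral_right) (auto simp: one_fn_def)
    then show ?thesis using True by (simp add: conv_def one_fn_def)
  qed (simp add: conv_def out)
qed

lemma conv_out: "\<not> \<mu> \<subseteq> PP \<Longrightarrow> conv F G \<mu> = 0"
  by (simp add: conv_def)

lemma sing_singleton: "Q \<in> PP \<Longrightarrow> sing \<phi> {Q} = \<phi> Q"
  by (simp add: sing_def)

lemma conv_sing_left:
  assumes "\<mu> \<subseteq> PP"
  shows "conv (sing \<phi>) G \<mu> = (\<Sum>Q\<in>\<mu>. \<phi> Q * G (\<mu> - {Q}) * (\<Prod>P\<in>\<mu> - {Q}. om Q P))"
proof -
  have "conv (sing \<phi>) G \<mu> = (\<Sum>A\<in>(\<lambda>Q. {Q}) ` \<mu>. sing \<phi> A * G (\<mu> - A) * Om A (\<mu> - A))"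
    unfolding conv_def using assms sub_fin[OF assms]
    by (auto intro!: sum.mono_neutral_right simp: sing_def is_singleton_def)
  also have "\<dots> = (\<Sum>Q\<in>\<mu>. \<phi> Q * G (\<mu> - {Q}) * (\<Prod>P\<in>\<mu> - {Q}. om Q P))"
    using assms by (subst sum.reindex) (auto simp: sing_singleton subset_iff intro!: sum.cong)
  finally show ?thesis .
qed

lemma conv_sing_right:
  assumes "\<mu> \<subseteq> PP"
  shows "conv G (sing \<phi>) \<mu> = (\<Sum>Q\<in>\<mu>. \<phi> Q * G (\<mu> - {Q}) * (\<Prod>P\<in>\<mu> - {Q}. om P Q))"
proof -
  have "conv G (sing \<phi>) \<mu> = (\<Sum>A\<in>(\<lambda>Q. \<mu> - {Q}) ` \<mu>. G A * sing \<phi> (\<mu> - A) * Om A (\<mu> - A))"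
    unfolding conv_def if_P[OF assms]
  proof (rule sum.mono_neutral_right)
    show "\<forall>A\<in>Pow \<mu> - (\<lambda>Q. \<mu> - {Q}) ` \<mu>. G A * sing \<phi> (\<mu> - A) * Om A (\<mu> - A) = 0"
    proof
      fix A assume A: "A \<in> Pow \<mu> - (\<lambda>Q. \<mu> - {Q}) ` \<mu>"
      have "\<not> is_singleton (\<mu> - A)"
      proof
        assume "is_singleton (\<mu> - A)"
        then obtain Q where "\<mu> - A = {Q}" by (auto simp: is_singleton_def)
        then have "A = \<mu> - {Q}" "Q \<in> \<mu>" using A by auto
        then show False using A by blast
      qed
      then show "G A * sing \<phi> (\<mu> - A) * Om A (\<mu> - A) = 0" by (simp add: sing_def)
    qed
  qed (use sub_fin[OF assms] in auto)
  also have "\<dots> = (\<Sum>Q\<in>\<mu>. G (\<mu> - {Q}) * sing \<phi> (\<mu> - (\<mu> - {Q})) * Om (\<mu> - {Q}) (\<mu> - (\<mu> - {Q})))"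
    by (subst sum.reindex) (auto simp: inj_on_def)
  also have "\<dots> = (\<Sum>Q\<in>\<mu>. \<phi> Q * G (\<mu> - {Q}) * (\<Prod>P\<in>\<mu> - {Q}. om P Q))"
  proof (rule sum.cong[OF refl])
    fix Q assume "Q \<in> \<mu>"
    then have "\<mu> - (\<mu> - {Q}) = {Q}" "Q \<in> PP" using assms by auto
    then show "G (\<mu> - {Q}) * sing \<phi> (\<mu> - (\<mu> - {Q})) * Om (\<mu> - {Q}) (\<mu> - (\<mu> - {Q})) =
        \<phi> Q * G (\<mu> - {Q}) * (\<Prod>P\<in>\<mu> - {Q}. om P Q)"
      by (simp add: sing_singleton)
  qed
  finally show ?thesis .
qed

definition com :: "('p set \<Rightarrow> real) \<Rightarrow> ('p set \<Rightarrow> real) \<Rightarrow> 'p set \<Rightarrow> real" where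
  "com F G \<mu> = conv F G \<mu> - conv G F \<mu>"

lemma com_sing:
  assumes "\<mu> \<subseteq> PP"
  shows "com (sing \<phi>) G \<mu> =
    (\<Sum>Q\<in>\<mu>. \<phi> Q * G (\<mu> - {Q}) * ((\<Prod>P\<in>\<mu> - {Q}. om Q P) - (\<Prod>P\<in>\<mu> - {Q}. om P Q)))"
  by (simp add: com_def conv_sing_left[OF assms] conv_sing_right[OF assms] sum_subtractf right_diff_distrib)

lemma sing_sum: "sing (\<lambda>Q. \<Sum>k\<in>S. \<phi> k Q) = (\<lambda>\<mu>. \<Sum>k\<in>S. sing (\<phi> k) \<mu>)"
proof
  fix \<mu>
  show "sing (\<lambda>Q. \<Sum>k\<in>S. \<phi> k Q) \<mu> = (\<Sum>k\<in>S. sing (\<phi> k) \<mu>)"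
    unfolding sing_def
    by (cases "\<mu> \<subseteq> PP \<and> is_singleton \<mu>") (simp_all only: if_True if_False simp_thms sum.neutral_const)
qed

section \<open>Evaluation of the free algebra in the shuffle algebra\<close>

primrec weval :: "(nat \<times> nat \<Rightarrow> 'p \<Rightarrow> real) \<Rightarrow> (nat \<times> nat) list \<Rightarrow> 'p set \<Rightarrow> real" where
  "weval ph [] = one_fn"
| "weval ph (q # w) = conv (sing (ph q)) (weval ph w)"

lemma weval_out: "\<not> \<mu> \<subseteq> PP \<Longrightarrow> weval ph w \<mu> = 0"
  by (cases w) (auto simp: one_fn_def conv_out)

lemma weval_append: "weval ph (u @ v) = conv (weval ph u) (weval ph v)"
proof (induction u)
  case Nil
  show ?case using conv_one[of "weval ph v"] weval_out[of _ ph v] by simp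
qed (simp add: conv_assoc)

primrec unW :: "'x word \<Rightarrow> 'x list" where "unW (Word u) = u"

lemma unW_add: "unW (u + v) = unW u @ unW v" by (cases u; cases v) simp

text \<open>An algebra homomorphism: \<open>hbar\<close> goes to \<eta> and the generator
  \<open>q\<close> to the function \<open>ph q\<close> on single points.\<close>

definition Phi :: "(nat \<times> nat \<Rightarrow> 'p \<Rightarrow> real) \<Rightarrow> real \<Rightarrow> free_elem \<Rightarrow> 'p set \<Rightarrow> real" where
  "Phi ph \<eta> f \<mu> = (\<Sum>w\<in>Poly_Mapping.keys f. ev \<eta> (Poly_Mapping.lookup f w) * weval ph (unW w) \<mu>)"

lemma Phi_superset:
  assumes "finite S" "Poly_Mapping.keys f \<subseteq> S"
  shows "Phi ph \<eta> f \<mu> = (\<Sum>w\<in>S. ev \<eta> (Poly_Mapping.lookup f w) * weval ph (unW w) \<mu>)"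
  unfolding Phi_def using assms by (intro sum.mono_neutral_left) (auto simp: in_keys_iff)

lemma Phi_add: "Phi ph \<eta> (f + g) = (\<lambda>\<mu>. Phi ph \<eta> f \<mu> + Phi ph \<eta> g \<mu>)"
proof
  fix \<mu>
  let ?S = "Poly_Mapping.keys f \<union> Poly_Mapping.keys g"
  show "Phi ph \<eta> (f + g) \<mu> = Phi ph \<eta> f \<mu> + Phi ph \<eta> g \<mu>"
    using Phi_superset[of ?S "f + g"] Phi_superset[of ?S f] Phi_superset[of ?S g]
      Poly_Mapping.keys_add[of f g]
    by (simp add: lookup_add ev_add distrib_right sum.distrib)
qed

lemma Phi_single: "Phi ph \<eta> (Poly_Mapping.single w c) = (\<lambda>\<mu>. ev \<eta> c * weval ph (unW w) \<mu>)"
  using Phi_superset[of "{w}" "Poly_Mapping.single w c"] by (auto simp: fun_eq_iff)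

lemma Phi_mult: "Phi ph \<eta> (f * g) = conv (Phi ph \<eta> f) (Phi ph \<eta> g)"
proof (induction f rule: poly_mapping_single_induct)
  case (single k c)
  show ?case
  proof (induction g rule: poly_mapping_single_induct)
    case (single l d)
    then show ?case
      by (simp add: mult_single Phi_single conv_scale unW_add weval_append ev_mult mult.assoc)
  next
    case (add f g)
    then show ?case by (simp add: distrib_left Phi_add conv_add_right)
  qed
next
  case (add f f')
  then show ?case by (simp add: distrib_right Phi_add conv_add_left)
qed

lemma Phi_0: "Phi ph \<eta> 0 = (\<lambda>_. 0)"
  by (simp add: Phi_def fun_eq_iff)

lemma Phi_uminus: "Phi ph \<eta> (- f) = (\<lambda>\<mu>. - Phi ph \<eta> f \<mu>)"
  using Phi_add[of ph \<eta> f "- f"] by (simp add: Phi_0 fun_eq_iff eq_neg_iff_add_eq_0 add.commute)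

lemma Phi_diff: "Phi ph \<eta> (f - g) = (\<lambda>\<mu>. Phi ph \<eta> f \<mu> - Phi ph \<eta> g \<mu>)"
  using Phi_add[of ph \<eta> f "- g"] by (simp add: Phi_uminus)

lemma Phi_sum: "Phi ph \<eta> (sum f S) = (\<lambda>\<mu>. \<Sum>x\<in>S. Phi ph \<eta> (f x) \<mu>)"
  by (induction S rule: infinite_finite_induct) (simp_all add: Phi_0 Phi_add)

lemma Phi_commutator: "Phi ph \<eta> (commutator f g) = com (Phi ph \<eta> f) (Phi ph \<eta> g)"
  by (auto simp: commutator_def com_def Phi_diff Phi_mult fun_eq_iff)

lemma Phi_out: "\<not> \<mu> \<subseteq> PP \<Longrightarrow> Phi ph \<eta> f \<mu> = 0"
  by (simp add: Phi_def weval_out)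

lemma Phi_scal: "Phi ph \<eta> (scal c * f) = (\<lambda>\<mu>. ev \<eta> c * Phi ph \<eta> f \<mu>)"
proof (induction f rule: poly_mapping_single_induct)
  case (single k d)
  then show ?case by (simp add: scal_def mult_single Phi_single ev_mult mult.assoc)
next
  case (add f g)
  then show ?case by (simp add: distrib_left Phi_add)
qed

lemma Phi_1: "Phi ph \<eta> 1 = one_fn"
proof -
  have "unW (0 :: (nat \<times> nat) word) = []" by (simp add: zero_word_def)
  then show ?thesis using Phi_single[of ph \<eta> 0 1] by simp
qed

lemma Phi_gen: "Phi ph \<eta> (gen i r) = sing (ph (i, r))"
proof -
  have "conv (sing (ph (i, r))) one_fn \<mu> = sing (ph (i, r)) \<mu>" for \<mu>
  proof (cases "\<mu> \<subseteq> PP")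
    case True
    have "conv (sing (ph (i, r))) one_fn \<mu> = (\<Sum>A\<in>{\<mu>}. sing (ph (i, r)) A * one_fn (\<mu> - A) * Om A (\<mu> - A))"
      unfolding conv_def if_P[OF True] using sub_fin[OF True]
      by (intro sum.mono_neutral_right) (auto simp: one_fn_def)
    then show ?thesis by (simp add: one_fn_def)
  qed (simp add: conv_def sing_def)
  then show ?thesis by (simp add: gen_def Phi_single fun_eq_iff)
qed

end

text \<open>The exchange relation below makes the functions on singletons satisfy the quadratic relations;
  \<open>cc\<close> stands for \<open>\<hbar>(\<alpha>\<^sub>i, \<alpha>\<^sub>j)/2\<close>.\<close>

locale shuffle_rel = shuffle PP om for PP :: "'p set" and om +
  fixes col :: "'p \<Rightarrow> nat" and pos :: "'p \<Rightarrow> real" and cc :: "nat \<Rightarrow> nat \<Rightarrow> real"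
  assumes same: "P \<in> PP \<Longrightarrow> Q \<in> PP \<Longrightarrow> P \<noteq> Q \<Longrightarrow> col P = col Q \<Longrightarrow>
      pos P \<noteq> pos Q \<and> om Q P = 1 + cc (col P) (col P) / (pos Q - pos P)"
    and diff: "P \<in> PP \<Longrightarrow> Q \<in> PP \<Longrightarrow> col P \<noteq> col Q \<Longrightarrow>
      om Q P * (pos Q - pos P - cc (col Q) (col P)) = om P Q * (pos Q - pos P + cc (col Q) (col P))"
    and cc_sym: "cc i j = cc j i"
begin

lemma exchange:
  assumes "P \<in> PP" "Q \<in> PP" "P \<noteq> Q"
  shows "om Q P * (pos Q - pos P - cc (col Q) (col P)) = om P Q * (pos Q - pos P + cc (col Q) (col P))"
proof (cases "col P = col Q")
  case True
  have "1 + c / (y - x) = (y - x + c) / (y - x)" "1 + c / (x - y) = (y - x - c) / (y - x)"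
    if "x \<noteq> y" for c x y :: real
    using that by (simp_all add: divide_simps) (simp_all add: algebra_simps)
  from this[of "pos P" "pos Q" "cc (col P) (col P)"]
  show ?thesis using same[OF assms(1,2,3) True] same[OF assms(2,1) assms(3)[symmetric] True[symmetric]] True
    by simp
qed (rule diff[OF assms(1,2)])

definition gph :: "nat \<times> nat \<Rightarrow> 'p \<Rightarrow> real" where
  "gph = (\<lambda>(i, r) Q. if col Q = i then pos Q ^ r else 0)"

lemma conv_sing_sing:
  assumes "\<mu> \<subseteq> PP" "card \<mu> = 2"
  obtains P Q where "P \<noteq> Q" "\<mu> = {P, Q}"
    "\<And>\<phi> \<psi>. conv (sing \<phi>) (sing \<psi>) \<mu> = \<phi> P * \<psi> Q * om P Q + \<phi> Q * \<psi> P * om Q P"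
proof -
  obtain P Q where PQ: "\<mu> = {P, Q}" "P \<noteq> Q" using assms(2) by (meson card_2_iff)
  have "conv (sing \<phi>) (sing \<psi>) \<mu> = \<phi> P * \<psi> Q * om P Q + \<phi> Q * \<psi> P * om Q P" for \<phi> \<psi>
  proof -
    have "{P, Q} - {P} = {Q}" "{P, Q} - {Q} = {P}" using PQ by auto
    then show ?thesis using PQ assms(1) by (simp add: conv_sing_left sing_singleton)
  qed
  then show thesis using that PQ by blast
qed

lemma conv_sing_sing_0:
  assumes "\<mu> \<subseteq> PP" "card \<mu> \<noteq> 2"
  shows "conv (sing \<phi>) (sing \<psi>) \<mu> = 0"
proof -
  have "sing \<psi> (\<mu> - {Q}) = 0" if "Q \<in> \<mu>" for Q
  proof -
    have "card (\<mu> - {Q}) \<noteq> 1" using assms that sub_fin[OF assms(1)] by (simp add: card_Diff_singleton)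
    then show ?thesis by (auto simp: sing_def is_singleton_altdef)
  qed
  then show ?thesis using assms by (simp add: conv_sing_left)
qed

text \<open>Everything lives on two-point sets. There each way to assign the two generators to the
  two points contributes the exchange relation times a monomial in the positions.\<close>

lemma quadratic_shuffle:
  assumes "\<mu> \<subseteq> PP"
  shows "conv (sing (gph (i, Suc r))) (sing (gph (j, s))) \<mu> - conv (sing (gph (j, s))) (sing (gph (i, Suc r))) \<mu>
    - (conv (sing (gph (i, r))) (sing (gph (j, Suc s))) \<mu> - conv (sing (gph (j, Suc s))) (sing (gph (i, r))) \<mu>)
    - cc i j * (conv (sing (gph (i, r))) (sing (gph (j, s))) \<mu> + conv (sing (gph (j, s))) (sing (gph (i, r))) \<mu>) = 0"
proof (cases "card \<mu> = 2")
  case True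
  then obtain P Q where PQ: "P \<noteq> Q" "\<mu> = {P, Q}"
    "\<And>\<phi> \<psi>. conv (sing \<phi>) (sing \<psi>) \<mu> = \<phi> P * \<psi> Q * om P Q + \<phi> Q * \<psi> P * om Q P"
    using conv_sing_sing[OF assms] by metis
  have key: "gph (i, Suc r) P * gph (j, s) Q * (om P Q - om Q P) - gph (i, r) P * gph (j, Suc s) Q * (om P Q - om Q P)
      - cc i j * (gph (i, r) P * gph (j, s) Q * (om P Q + om Q P)) = 0"
    if "P \<in> PP" "Q \<in> PP" "P \<noteq> Q" for P Q
  proof (cases "col P = i \<and> col Q = j")
    case True
    have "om P Q * (pos P - pos Q - cc i j) = om Q P * (pos P - pos Q + cc i j)"
      using exchange[OF that(2,1) that(3)[symmetric]] True by simp
    then have "pos P ^ r * pos Q ^ s * (om P Q * (pos P - pos Q - cc i j)) =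
        pos P ^ r * pos Q ^ s * (om Q P * (pos P - pos Q + cc i j))" by simp
    then show ?thesis using True by (simp add: gph_def algebra_simps)
  qed (auto simp: gph_def)
  have "P \<in> PP" "Q \<in> PP" using assms PQ(2) by auto
  then show ?thesis
    unfolding PQ(3) using key[of P Q] key[of Q P] PQ(1) by (simp add: algebra_simps)
qed (simp add: conv_sing_sing_0[OF assms])

text \<open>Summing over the last particle that is bracketed in, the contribution of each set of \<open>k\<close> particles of
  colour \<open>i\<close> is a constant; the constant vanishes for \<open>k = 1 - a\<^sub>i\<^sub>j\<close>.\<close>

definition kap :: "nat \<Rightarrow> nat \<Rightarrow> 'p \<Rightarrow> 'p \<Rightarrow> real" where
  "kap i j z y = (om z y - om y z) / (2 * cc i j)"

text \<open>By the exchange relation the two twists are proportional to two linear factors;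
  \<open>kap\<close> is the common ratio.\<close>

lemma kap:
  assumes "z \<in> PP" "y \<in> PP" "col z = i" "col y = j" "i \<noteq> j" "cc i j \<noteq> 0"
  shows "om z y = kap i j z y * (pos z - pos y + cc i j)" "om y z = kap i j z y * (pos z - pos y - cc i j)"
proof -
  have ex: "om z y * (pos z - pos y - cc i j) = om y z * (pos z - pos y + cc i j)"
    using diff[of y z] assms by simp
  have "om z y * (2 * cc i j) = (om z y - om y z) * (pos z - pos y + cc i j)"
    "om y z * (2 * cc i j) = (om z y - om y z) * (pos z - pos y - cc i j)"
    using ex by (simp_all add: algebra_simps)
  then show "om z y = kap i j z y * (pos z - pos y + cc i j)" "om y z = kap i j z y * (pos z - pos y - cc i j)"
    using assms(6) by (simp_all add: kap_def field_simps)
qed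

text \<open>\<open>sum_prod_shift\<close> is applied with the shifts \<open>cc i i\<close> and
  \<open>- cc i i\<close>. In the difference the sums of positions and the terms with
  \<open>pos y\<close> cancel, which leaves a constant in the number of points.\<close>

lemma bracket_sum:
  assumes "finite Z" "Z \<subseteq> PP" "\<And>z. z \<in> Z \<Longrightarrow> col z = i" "y \<in> PP" "col y = j" "i \<noteq> j" "cc i j \<noteq> 0"
  shows "(\<Sum>u\<in>Z. (\<Prod>z\<in>Z - {u}. kap i j z y) *
      (om u y * (\<Prod>z\<in>Z - {u}. om u z) - om y u * (\<Prod>z\<in>Z - {u}. om z u))) =
    (\<Prod>z\<in>Z. kap i j z y) * (real (card Z) * (2 * cc i j + (real (card Z) - 1) * cc i i))"
proof -
  let ?c = "cc i i" and ?e = "cc i j" and ?N = "real (card Z)"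
  have factor: "R * (k * X * A - k * Y * D) = (k * R) * (X * A - Y * D)" for R k X Y A D :: real
    by (simp add: algebra_simps)
  have inj: "inj_on pos Z"
    using same assms(2,3) by (intro inj_onI) (metis subsetD)
  have 1: "om u z = 1 + ?c / (pos u - pos z)" "om z u = 1 + (- ?c) / (pos u - pos z)"
    if "u \<in> Z" "z \<in> Z - {u}" for u z
  proof -
    have uz: "u \<in> PP" "z \<in> PP" "u \<noteq> z" "col u = i" "col z = i" using that assms by auto
    show "om u z = 1 + ?c / (pos u - pos z)" using same[of z u] uz by simp
    have "om z u = 1 + ?c / (pos z - pos u)" using same[of u z] uz by simp
    then show "om z u = 1 + (- ?c) / (pos u - pos z)" by (metis minus_diff_eq minus_divide_right minus_divide_left)
  qed
  let ?p = "\<lambda>c u. \<Prod>z\<in>Z - {u}. 1 + c / (pos u - pos z)"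
  have "(\<Sum>u\<in>Z. (\<Prod>z\<in>Z - {u}. kap i j z y) *
      (om u y * (\<Prod>z\<in>Z - {u}. om u z) - om y u * (\<Prod>z\<in>Z - {u}. om z u))) =
    (\<Sum>u\<in>Z. (\<Prod>z\<in>Z. kap i j z y) * ((pos u - pos y + ?e) * ?p ?c u - (pos u - pos y - ?e) * ?p (- ?c) u))"
  proof (rule sum.cong[OF refl])
    fix u assume u: "u \<in> Z"
    have e: "om u y = kap i j u y * (pos u - pos y + ?e)" "om y u = kap i j u y * (pos u - pos y - ?e)"
      using kap[of u y i j] u assms by auto
    have rem: "(\<Prod>z\<in>Z. kap i j z y) = kap i j u y * (\<Prod>z\<in>Z - {u}. kap i j z y)"
      using assms(1) u by (rule prod.remove)
    have pr: "(\<Prod>z\<in>Z - {u}. om u z) = ?p ?c u" "(\<Prod>z\<in>Z - {u}. om z u) = ?p (- ?c) u"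
      using 1[OF u] by (auto intro: prod.cong)
    show "(\<Prod>z\<in>Z - {u}. kap i j z y) *
        (om u y * (\<Prod>z\<in>Z - {u}. om u z) - om y u * (\<Prod>z\<in>Z - {u}. om z u)) =
      (\<Prod>z\<in>Z. kap i j z y) * ((pos u - pos y + ?e) * ?p ?c u - (pos u - pos y - ?e) * ?p (- ?c) u)"
      unfolding pr unfolding e rem by (rule factor)
  qed
  also have "\<dots> = (\<Prod>z\<in>Z. kap i j z y) *
      (((\<Sum>u\<in>Z. pos u * ?p ?c u) + (?e - pos y) * (\<Sum>u\<in>Z. ?p ?c u))
      - ((\<Sum>u\<in>Z. pos u * ?p (- ?c) u) - (?e + pos y) * (\<Sum>u\<in>Z. ?p (- ?c) u)))"
  proof -
    have "(\<Sum>u\<in>Z. C * ((pos u - pos y + ?e) * P u - (pos u - pos y - ?e) * R u)) =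
      C * (((\<Sum>u\<in>Z. pos u * P u) + (?e - pos y) * (\<Sum>u\<in>Z. P u))
      - ((\<Sum>u\<in>Z. pos u * R u) - (?e + pos y) * (\<Sum>u\<in>Z. R u)))" for C P R
    proof -
      have "(\<Sum>u\<in>Z. C * ((pos u - pos y + ?e) * P u - (pos u - pos y - ?e) * R u)) =
        (\<Sum>u\<in>Z. C * (pos u * P u) + C * ((?e - pos y) * P u) - (C * (pos u * R u) - C * ((?e + pos y) * R u)))"
        by (intro sum.cong refl) (simp add: algebra_simps)
      then show ?thesis
        by (simp only: sum.distrib sum_subtractf sum_distrib_left[symmetric] distrib_left right_diff_distrib)
    qed
    then show ?thesis .
  qed
  also have "\<dots> = (\<Prod>z\<in>Z. kap i j z y) * (?N * (2 * ?e + (?N - 1) * ?c))"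
  proof -
    have "C * ((S + c * N * (N - 1) / 2 + (e - q) * N) - (S + - c * N * (N - 1) / 2 - (e + q) * N)) =
        C * (N * (2 * e + (N - 1) * c))" for C S c e q N :: real
      by (simp add: field_simps)
    then show ?thesis unfolding sum_prod_shift[OF assms(1) inj] .
  qed
  finally show ?thesis .
qed

text \<open>One more bracket sums over the newly added particle \<open>u\<close>. After exchanging
  this sum with the one over \<open>y\<close>, what remains for fixed \<open>y\<close> is the sum
  evaluated by \<open>bracket_sum\<close>, and it supplies the next factor of the product.\<close>

lemma com_power:
  assumes ij: "i \<noteq> j" "cc i j \<noteq> 0"
    and \<phi>: "\<And>Q. col Q \<noteq> i \<Longrightarrow> \<phi> Q = 0" and \<psi>: "\<And>Q. col Q \<noteq> j \<Longrightarrow> \<psi> Q = 0" and \<mu>: "\<mu> \<subseteq> PP"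
  shows "((com (sing \<phi>)) ^^ k) (sing \<psi>) \<mu> =
    (\<Prod>l<k. real (Suc l) * (2 * cc i j + real l * cc i i)) *
    (if card \<mu> = Suc k then \<Sum>y\<in>\<mu>. \<psi> y * (\<Prod>z\<in>\<mu> - {y}. \<phi> z * kap i j z y) else 0)"
  using \<mu>
proof (induction k arbitrary: \<mu>)
  case 0
  then show ?case
    by (cases "is_singleton \<mu>") (auto simp: sing_def is_singleton_altdef card_1_singleton_iff)
next
  case (Suc k)
  note fm = sub_fin[OF Suc.prems]
  let ?K = "\<Prod>l<k. real (Suc l) * (2 * cc i j + real l * cc i i)"
  let ?w = "\<lambda>u. (\<Prod>P\<in>\<mu> - {u}. om u P) - (\<Prod>P\<in>\<mu> - {u}. om P u)"
  have "((com (sing \<phi>)) ^^ Suc k) (sing \<psi>) \<mu> = com (sing \<phi>) (((com (sing \<phi>)) ^^ k) (sing \<psi>)) \<mu>" by simp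
  also have "\<dots> = (\<Sum>u\<in>\<mu>. \<phi> u * (((com (sing \<phi>)) ^^ k) (sing \<psi>)) (\<mu> - {u}) * ?w u)"
    by (rule com_sing[OF Suc.prems])
  also have "\<dots> = (\<Sum>u\<in>\<mu>. \<phi> u * (?K * (if card \<mu> = Suc (Suc k)
      then \<Sum>y\<in>\<mu> - {u}. \<psi> y * (\<Prod>z\<in>\<mu> - {u} - {y}. \<phi> z * kap i j z y) else 0)) * ?w u)"
  proof (rule sum.cong[OF refl])
    fix u assume u: "u \<in> \<mu>"
    have "card \<mu> = Suc (card (\<mu> - {u}))" using fm u by (metis card.remove)
    moreover have "\<mu> - {u} \<subseteq> PP" using Suc.prems by auto
    ultimately show "\<phi> u * (((com (sing \<phi>)) ^^ k) (sing \<psi>)) (\<mu> - {u}) * ?w u =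
      \<phi> u * (?K * (if card \<mu> = Suc (Suc k)
      then \<Sum>y\<in>\<mu> - {u}. \<psi> y * (\<Prod>z\<in>\<mu> - {u} - {y}. \<phi> z * kap i j z y) else 0)) * ?w u"
      using Suc.IH[of "\<mu> - {u}"] by simp
  qed
  also have "\<dots> = (\<Prod>l<Suc k. real (Suc l) * (2 * cc i j + real l * cc i i)) *
    (if card \<mu> = Suc (Suc k) then \<Sum>y\<in>\<mu>. \<psi> y * (\<Prod>z\<in>\<mu> - {y}. \<phi> z * kap i j z y) else 0)"
  proof (cases "card \<mu> = Suc (Suc k)")
    case True
    have "(\<Sum>u\<in>\<mu>. \<phi> u * (?K * (\<Sum>y\<in>\<mu> - {u}. \<psi> y * (\<Prod>z\<in>\<mu> - {u} - {y}. \<phi> z * kap i j z y))) * ?w u) =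
        (\<Sum>u\<in>\<mu>. \<Sum>y\<in>\<mu> - {u}. ?K * \<psi> y * (\<phi> u * (\<Prod>z\<in>\<mu> - {u} - {y}. \<phi> z * kap i j z y) * ?w u))"
      by (simp add: sum_distrib_left sum_distrib_right ac_simps)
    also have "\<dots> = (\<Sum>y\<in>\<mu>. \<Sum>u\<in>\<mu> - {y}. ?K * \<psi> y * (\<phi> u * (\<Prod>z\<in>\<mu> - {u} - {y}. \<phi> z * kap i j z y) * ?w u))"
    proof -
      have "(\<Sum>u\<in>\<mu>. \<Sum>y\<in>\<mu> - {u}. f u y) = (\<Sum>y\<in>\<mu>. \<Sum>u\<in>\<mu> - {y}. f u y)" for f :: "'p \<Rightarrow> 'p \<Rightarrow> real"
      proof -
        have "(\<Sum>u\<in>\<mu>. \<Sum>y\<in>\<mu> - {u}. f u y) = (\<Sum>u\<in>\<mu>. \<Sum>y\<in>{y \<in> \<mu>. y \<noteq> u}. f u y)"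
          by (intro sum.cong) auto
        also have "\<dots> = (\<Sum>y\<in>\<mu>. \<Sum>u\<in>{u \<in> \<mu>. y \<noteq> u}. f u y)" by (rule sum.swap_restrict[OF fm fm])
        also have "\<dots> = (\<Sum>y\<in>\<mu>. \<Sum>u\<in>\<mu> - {y}. f u y)" by (intro sum.cong) auto
        finally show ?thesis .
      qed
      then show ?thesis .
    qed
    also have "\<dots> = (\<Sum>y\<in>\<mu>. ?K * \<psi> y * ((\<Prod>z\<in>\<mu> - {y}. \<phi> z * kap i j z y) *
        (real (Suc k) * (2 * cc i j + real k * cc i i))))"
    proof (rule sum.cong[OF refl])
      fix y assume y: "y \<in> \<mu>"
      let ?Z = "\<mu> - {y}"
      have cZ: "card ?Z = Suc k" using True y fm by (simp add: card_Diff_singleton)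
      show "(\<Sum>u\<in>?Z. ?K * \<psi> y * (\<phi> u * (\<Prod>z\<in>\<mu> - {u} - {y}. \<phi> z * kap i j z y) * ?w u)) =
          ?K * \<psi> y * ((\<Prod>z\<in>?Z. \<phi> z * kap i j z y) * (real (Suc k) * (2 * cc i j + real k * cc i i)))"
      proof (cases "col y = j \<and> (\<forall>z\<in>?Z. col z = i)")
        case True
        have "(\<Sum>u\<in>?Z. \<phi> u * (\<Prod>z\<in>\<mu> - {u} - {y}. \<phi> z * kap i j z y) * ?w u) =
            (\<Sum>u\<in>?Z. (\<Prod>z\<in>?Z. \<phi> z) * ((\<Prod>z\<in>?Z - {u}. kap i j z y) *
              (om u y * (\<Prod>z\<in>?Z - {u}. om u z) - om y u * (\<Prod>z\<in>?Z - {u}. om z u))))"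
        proof (rule sum.cong[OF refl])
          fix u assume u: "u \<in> ?Z"
          have d: "\<mu> - {u} - {y} = ?Z - {u}" by auto
          have "\<mu> - {u} = insert y (?Z - {u})" "y \<notin> ?Z - {u}" "finite (?Z - {u})" using u y fm by auto
          then have "(\<Prod>P\<in>\<mu> - {u}. om u P) = om u y * (\<Prod>z\<in>?Z - {u}. om u z)"
            "(\<Prod>P\<in>\<mu> - {u}. om P u) = om y u * (\<Prod>z\<in>?Z - {u}. om z u)" by simp_all
          moreover have "(\<Prod>z\<in>?Z. \<phi> z) = \<phi> u * (\<Prod>z\<in>?Z - {u}. \<phi> z)"
            using fm u by (intro prod.remove) auto
          ultimately show "\<phi> u * (\<Prod>z\<in>\<mu> - {u} - {y}. \<phi> z * kap i j z y) * ?w u =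
              (\<Prod>z\<in>?Z. \<phi> z) * ((\<Prod>z\<in>?Z - {u}. kap i j z y) *
              (om u y * (\<Prod>z\<in>?Z - {u}. om u z) - om y u * (\<Prod>z\<in>?Z - {u}. om z u)))"
            unfolding d prod.distrib by (simp only: ac_simps)
        qed
        also have "\<dots> = (\<Prod>z\<in>?Z. \<phi> z) * ((\<Prod>z\<in>?Z. kap i j z y) *
            (real (card ?Z) * (2 * cc i j + (real (card ?Z) - 1) * cc i i)))"
          unfolding sum_distrib_left[symmetric]
          by (subst bracket_sum) (use True y Suc.prems fm ij in auto)
        finally show ?thesis
          unfolding sum_distrib_left[symmetric] cZ prod.distrib by (simp add: ac_simps)
      next
        case False
        show ?thesis
        proof (cases "col y = j")
          case True
          then obtain z0 where z0: "z0 \<in> ?Z" "col z0 \<noteq> i" using False by auto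
          \<comment> \<open>A particle of the wrong colour is either \<open>u\<close> itself or
            still present in the product.\<close>
          have zz: "\<phi> u * (\<Prod>z\<in>\<mu> - {u} - {y}. \<phi> z * kap i j z y) = 0" if "u \<in> ?Z" for u
          proof (cases "u = z0")
            case False
            then have "z0 \<in> \<mu> - {u} - {y}" "finite (\<mu> - {u} - {y})" using z0 fm by auto
            then have "(\<Prod>z\<in>\<mu> - {u} - {y}. \<phi> z * kap i j z y) = 0" using \<phi>[OF z0(2)] by (auto intro!: prod_zero)
            then show ?thesis by simp
          qed (simp add: \<phi> z0)
          have "(\<Sum>u\<in>?Z. ?K * \<psi> y * (\<phi> u * (\<Prod>z\<in>\<mu> - {u} - {y}. \<phi> z * kap i j z y) * ?w u)) = 0"
            by (intro sum.neutral ballI) (simp only: zz mult_zero_left mult_zero_right)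
          moreover have "(\<Prod>z\<in>?Z. \<phi> z * kap i j z y) = 0"
            using z0 fm \<phi>[OF z0(2)] by (intro prod_zero) auto
          ultimately show ?thesis by (simp only: mult_zero_left mult_zero_right)
        qed (simp add: \<psi>)
      qed
    qed
    also have "\<dots> = (\<Prod>l<Suc k. real (Suc l) * (2 * cc i j + real l * cc i i)) *
        (\<Sum>y\<in>\<mu>. \<psi> y * (\<Prod>z\<in>\<mu> - {y}. \<phi> z * kap i j z y))"
      unfolding prod.lessThan_Suc sum_distrib_left by (rule sum.cong[OF refl]) (simp only: ac_simps)
    finally show ?thesis using True by simp
  qed simp
  finally show ?case .
qed

lemma com_sum: "finite A \<Longrightarrow> com F (\<lambda>\<mu>. \<Sum>g\<in>A. G g \<mu>) = (\<lambda>\<mu>. \<Sum>g\<in>A. com F (G g) \<mu>)"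
  "finite A \<Longrightarrow> com (\<lambda>\<mu>. \<Sum>g\<in>A. G g \<mu>) F = (\<lambda>\<mu>. \<Sum>g\<in>A. com (G g) F \<mu>)"
  by (simp_all add: com_def fun_eq_iff conv_sum sum_subtractf)

lemma com_out: "\<not> \<mu> \<subseteq> PP \<Longrightarrow> com F G \<mu> = 0"
  by (simp add: com_def conv_out)

lemma com_sing_sing_0:
  assumes "i \<noteq> j" "cc i j = 0" "\<And>Q. col Q \<noteq> i \<Longrightarrow> \<phi> Q = 0" "\<And>Q. col Q \<noteq> j \<Longrightarrow> \<psi> Q = 0"
    and comm: "\<And>P Q. P \<in> PP \<Longrightarrow> Q \<in> PP \<Longrightarrow> col P = i \<Longrightarrow> col Q = j \<Longrightarrow> om P Q = om Q P"
  shows "com (sing \<phi>) (sing \<psi>) \<mu> = 0"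
proof (cases "\<mu> \<subseteq> PP \<and> card \<mu> = 2")
  case True
  then obtain P Q where PQ: "P \<noteq> Q" "\<mu> = {P, Q}"
    "\<And>\<phi> \<psi>. conv (sing \<phi>) (sing \<psi>) \<mu> = \<phi> P * \<psi> Q * om P Q + \<phi> Q * \<psi> P * om Q P"
    using conv_sing_sing[of \<mu>] by metis
  have "P \<in> PP" "Q \<in> PP" using True PQ(2) by auto
  then have "\<phi> A * \<psi> C * om A C = \<phi> A * \<psi> C * om C A" if "{A, C} = {P, Q}" for A C
  proof -
    have "A \<in> PP" "C \<in> PP" using that \<open>P \<in> PP\<close> \<open>Q \<in> PP\<close> by auto
    then show ?thesis
      using comm[of A C] assms(3)[of A] assms(4)[of C] by (cases "col A = i"; cases "col C = j") auto
  qed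
  from this[of P Q] this[of Q P]
  have "\<phi> P * \<psi> Q * om P Q = \<phi> P * \<psi> Q * om Q P" "\<phi> Q * \<psi> P * om Q P = \<phi> Q * \<psi> P * om P Q"
    by auto
  then show ?thesis
    unfolding com_def PQ(3) mult.commute[of "\<psi> P" "\<phi> Q"] mult.commute[of "\<psi> Q" "\<phi> P"] by linarith
next
  case False
  then have "conv (sing \<phi>') (sing \<psi>') \<mu> = 0" for \<phi>' \<psi>'
    by (cases "\<mu> \<subseteq> PP") (simp_all add: conv_out conv_sing_sing_0)
  then show ?thesis by (simp add: com_def)
qed

text \<open>Polarization leaves a single function of colour \<open>i\<close>, bracketed
  \<open>m\<close> times. The factor \<open>l = m - 1\<close> in \<open>com_power\<close> is then 0
  by the choice of \<open>m\<close>. Orthogonal colours are treated apart because \<open>kap\<close>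
  divides by \<open>cc i j\<close>.\<close>

lemma serre_shuffle:
  assumes "i \<noteq> j" and m: "m \<ge> 1" "2 * cc i j = - (real m - 1) * cc i i"
    and comm: "\<And>P Q. cc i j = 0 \<Longrightarrow> P \<in> PP \<Longrightarrow> Q \<in> PP \<Longrightarrow> col P = i \<Longrightarrow> col Q = j \<Longrightarrow> om P Q = om Q P"
  shows "(\<Sum>\<sigma> | \<sigma> permutes {..<m}.
    foldr (\<lambda>k. com (sing (gph (i, s (\<sigma> k))))) [0..<m] (sing (gph (j, r))) \<mu>) = 0"
proof (rule polarization)
  show "com (sing (gph (i, s k))) (\<lambda>\<mu>. \<Sum>g\<in>A. F g \<mu>) = (\<lambda>\<mu>. \<Sum>g\<in>A. com (sing (gph (i, s k))) (F g) \<mu>)"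
    if "finite A" for k F and A :: "nat list set"
    by (rule com_sum[OF that])
  fix S assume S: "S \<subseteq> {..<m}"
  then have fS: "finite S" using finite_subset by auto
  let ?\<phi> = "\<lambda>Q. \<Sum>k\<in>S. gph (i, s k) Q"
  have eq: "(\<lambda>F \<mu>. \<Sum>k\<in>S. com (sing (gph (i, s k))) F \<mu>) = com (sing ?\<phi>)"
    unfolding sing_sum using com_sum(2)[OF fS] by (simp add: fun_eq_iff)
  have \<phi>: "\<And>Q. col Q \<noteq> i \<Longrightarrow> ?\<phi> Q = 0" and \<psi>: "\<And>Q. col Q \<noteq> j \<Longrightarrow> gph (j, r) Q = 0"
    by (simp_all add: gph_def)
  have "((com (sing ?\<phi>)) ^^ m) (sing (gph (j, r))) \<mu> = 0" for \<mu>
  proof (cases "\<mu> \<subseteq> PP")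
    case True
    show ?thesis
    proof (cases "cc i j = 0")
      case False
      have "(\<Prod>l<m. real (Suc l) * (2 * cc i j + real l * cc i i)) = 0"
      proof (rule prod_zero)
        have z: "2 * cc i j + real (m - 1) * cc i i = 0" using m by (simp add: of_nat_diff algebra_simps)
        have "real (Suc (m - 1)) * (2 * cc i j + real (m - 1) * cc i i) = 0" unfolding z by simp
        then show "\<exists>l\<in>{..<m}. real (Suc l) * (2 * cc i j + real l * cc i i) = 0"
          by (rule bexI[of _ "m - 1"]) (use m(1) in simp)
      qed simp
      then show ?thesis using com_power[OF assms(1) False \<phi> \<psi> True, where k = m] by simp
    next
      case True
      obtain m' where m': "m = Suc m'" using m(1) by (cases m) auto
      have "com (sing ?\<phi>) (sing (gph (j, r))) = (\<lambda>_. 0)"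
        by (rule ext) (rule com_sing_sing_0[OF assms(1) True \<phi> \<psi> comm[OF True]])
      moreover have c0: "com F (\<lambda>_. 0) = (\<lambda>_. 0)" for F by (simp add: com_def conv_0 fun_eq_iff)
      have "((com F) ^^ k) (\<lambda>_. 0) = (\<lambda>_. 0)" for k F by (induction k) (simp_all add: c0)
      ultimately show ?thesis unfolding m' funpow_Suc_right comp_def by (simp only:)
    qed
  next
    case False
    obtain m' where m': "m = Suc m'" using m(1) by (cases m) auto
    show ?thesis unfolding m' funpow.simps comp_def using False by (rule com_out)
  qed
  then show "((\<lambda>F \<mu>. \<Sum>k\<in>S. com (sing (gph (i, s k))) F \<mu>) ^^ m) (sing (gph (j, r))) = (\<lambda>_. 0)"
    unfolding eq by (simp add: fun_eq_iff)
qed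

end

section \<open>Chains of particles\<close>

definition pc :: "cartan_type \<Rightarrow> nat \<Rightarrow> nat \<Rightarrow> real" where
  "pc T i j = real_of_int (root_pairing T i j) / 2"

lemma pc_sym: "pc T i j = pc T j i"
  by (cases T) (auto simp: pc_def)

text \<open>Each step is the shift at which the twist of a point against its successor vanishes
  (\<open>omw_succ\<close>).\<close>

definition tpos :: "cartan_type \<Rightarrow> nat list \<Rightarrow> nat \<Rightarrow> real" where
  "tpos T w k = (\<Sum>l<k. pc T (w ! l) (w ! Suc l))"

text \<open>Chosen so that no denominator of \<open>omw\<close> below vanishes, \<open>omw\<close> of a later against an earlier point is
  nonzero, and \<open>omw\<close> of a point against its successor is zero.\<close>

definition good_word :: "cartan_type \<Rightarrow> nat list \<Rightarrow> bool" where
  "good_word T w \<longleftrightarrow> (\<forall>l<length w. \<forall>k<l.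
    (w ! k = w ! l \<longrightarrow> tpos T w k \<noteq> tpos T w l) \<and>
    (pc T (w ! k) (w ! l) \<noteq> 0 \<longrightarrow> tpos T w l - tpos T w k + pc T (w ! k) (w ! l) \<noteq> 0) \<and>
    (l = Suc k \<longrightarrow> pc T (w ! k) (w ! l) \<noteq> 0))"

text \<open>A solution of the exchange relation at the positions \<open>\<eta> * tpos\<close>, from
  which \<eta> cancels. For two different colours only the quotient of the two twists is prescribed;
  it is normalised by the value 1 for a later against an earlier point.\<close>

definition omw :: "cartan_type \<Rightarrow> nat list \<Rightarrow> nat \<Rightarrow> nat \<Rightarrow> real" where
  "omw T w q p = (let c = pc T (w ! q) (w ! p) in
    if w ! q = w ! p then 1 + c / (tpos T w q - tpos T w p)
    else if p < q \<or> c = 0 then 1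
    else (tpos T w p - tpos T w q - c) / (tpos T w p - tpos T w q + c))"

lemma pc_self: "pc T i i \<noteq> 0"
  by (cases T) (auto simp: pc_def)

lemma omw_later:
  assumes "good_word T w" "p < q" "q < length w"
  shows "omw T w q p \<noteq> 0"
proof (cases "w ! q = w ! p")
  case True
  have "tpos T w p \<noteq> tpos T w q" "tpos T w q - tpos T w p + pc T (w ! p) (w ! q) \<noteq> 0"
    using assms True pc_self[of T "w ! p"] unfolding good_word_def by metis+
  then show ?thesis using True unfolding omw_def Let_def by (simp add: add_divide_eq_if_simps)
qed (use assms in \<open>simp add: omw_def\<close>)

lemma omw_succ:
  assumes "good_word T w" "Suc k < length w"
  shows "omw T w k (Suc k) = 0"
proof -
  have c: "pc T (w ! k) (w ! Suc k) \<noteq> 0" using assms unfolding good_word_def by (metis lessI)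
  have t: "tpos T w (Suc k) - tpos T w k = pc T (w ! k) (w ! Suc k)" by (simp add: tpos_def)
  have tt: "tpos T w k - tpos T w (Suc k) = - pc T (w ! k) (w ! Suc k)" using t by linarith
  show ?thesis
  proof (cases "w ! k = w ! Suc k")
    case True
    have "omw T w k (Suc k) = 1 + pc T (w ! k) (w ! Suc k) / (tpos T w k - tpos T w (Suc k))"
      unfolding omw_def Let_def by (rule if_P[OF True])
    also have "\<dots> = 0" unfolding tt using c by simp
    finally show ?thesis .
  next
    case False
    then show ?thesis using c t unfolding omw_def Let_def by simp
  qed
qed

text \<open>Everything that does not depend on where the chains sit. The limit is studied at this
  level so that the values of root vectors on chains are the same for all positions, in particular
  for all \<tau>.\<close>

locale chains0 =
  fixes T :: cartan_type and N :: nat and ws :: "nat \<Rightarrow> nat list"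
  assumes good: "a < N \<Longrightarrow> good_word T (ws a)"
    and ws_ne: "a < N \<Longrightarrow> ws a \<noteq> []"
begin

definition PP :: "(nat \<times> nat) set" where
  "PP = (SIGMA a:{..<N}. {..<length (ws a)})"

definition col :: "nat \<times> nat \<Rightarrow> nat" where
  "col P = ws (fst P) ! snd P"

lemma finite_PP: "finite PP"
  by (auto simp: PP_def)

end

locale chains = chains0 T N ws for T N ws +
  fixes us :: "nat \<Rightarrow> real"
  assumes us_inj: "a < N \<Longrightarrow> b < N \<Longrightarrow> a \<noteq> b \<Longrightarrow> us a \<noteq> us b"
begin

definition pos :: "real \<Rightarrow> nat \<times> nat \<Rightarrow> real" where
  "pos \<eta> P = us (fst P) + \<eta> * tpos T (ws (fst P)) (snd P)"

definition om :: "real \<Rightarrow> nat \<times> nat \<Rightarrow> nat \<times> nat \<Rightarrow> real" where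
  "om \<eta> Q P = (if fst Q = fst P then omw T (ws (fst Q)) (snd Q) (snd P)
    else 1 + \<eta> * pc T (col Q) (col P) / (pos \<eta> Q - pos \<eta> P))"

definition generic :: "real \<Rightarrow> bool" where
  "generic \<eta> \<longleftrightarrow> \<eta> \<noteq> 0 \<and> (\<forall>P\<in>PP. \<forall>Q\<in>PP. fst P \<noteq> fst Q \<longrightarrow> pos \<eta> P \<noteq> pos \<eta> Q)"

sublocale S: shuffle PP "om \<eta>" for \<eta>
  by unfold_locales (rule finite_PP)

text \<open>Inside a chain all differences of positions carry a factor \<eta>, which cancels. Across
  chains the twist has the form required for equal colours, and this form solves the exchange
  relation for different colours as well.\<close>

lemma shuffle_rel_om:
  assumes \<eta>: "generic \<eta>"
  shows "shuffle_rel PP (om \<eta>) col (pos \<eta>) (\<lambda>i j. \<eta> * pc T i j)"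
proof
  have n0: "\<eta> \<noteq> 0" using \<eta> by (simp add: generic_def)
  fix P Q assume P: "P \<in> PP" and Q: "Q \<in> PP"
  obtain a k b l where ak: "P = (a, k)" "Q = (b, l)" by (cases P; cases Q) auto
  have in_range: "a < N" "k < length (ws a)" "b < N" "l < length (ws b)" using P Q ak by (auto simp: PP_def)
  have gw: "good_word T (ws a)" by (rule good) (rule in_range)
  {
    assume "P \<noteq> Q" and c: "col P = col Q"
    show "pos \<eta> P \<noteq> pos \<eta> Q \<and> om \<eta> Q P = 1 + \<eta> * pc T (col P) (col P) / (pos \<eta> Q - pos \<eta> P)"
    proof (cases "a = b")
      case False
      then show ?thesis using \<eta> P Q ak c by (auto simp: generic_def om_def)
    next
      case True
      then have kl: "k \<noteq> l" using \<open>P \<noteq> Q\<close> ak by auto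
      have "tpos T (ws a) k \<noteq> tpos T (ws a) l"
        using gw kl c in_range True ak unfolding good_word_def col_def
        by (metis fst_conv linorder_neqE_nat snd_conv)
      moreover have "pos \<eta> Q - pos \<eta> P = \<eta> * (tpos T (ws a) l - tpos T (ws a) k)"
        using True ak by (simp add: pos_def algebra_simps)
      moreover have "om \<eta> Q P = 1 + pc T (col P) (col P) / (tpos T (ws a) l - tpos T (ws a) k)"
        using True ak c by (simp add: om_def omw_def Let_def col_def)
      ultimately show ?thesis using n0 by auto
    qed
  }
  assume c: "col P \<noteq> col Q"
  show "om \<eta> Q P * (pos \<eta> Q - pos \<eta> P - \<eta> * pc T (col Q) (col P)) =
      om \<eta> P Q * (pos \<eta> Q - pos \<eta> P + \<eta> * pc T (col Q) (col P))"
  proof (cases "a = b")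
    case False
    then have z: "pos \<eta> Q - pos \<eta> P \<noteq> 0" using \<eta> P Q ak by (auto simp: generic_def)
    have gen: "(1 + e / z) * (z - e) = (1 + e / (- z)) * (z + e)" if "z \<noteq> 0" for e z :: real
      using that by (simp add: field_simps)
    show ?thesis
      using gen[OF z, of "\<eta> * pc T (col Q) (col P)"] False ak pc_sym[of T "col P" "col Q"]
      by (simp add: om_def)
  next
    case True
    let ?t = "tpos T (ws a)" and ?c = "pc T (col Q) (col P)"
    have d: "pos \<eta> Q - pos \<eta> P = \<eta> * (?t l - ?t k)"
      using True ak by (simp add: pos_def algebra_simps)
    have kl: "k \<noteq> l" using c True ak by auto
    have key: "omw T (ws a) p q * (?t q - ?t p + e) = ?t q - ?t p - e \<and> omw T (ws a) q p = 1"
      if "p < q" "q < length (ws a)" "ws a ! p \<noteq> ws a ! q" "e = pc T (ws a ! p) (ws a ! q)" for p q e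
    proof (cases "e = 0")
      case False
      then have "?t q - ?t p + e \<noteq> 0" using gw that unfolding good_word_def by metis
      then show ?thesis using that False by (auto simp: omw_def Let_def)
    qed (use that in \<open>auto simp: omw_def Let_def\<close>)
    have cc: "?c = pc T (ws a ! k) (ws a ! l)" using True ak pc_sym by (simp add: col_def)
    have om: "om \<eta> Q P = omw T (ws a) l k" "om \<eta> P Q = omw T (ws a) k l" using True ak by (simp_all add: om_def)
    have ne: "ws a ! k \<noteq> ws a ! l" using c True ak by (simp add: col_def)
    show ?thesis
    proof (cases "k < l")
      case True': True
      have K: "omw T (ws a) k l * (?t l - ?t k + ?c) = ?t l - ?t k - ?c" "omw T (ws a) l k = 1"
        using key[of k l ?c] True' in_range True ne cc by auto
      have "omw T (ws a) k l * (\<eta> * (?t l - ?t k) + \<eta> * ?c) = \<eta> * (omw T (ws a) k l * (?t l - ?t k + ?c))"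
        by (simp add: algebra_simps)
      then show ?thesis unfolding om d K by (simp add: algebra_simps)
    next
      case False
      have K: "omw T (ws a) l k * (?t k - ?t l + ?c) = ?t k - ?t l - ?c" "omw T (ws a) k l = 1"
        using key[of l k ?c] False kl in_range True ne cc pc_sym[of T "ws a ! k" "ws a ! l"] by auto
      have "omw T (ws a) l k * (\<eta> * (?t l - ?t k) - \<eta> * ?c) = - (\<eta> * (omw T (ws a) l k * (?t k - ?t l + ?c)))"
        by (simp add: algebra_simps)
      then show ?thesis unfolding om d K by (simp add: algebra_simps)
    qed
  qed
next
  show "\<eta> * pc T i j = \<eta> * pc T j i" for i j using pc_sym by simp
qed

definition ph :: "real \<Rightarrow> nat \<times> nat \<Rightarrow> nat \<times> nat \<Rightarrow> real" where
  "ph \<eta> = (\<lambda>(i, r) Q. if col Q = i then pos \<eta> Q ^ r else 0)"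

abbreviation E :: "real \<Rightarrow> free_elem \<Rightarrow> (nat \<times> nat) set \<Rightarrow> real" where
  "E \<eta> f \<equiv> S.Phi \<eta> (ph \<eta>) \<eta> f"

lemma pairing_exact:
  assumes "valid T" "i \<in> index_set T" "j \<in> index_set T"
  shows "sym_d T i * cartan_a T i j = root_pairing T i j"
  using assms by (cases T) (auto simp: sym_d_def cartan_a_def valid_def)

lemma relators_vanish:
  assumes T: "valid T" and \<eta>: "generic \<eta>" and f: "f \<in> yangian_relators T"
  shows "E \<eta> f = (\<lambda>_. 0)"
proof -
  interpret R: shuffle_rel PP "om \<eta>" col "pos \<eta>" "\<lambda>i j. \<eta> * pc T i j"
    by (rule shuffle_rel_om[OF \<eta>])
  have ph: "ph \<eta> = R.gph" by (simp add: ph_def R.gph_def)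
  have n0: "\<eta> \<noteq> 0" using \<eta> by (simp add: generic_def)
  from f consider i j r s where "f = quadratic_relator T i j r s" "i \<in> index_set T" "j \<in> index_set T"
    | i j s r where "f = serre_relator T i j s r" "i \<in> index_set T" "j \<in> index_set T" "i \<noteq> j"
    unfolding yangian_relators_def by blast
  then show ?thesis
  proof cases
    case 1
    have c: "ev \<eta> ([:of_int (sym_d T i * cartan_a T i j) / 2:] * hbar) = \<eta> * pc T i j"
      unfolding pairing_exact[OF T 1(2,3)] ev_mult ev_hbar by (simp add: pc_def of_rat_divide)
    show ?thesis
    proof
      fix \<mu>
      show "E \<eta> f \<mu> = 0"
      proof (cases "\<mu> \<subseteq> PP")
        case True
        show ?thesis
          using R.quadratic_shuffle[OF True, of i r j s]
          unfolding 1(1) quadratic_relator_def S.Phi_diff S.Phi_commutator S.Phi_scal c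
          unfolding S.Phi_add S.Phi_mult S.Phi_gen ph S.com_def .
      qed (rule S.Phi_out)
    qed
  next
    case 2
    define m where "m = nat (1 - cartan_a T i j)"
    have a0: "cartan_a T i j \<le> 0" and dpos: "sym_d T i \<noteq> 0" and dd: "root_pairing T i i = 2 * sym_d T i"
      using T 2 by (cases T; auto simp: cartan_a_def sym_d_def valid_def)+
    have m: "m \<ge> 1" "real m - 1 = - real_of_int (cartan_a T i j)" using a0 by (auto simp: m_def)
    have "real_of_int (root_pairing T i j) = real_of_int (sym_d T i) * real_of_int (cartan_a T i j)"
      using pairing_exact[OF T 2(2,3)] by (metis of_int_mult)
    then have mc: "2 * (\<eta> * pc T i j) = - (real m - 1) * (\<eta> * pc T i i)"
      unfolding m(2) pc_def dd by simp
    \<comment> \<open>For orthogonal colours both twists are 1. The exchange relation alone would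
      not give their equality at coinciding positions.\<close>
    have comm: "om \<eta> P Q = om \<eta> Q P" if "\<eta> * pc T i j = 0" "col P = i" "col Q = j" for P Q
      using that n0 2(4) pc_sym[of T i j] unfolding om_def omw_def Let_def by (auto simp: col_def)
    have fold: "E \<eta> (foldr (\<lambda>k. commutator (gen i (s (\<sigma> k)))) ks (gen j r)) =
        foldr (\<lambda>k. S.com \<eta> (S.sing (ph \<eta> (i, s (\<sigma> k))))) ks (S.sing (ph \<eta> (j, r)))" for \<sigma> ks
      by (induction ks) (simp_all add: S.Phi_gen S.Phi_commutator)
    show ?thesis
    proof
      fix \<mu>
      show "E \<eta> f \<mu> = 0"
        unfolding 2(1) serre_relator_def Let_def m_def[symmetric] S.Phi_sum fold unfolding ph
        by (rule R.serre_shuffle[OF 2(4) m(1) mc]) (rule comm)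
    qed
  qed
qed

lemma ideal_vanish:
  assumes T: "valid T" and \<eta>: "generic \<eta>" and f: "f \<in> yangian_ideal T"
  shows "E \<eta> f = (\<lambda>_. 0)"
proof -
  let ?K = "{f \<in> falg (index_set T). E \<eta> f = (\<lambda>_. 0)}"
  interpret F: ring "free_alg (index_set T)" by (rule free_alg_ring)
  have "ideal ?K (free_alg (index_set T))"
  proof (rule idealI[OF free_alg_ring])
    show "subgroup ?K (add_monoid (free_alg (index_set T)))"
    proof (rule F.add.subgroupI)
      show "?K \<noteq> {}" using falg_0 S.Phi_0 by blast
      show "\<ominus>\<^bsub>free_alg (index_set T)\<^esub> a \<in> ?K" if "a \<in> ?K" for a
        using that by (simp add: free_alg_a_inv falg_uminus S.Phi_uminus)
    qed (auto simp: falg_add S.Phi_add)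
  qed (auto simp: falg_mult S.Phi_mult S.conv_0)
  moreover have "yangian_relators T \<subseteq> ?K"
    using relators_vanish[OF T \<eta>] yangian_relators_falg by auto
  ultimately show ?thesis using yangian_ideal_minimal f by blast
qed

section \<open>The limit \<eta> to 0\<close>

lemma tendsto_om:
  assumes "P \<in> PP" "Q \<in> PP"
  shows "((\<lambda>\<eta>. om \<eta> Q P) \<longlongrightarrow> om 0 Q P) (at 0)"
proof (cases "fst Q = fst P")
  case False
  have "us (fst Q) - us (fst P) \<noteq> 0" using assms False us_inj[of "fst Q" "fst P"] by (auto simp: PP_def)
  then have "((\<lambda>\<eta>. 1 + \<eta> * pc T (col Q) (col P) / (pos \<eta> Q - pos \<eta> P)) \<longlongrightarrow>
      1 + 0 * pc T (col Q) (col P) / (us (fst Q) + 0 * tpos T (ws (fst Q)) (snd Q)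
        - (us (fst P) + 0 * tpos T (ws (fst P)) (snd P)))) (at 0)"
    unfolding pos_def by (intro tendsto_intros) simp
  then show ?thesis using False by (simp add: om_def pos_def)
qed (simp add: om_def)

lemma tendsto_conv:
  assumes "\<And>\<mu>. ((\<lambda>\<eta>. F \<eta> \<mu>) \<longlongrightarrow> F 0 \<mu>) (at 0)" "\<And>\<mu>. ((\<lambda>\<eta>. G \<eta> \<mu>) \<longlongrightarrow> G 0 \<mu>) (at 0)"
  shows "((\<lambda>\<eta>. S.conv \<eta> (F \<eta>) (G \<eta>) \<mu>) \<longlongrightarrow> S.conv 0 (F 0) (G 0) \<mu>) (at 0)"
proof (cases "\<mu> \<subseteq> PP")
  case True
  show ?thesis
    unfolding S.conv_def if_P[OF True]
    by (intro tendsto_intros assms tendsto_om) (use True in auto)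
qed (simp add: S.conv_def)

lemma tendsto_weval: "((\<lambda>\<eta>. S.weval \<eta> (ph \<eta>) w \<mu>) \<longlongrightarrow> S.weval 0 (ph 0) w \<mu>) (at 0)"
proof (induction w arbitrary: \<mu>)
  case Nil
  show ?case by (simp add: S.one_fn_def)
next
  case (Cons q w)
  have tp: "((\<lambda>\<eta>. pos \<eta> Q) \<longlongrightarrow> pos 0 Q) (at 0)" for Q
    unfolding pos_def by (intro tendsto_intros)
  obtain i r where q: "q = (i, r)" by (cases q)
  have "((\<lambda>\<eta>. ph \<eta> q Q) \<longlongrightarrow> ph 0 q Q) (at 0)" for Q
    unfolding ph_def q prod.case by (cases "col Q = i") (simp_all only: if_True if_False simp_thms tendsto_power[OF tp] tendsto_const)
  then have "((\<lambda>\<eta>. S.sing (ph \<eta> q) \<mu>) \<longlongrightarrow> S.sing (ph 0 q) \<mu>) (at 0)" for \<mu>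
    unfolding S.sing_def
    by (cases "\<mu> \<subseteq> PP \<and> is_singleton \<mu>") (simp_all only: if_True if_False simp_thms tendsto_const)
  then show ?case
    unfolding S.weval.simps by (rule tendsto_conv) (rule Cons.IH)
qed

lemma tendsto_ev: "((\<lambda>\<eta>. ev \<eta> c) \<longlongrightarrow> ev 0 c) (at 0)"
  unfolding ev_def by (intro tendsto_intros)

lemma tendsto_E: "((\<lambda>\<eta>. E \<eta> f \<mu>) \<longlongrightarrow> E 0 f \<mu>) (at 0)"
  unfolding S.Phi_def by (intro tendsto_intros tendsto_ev tendsto_weval)

lemma eventually_generic: "eventually generic (at 0)"
proof -
  have "eventually (\<lambda>\<eta>. fst P \<noteq> fst Q \<longrightarrow> pos \<eta> P \<noteq> pos \<eta> Q) (at 0)" if "P \<in> PP" "Q \<in> PP" for P Q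
  proof (cases "fst P = fst Q")
    case False
    have "((\<lambda>\<eta>. pos \<eta> P - pos \<eta> Q) \<longlongrightarrow>
      (us (fst P) + 0 * tpos T (ws (fst P)) (snd P)) - (us (fst Q) + 0 * tpos T (ws (fst Q)) (snd Q))) (at 0)"
      unfolding pos_def by (intro tendsto_intros)
    moreover have "us (fst P) \<noteq> us (fst Q)" using that False us_inj[of "fst P" "fst Q"] by (auto simp: PP_def)
    ultimately have "eventually (\<lambda>\<eta>. pos \<eta> P - pos \<eta> Q \<noteq> 0) (at 0)"
      by (intro tendsto_imp_eventually_ne) auto
    then show ?thesis by (rule eventually_mono) auto
  qed simp
  then have "eventually (\<lambda>\<eta>. \<forall>P\<in>PP. \<forall>Q\<in>PP. fst P \<noteq> fst Q \<longrightarrow> pos \<eta> P \<noteq> pos \<eta> Q) (at 0)"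
    by (intro eventually_ball_finite finite_PP ballI)
  moreover have "eventually (\<lambda>\<eta>::real. \<eta> \<noteq> 0) (at 0)" by (simp add: eventually_at_filter)
  ultimately show ?thesis by eventually_elim (simp add: generic_def)
qed

text \<open>At generic \<eta> the relation holds and can be divided by \<open>\<eta>^k\<close>; in
  the limit only the coefficients of \<open>hbar^k\<close> survive.\<close>

lemma lowest_coefficient_vanishes:
  assumes T: "valid T" and "finite S"
    and ideal: "(\<Sum>h\<in>S. scal (c h) * X h) \<in> yangian_ideal T"
    and low: "\<And>h l. h \<in> S \<Longrightarrow> l < k \<Longrightarrow> Polynomial.coeff (c h) l = 0"
  shows "(\<Sum>h\<in>S. of_rat (Polynomial.coeff (c h) k) * E 0 (X h) \<mu>) = 0"
proof -
  have "\<exists>q. c h = Polynomial.monom 1 k * q" if "h \<in> S" for h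
    using low[OF that] monom_1_dvd_iff'[of k "c h"] by (auto simp: dvd_def)
  then obtain q where q: "\<And>h. h \<in> S \<Longrightarrow> c h = Polynomial.monom 1 k * q h" by metis
  have ev0: "ev 0 p = of_rat (Polynomial.coeff p 0)" for p by (cases p) simp
  have evm: "ev \<eta> (Polynomial.monom 1 k) = \<eta> ^ k" for \<eta>
    by (simp add: monom_altdef ev_smult ev_power flip: hbar_def)
  have "(\<Sum>h\<in>S. ev \<eta> (q h) * E \<eta> (X h) \<mu>) = 0" if \<eta>: "generic \<eta>" for \<eta>
  proof -
    have "0 = (\<Sum>h\<in>S. ev \<eta> (c h) * E \<eta> (X h) \<mu>)"
      using ideal_vanish[OF T \<eta> ideal] by (simp add: S.Phi_sum S.Phi_scal fun_eq_iff)
    also have "\<dots> = \<eta> ^ k * (\<Sum>h\<in>S. ev \<eta> (q h) * E \<eta> (X h) \<mu>)"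
      unfolding sum_distrib_left by (intro sum.cong refl) (simp add: q ev_mult evm mult.assoc)
    finally show ?thesis using \<eta> by (simp add: generic_def)
  qed
  then have e: "eventually (\<lambda>\<eta>. (\<Sum>h\<in>S. ev \<eta> (q h) * E \<eta> (X h) \<mu>) = 0) (at 0)"
    using eventually_generic by (rule eventually_mono[rotated])
  have L: "((\<lambda>\<eta>. \<Sum>h\<in>S. ev \<eta> (q h) * E \<eta> (X h) \<mu>) \<longlongrightarrow> (\<Sum>h\<in>S. ev 0 (q h) * E 0 (X h) \<mu>)) (at 0)"
    by (intro tendsto_intros tendsto_ev tendsto_E)
  have "(\<Sum>h\<in>S. ev 0 (q h) * E 0 (X h) \<mu>) = 0"
    by (rule tendsto_unique[OF at_neq_bot L tendsto_eventually[OF e]])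
  moreover have "Polynomial.coeff (c h) k = Polynomial.coeff (q h) 0" if "h \<in> S" for h
    using coeff_monom_mult[of 1 k "q h" k] q[OF that] by simp
  ultimately show ?thesis by (simp add: ev0)
qed

end

section \<open>The limiting shuffle algebra, in which chains do not interact\<close>

context chains0
begin

definition om0 :: "nat \<times> nat \<Rightarrow> nat \<times> nat \<Rightarrow> real" where
  "om0 Q P = (if fst Q = fst P then omw T (ws (fst Q)) (snd Q) (snd P) else 1)"

sublocale Z: shuffle PP om0
  by unfold_locales (rule finite_PP)

definition ph0 :: "(nat \<Rightarrow> real) \<Rightarrow> nat \<times> nat \<Rightarrow> nat \<times> nat \<Rightarrow> real" where
  "ph0 u = (\<lambda>(i, r) Q. if col Q = i then u (fst Q) ^ r else 0)"

abbreviation E0 :: "(nat \<Rightarrow> real) \<Rightarrow> free_elem \<Rightarrow> (nat \<times> nat) set \<Rightarrow> real" where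
  "E0 u f \<equiv> Z.Phi (ph0 u) 0 f"

definition zgen :: "nat \<Rightarrow> (nat \<times> nat) set \<Rightarrow> real" where
  "zgen i = Z.sing (\<lambda>Q. if col Q = i then 1 else 0)"

text \<open>The limiting root vector of loop degree 0. Degree \<open>s\<close> only multiplies its
  values on subsets of chain \<open>a\<close> by \<open>u a ^ s\<close>, see
  \<open>scaled\<close>.\<close>

definition zroot :: "nat list \<Rightarrow> (nat \<times> nat) set \<Rightarrow> real" where
  "zroot \<beta> = (if T = G2 \<and> \<beta> = [1,2,1,2,2]
    then Z.com (Z.com (zgen 1) (zgen 2)) (Z.com (Z.com (zgen 1) (zgen 2)) (zgen 2))
    else foldl Z.com (zgen (hd \<beta>)) (map zgen (tl \<beta>)))"

text \<open>The analogue of primitive elements: such a function is not shared between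
  chains.\<close>

definition prim :: "((nat \<times> nat) set \<Rightarrow> real) \<Rightarrow> bool" where
  "prim F \<longleftrightarrow> (\<forall>\<mu>. F \<mu> \<noteq> 0 \<longrightarrow> \<mu> \<noteq> {} \<and> (\<exists>a. \<mu> \<subseteq> {a} \<times> UNIV))"

text \<open>In the limit all points of chain \<open>a\<close> have the same position
  \<open>u a\<close>, so only the total loop degree matters.\<close>

definition scaled :: "(nat \<Rightarrow> real) \<Rightarrow> nat \<Rightarrow> ((nat \<times> nat) set \<Rightarrow> real) \<Rightarrow> ((nat \<times> nat) set \<Rightarrow> real) \<Rightarrow> bool" where
  "scaled u s F G \<longleftrightarrow> (\<forall>\<mu> a. \<mu> \<subseteq> {a} \<times> UNIV \<longrightarrow> F \<mu> = u a ^ s * G \<mu>)"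

definition supp :: "((nat \<times> nat) set \<Rightarrow> real) \<Rightarrow> nat multiset \<Rightarrow> bool" where
  "supp F M \<longleftrightarrow> (\<forall>\<mu>. F \<mu> \<noteq> 0 \<longrightarrow> image_mset col (mset_set \<mu>) = M)"

lemma om0_different: "A \<subseteq> {a} \<times> UNIV \<Longrightarrow> C \<subseteq> {b} \<times> UNIV \<Longrightarrow> a \<noteq> b \<Longrightarrow> Z.Om A C = 1"
  by (intro prod.neutral ballI) (auto simp: om0_def)

text \<open>A splitting into parts on different chains has twist 1 in both orders, so it drops out
  of the commutator.\<close>

lemma prim_com:
  assumes "prim F" "prim G"
  shows "prim (Z.com F G)"
  unfolding prim_def
proof (intro allI impI)
  fix \<mu> assume nz: "Z.com F G \<mu> \<noteq> 0"
  then have \<mu>: "\<mu> \<subseteq> PP" by (auto simp: Z.com_def Z.conv_def split: if_splits)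
  show "\<mu> \<noteq> {} \<and> (\<exists>a. \<mu> \<subseteq> {a} \<times> UNIV)"
  proof (rule ccontr)
    assume no: "\<not> (\<mu> \<noteq> {} \<and> (\<exists>a. \<mu> \<subseteq> {a} \<times> UNIV))"
    have "Z.conv G F \<mu> = (\<Sum>A\<in>Pow \<mu>. F A * G (\<mu> - A) * Z.Om (\<mu> - A) A)"
      unfolding Z.conv_def if_P[OF \<mu>]
      by (rule sum.reindex_bij_witness[where i = "\<lambda>A. \<mu> - A" and j = "\<lambda>A. \<mu> - A"])
        (auto simp: double_diff)
    moreover have sym: "F A * G (\<mu> - A) * Z.Om A (\<mu> - A) = F A * G (\<mu> - A) * Z.Om (\<mu> - A) A"
      if A: "A \<in> Pow \<mu>" for A
    proof (cases "F A = 0 \<or> G (\<mu> - A) = 0")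
      case False
      then obtain a b where ab: "A \<subseteq> {a} \<times> UNIV" "\<mu> - A \<subseteq> {b} \<times> UNIV" "A \<noteq> {}"
        using assms unfolding prim_def by blast
      have "a \<noteq> b" using ab A no by blast
      then show ?thesis using om0_different[OF ab(1,2)] om0_different[OF ab(2,1)] by simp
    qed auto
    moreover have "Z.conv F G \<mu> = (\<Sum>A\<in>Pow \<mu>. F A * G (\<mu> - A) * Z.Om (\<mu> - A) A)"
      unfolding Z.conv_def if_P[OF \<mu>] by (rule sum.cong[OF refl]) (rule sym)
    ultimately have "Z.com F G \<mu> = 0" by (simp add: Z.com_def)
    then show False using nz by simp
  qed
qed

lemma scaled_com:
  assumes "scaled u s F G" "scaled u s' F' G'"
  shows "scaled u (s + s') (Z.com F F') (Z.com G G')"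
  unfolding scaled_def
proof (intro allI impI)
  fix \<mu> :: "(nat \<times> nat) set" and a assume \<mu>: "\<mu> \<subseteq> {a} \<times> UNIV"
  have "Z.conv F F' \<mu> = u a ^ (s + s') * Z.conv G G' \<mu>" if "scaled u s F G" "scaled u s' F' G'" for F G F' G' s s'
  proof (cases "\<mu> \<subseteq> PP")
    case True
    have "F A * F' (\<mu> - A) * Z.Om A (\<mu> - A) = u a ^ (s + s') * (G A * G' (\<mu> - A) * Z.Om A (\<mu> - A))"
      if A: "A \<in> Pow \<mu>" for A
    proof -
      have "A \<subseteq> {a} \<times> UNIV" "\<mu> - A \<subseteq> {a} \<times> UNIV" using A \<mu> by auto
      then have "F A = u a ^ s * G A" "F' (\<mu> - A) = u a ^ s' * G' (\<mu> - A)"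
        using \<open>scaled u s F G\<close> \<open>scaled u s' F' G'\<close> unfolding scaled_def by blast+
      then show ?thesis by (simp add: power_add)
    qed
    then show ?thesis unfolding Z.conv_def if_P[OF True] sum_distrib_left by (intro sum.cong refl)
  qed (simp add: Z.conv_def)
  from this[OF assms] this[OF assms(2,1)]
  show "Z.com F F' \<mu> = u a ^ (s + s') * Z.com G G' \<mu>"
    by (simp add: Z.com_def right_diff_distrib add.commute)
qed

lemma supp_com:
  assumes "supp F M" "supp G M'"
  shows "supp (Z.com F G) (M + M')"
  unfolding supp_def
proof (intro allI impI)
  fix \<mu> assume nz: "Z.com F G \<mu> \<noteq> 0"
  have conv: "image_mset col (mset_set \<mu>) = M + M'" if "Z.conv F G \<mu> \<noteq> 0" "supp F M" "supp G M'" for F G M M'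
  proof -
    have \<mu>: "\<mu> \<subseteq> PP" using that(1) by (auto simp: Z.conv_def split: if_splits)
    have n: "(\<Sum>A\<in>Pow \<mu>. F A * G (\<mu> - A) * Z.Om A (\<mu> - A)) \<noteq> 0"
      using that(1) unfolding Z.conv_def if_P[OF \<mu>] .
    from sum.not_neutral_contains_not_neutral[OF n]
    obtain A where A: "A \<in> Pow \<mu>" "F A * G (\<mu> - A) * Z.Om A (\<mu> - A) \<noteq> 0" .
    have sub: "A \<subseteq> \<mu>" and fin: "finite \<mu>" using A(1) Z.sub_fin[OF \<mu>] by auto
    have "A \<union> (\<mu> - A) = \<mu>" using sub by auto
    with mset_set_Union[OF finite_subset[OF sub fin] finite_Diff[OF fin, of A]]
    have m: "mset_set \<mu> = mset_set A + mset_set (\<mu> - A)" by simp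
    have "F A \<noteq> 0" "G (\<mu> - A) \<noteq> 0" using A(2) by auto
    then have "image_mset col (mset_set A) = M" "image_mset col (mset_set (\<mu> - A)) = M'"
      using that(2,3) unfolding supp_def by blast+
    then show ?thesis unfolding m by simp
  qed
  from nz have "Z.conv F G \<mu> \<noteq> 0 \<or> Z.conv G F \<mu> \<noteq> 0" by (auto simp: Z.com_def)
  then show "image_mset col (mset_set \<mu>) = M + M'"
    using conv[OF _ assms] conv[OF _ assms(2,1)] by (auto simp: add.commute)
qed

definition ok :: "(nat \<Rightarrow> real) \<Rightarrow> nat \<Rightarrow> nat multiset \<Rightarrow> free_elem \<Rightarrow> ((nat \<times> nat) set \<Rightarrow> real) \<Rightarrow> bool" where
  "ok u s M f G \<longleftrightarrow> prim (E0 u f) \<and> scaled u s (E0 u f) G \<and> supp (E0 u f) M"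

lemma ok_commutator:
  "ok u s M f G \<Longrightarrow> ok u s' M' f' G' \<Longrightarrow> ok u (s + s') (M + M') (commutator f f') (Z.com G G')"
  by (simp add: ok_def Z.Phi_commutator prim_com scaled_com supp_com)

lemma ok_gen: "ok u r {#i#} (gen i r) (zgen i)"
proof -
  have "scaled u r (Z.sing (ph0 u (i, r))) (zgen i)"
    unfolding scaled_def
  proof (intro allI impI)
    fix \<mu> :: "(nat \<times> nat) set" and a assume "\<mu> \<subseteq> {a} \<times> UNIV"
    then show "Z.sing (ph0 u (i, r)) \<mu> = u a ^ r * zgen i \<mu>"
      by (auto simp: Z.sing_def zgen_def ph0_def is_singleton_def)
  qed
  moreover have "prim (Z.sing (ph0 u (i, r)))"
    unfolding prim_def by (auto simp: Z.sing_def is_singleton_def split: if_splits)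
  moreover have "supp (Z.sing (ph0 u (i, r))) {#i#}"
    unfolding supp_def by (auto simp: Z.sing_def is_singleton_def ph0_def split: if_splits)
  ultimately show ?thesis by (simp add: ok_def Z.Phi_gen)
qed

lemma ok_foldl:
  "ok u s M f G \<Longrightarrow> length ts = length ks \<Longrightarrow>
    ok u (s + sum_list ts) (M + mset ks) (foldl commutator f (map2 gen ks ts)) (foldl Z.com G (map zgen ks))"
proof (induction ks arbitrary: ts s M f G)
  case (Cons k ks)
  obtain t ts' where ts: "ts = t # ts'" using Cons.prems by (cases ts) auto
  show ?case
    using Cons.IH[OF ok_commutator[OF Cons.prems(1) ok_gen], of ts' t k] Cons.prems(2) ts
    by (simp add: add.assoc)
qed simp

lemma ok_rvec:
  assumes "decomposition T \<delta>" "\<beta> \<in> set (pos_roots T)"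
  shows "ok u s (mset \<beta>) (rvec T \<delta> (\<beta>, s)) (zroot \<beta>)"
proof -
  have len: "length (\<delta> \<beta> s) = length \<beta>" "sum_list (\<delta> \<beta> s) = s"
    using decompositionD[OF assms] by auto
  show ?thesis
  proof (cases "T = G2 \<and> \<beta> = [1,2,1,2,2]")
    case True
    have "\<exists>a b c d e. \<delta> \<beta> s = [a, b, c, d, e]"
      using len(1) True by (simp add: length_Suc_conv) blast
    then obtain a b c d e where abc: "\<delta> \<beta> s = [a, b, c, d, e]" by blast
    then have s: "s = (a + b) + ((c + d) + e)" using len(2) by simp
    have m: "mset \<beta> = ({#1#} + {#2#}) + (({#1#} + {#2#}) + {#2#})" using True by simp
    have "rvec T \<delta> (\<beta>, s) = commutator (commutator (gen 1 a) (gen 2 b))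
       (commutator (commutator (gen 1 c) (gen 2 d)) (gen 2 e))"
      using abc True by (simp add: rvec_def Let_def)
    moreover have "zroot \<beta> = Z.com (Z.com (zgen 1) (zgen 2)) (Z.com (Z.com (zgen 1) (zgen 2)) (zgen 2))"
      unfolding zroot_def by (rule if_P[OF True])
    ultimately show ?thesis unfolding s m by (simp only: ok_commutator ok_gen)
  next
    case False
    obtain k \<beta>' where \<beta>: "\<beta> = k # \<beta>'" using pos_roots_ne[OF assms(2)] by (cases \<beta>) auto
    obtain t ts where ts: "\<delta> \<beta> s = t # ts" "length ts = length \<beta>'" using len(1) \<beta> by (cases "\<delta> \<beta> s") auto
    have s: "s = t + sum_list ts" using len(2) ts by simp
    have "rvec T \<delta> (\<beta>, s) = lnest (map2 gen \<beta> (\<delta> \<beta> s))"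
      unfolding rvec_def Let_def using False by (simp only: prod.case if_False)
    then have "rvec T \<delta> (\<beta>, s) = foldl commutator (gen k t) (map2 gen \<beta>' ts)"
      using \<beta> ts by (simp add: lnest_def)
    moreover have "zroot \<beta> = foldl Z.com (zgen k) (map zgen \<beta>')"
      unfolding zroot_def if_not_P[OF False] by (simp only: \<beta> list.sel)
    moreover have "mset \<beta> = {#k#} + mset \<beta>'" using \<beta> by simp
    ultimately show ?thesis using ok_foldl[OF ok_gen ts(2), of u t k] s by simp
  qed
qed

definition Cv :: "((nat \<times> nat) set \<Rightarrow> real) list \<Rightarrow> (nat \<times> nat) set \<Rightarrow> real" where
  "Cv Fs = foldr Z.conv Fs Z.one_fn"

lemma E0_mono: "E0 u (root_mono T \<delta> ps) = Cv (map (\<lambda>p. E0 u (rvec T \<delta> p)) ps)"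
  by (induction ps) (simp_all add: root_mono_def Cv_def Z.Phi_1 Z.Phi_mult)

text \<open>Each factor uses up points of one chain only, so some chain is left over.\<close>

lemma Cv_few:
  assumes "\<And>F. F \<in> set Fs \<Longrightarrow> prim F" "\<mu> \<subseteq> PP" "length Fs < card (fst ` \<mu>)"
  shows "Cv Fs \<mu> = 0"
  using assms
proof (induction Fs arbitrary: \<mu>)
  case Nil
  then show ?case by (auto simp: Cv_def Z.one_fn_def)
next
  case (Cons F Fs)
  have z: "F A * Cv Fs (\<mu> - A) * Z.Om A (\<mu> - A) = 0" if A: "A \<in> Pow \<mu>" for A
  proof (cases "F A = 0")
    case False
    then obtain a where a: "A \<subseteq> {a} \<times> UNIV" using Cons.prems(1)[of F] by (auto simp: prim_def)
    have fm: "finite \<mu>" by (rule Z.sub_fin[OF Cons.prems(2)])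
    have "fst ` \<mu> \<subseteq> insert a (fst ` (\<mu> - A))" using a by force
    then have "card (fst ` \<mu>) \<le> card (insert a (fst ` (\<mu> - A)))" using fm by (intro card_mono) auto
    also have "\<dots> \<le> Suc (card (fst ` (\<mu> - A)))" by (rule card_insert_le_m1) (use fm in auto)
    finally have "length Fs < card (fst ` (\<mu> - A))" using Cons.prems(3) by simp
    moreover have "\<mu> - A \<subseteq> PP" using Cons.prems(2) by auto
    ultimately have "Cv Fs (\<mu> - A) = 0" using Cons.prems(1) by (intro Cons.IH) auto
    then show ?thesis by simp
  qed simp
  have "Cv (F # Fs) \<mu> = (\<Sum>A\<in>Pow \<mu>. F A * Cv Fs (\<mu> - A) * Z.Om A (\<mu> - A))"
    using Cons.prems(2) by (simp add: Cv_def Z.conv_def)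
  also have "\<dots> = 0" by (rule sum.neutral) (rule ballI, rule z)
  finally show ?case .
qed

definition ch :: "nat \<Rightarrow> (nat \<times> nat) set" where
  "ch a = {a} \<times> {..<length (ws a)}"

definition full :: "nat set \<Rightarrow> (nat \<times> nat) set" where
  "full S = (\<Union>a\<in>S. ch a)"

lemma fst_full: "S \<subseteq> {..<N} \<Longrightarrow> fst ` full S = S"
  using ws_ne by (force simp: full_def ch_def)

lemma full_PP: "S \<subseteq> {..<N} \<Longrightarrow> full S \<subseteq> PP"
  by (auto simp: full_def ch_def PP_def)

text \<open>The first factor has to take a whole chain: if it left a point of its chain over, the
  remaining factors would be fewer than the chains still to be covered.\<close>

lemma Cv_full:
  assumes F: "\<And>G. G \<in> set (F # Fs) \<Longrightarrow> prim G" and S: "S \<subseteq> {..<N}" "card S = Suc (length Fs)"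
  shows "Cv (F # Fs) (full S) = (\<Sum>a\<in>S. F (ch a) * Cv Fs (full (S - {a})))"
proof -
  have fS: "finite S" using S finite_subset by auto
  have ne: "ch a \<noteq> {}" if "a \<in> S" for a using ws_ne[of a] S that by (auto simp: ch_def)
  have zero: "F A * Cv Fs (full S - A) * Z.Om A (full S - A) = 0" if A: "A \<in> Pow (full S) - ch ` S" for A
  proof (cases "F A = 0")
    case False
    then obtain a where a: "A \<subseteq> {a} \<times> UNIV" "A \<noteq> {}" using F[of F] by (auto simp: prim_def)
    have aS: "a \<in> S" "A \<subseteq> ch a" using a A by (auto simp: full_def ch_def)
    have "A \<noteq> ch a" using aS(1) A by blast
    then obtain P where P: "P \<in> ch a" "P \<notin> A" using aS(2) by blast
    have sub: "S \<subseteq> fst ` (full S - A)"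
    proof
      fix b assume b: "b \<in> S"
      show "b \<in> fst ` (full S - A)"
      proof (cases "b = a")
        case True
        have "P \<in> full S - A" "fst P = b" using P b True by (auto simp: full_def ch_def)
        then show ?thesis by blast
      next
        case False
        obtain P where "P \<in> ch b" using ne[OF b] by auto
        then have "P \<in> full S - A" "fst P = b" using a b False by (auto simp: full_def ch_def)
        then show ?thesis by blast
      qed
    qed
    have fin: "finite (fst ` (full S - A))" using Z.sub_fin[OF full_PP[OF S(1)]] by simp
    have "length Fs < card (fst ` (full S - A))" using S(2) card_mono[OF fin sub] by linarith
    moreover have "full S - A \<subseteq> PP" using full_PP[OF S(1)] by auto
    ultimately have "Cv Fs (full S - A) = 0" using F by (intro Cv_few) auto
    then show ?thesis by simp
  qed simp
  have inj: "inj_on ch S" using ne by (intro inj_onI) (auto simp: ch_def times_eq_iff)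
  have "Cv (F # Fs) (full S) = (\<Sum>A\<in>Pow (full S). F A * Cv Fs (full S - A) * Z.Om A (full S - A))"
    using full_PP[OF S(1)] by (simp add: Cv_def Z.conv_def)
  also have "\<dots> = (\<Sum>A\<in>ch ` S. F A * Cv Fs (full S - A) * Z.Om A (full S - A))"
    using zero Z.sub_fin[OF full_PP[OF S(1)]]
    by (intro sum.mono_neutral_right) (auto simp: full_def)
  also have "\<dots> = (\<Sum>a\<in>S. F (ch a) * Cv Fs (full S - ch a) * Z.Om (ch a) (full S - ch a))"
    using inj by (simp add: sum.reindex)
  also have "\<dots> = (\<Sum>a\<in>S. F (ch a) * Cv Fs (full (S - {a})))"
  proof (rule sum.cong[OF refl])
    fix a assume a: "a \<in> S"
    have "full S - ch a = full (S - {a})" by (auto simp: full_def ch_def)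
    moreover have "Z.Om (ch a) (full S - ch a) = 1"
      by (intro prod.neutral ballI) (auto simp: om0_def full_def ch_def)
    ultimately show "F (ch a) * Cv Fs (full S - ch a) * Z.Om (ch a) (full S - ch a) = F (ch a) * Cv Fs (full (S - {a}))"
      by simp
  qed
  finally show ?thesis .
qed

text \<open>Within a chain, a particle with a neighbour on both sides can be neither the first nor the last one
  to be bracketed in.\<close>

definition iv :: "nat \<Rightarrow> nat \<Rightarrow> nat \<Rightarrow> (nat \<times> nat) set" where
  "iv a i j = {a} \<times> {i..j}"

lemma com_interval:
  assumes a: "a < N" and ij: "i < j" "j < length (ws a)"
  shows "Z.com (Z.sing \<phi>) G (iv a i j) =
    \<phi> (a, j) * G (iv a i (j - 1)) * (\<Prod>l\<in>{i..<j}. omw T (ws a) j l)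
    - \<phi> (a, i) * G (iv a (Suc i) j) * (\<Prod>l\<in>{i<..j}. omw T (ws a) l i)"
proof -
  let ?o = "omw T (ws a)"
  have sub: "iv a i j \<subseteq> PP" using a ij by (auto simp: iv_def PP_def)
  have z: "?o k (Suc k) = 0" if "Suc k \<le> j" for k
    using omw_succ[OF good[OF a], of k] that ij by simp
  have pr: "(\<Prod>P\<in>iv a i j - {(a, k)}. f P) = (\<Prod>l\<in>{i..j} - {k}. f (a, l))" for f :: "nat \<times> nat \<Rightarrow> real" and k
  proof -
    have "iv a i j - {(a, k)} = Pair a ` ({i..j} - {k})" by (auto simp: iv_def)
    then show ?thesis by (simp add: prod.reindex inj_on_def)
  qed
  have pz: "(\<Prod>l\<in>{i..j} - {k}. ?o l k) = 0" if "i < k" "k \<le> j" for k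
  proof (rule prod_zero)
    show "\<exists>l\<in>{i..j} - {k}. ?o l k = 0" using that z[of "k - 1"] by (intro bexI[of _ "k - 1"]) auto
  qed simp
  have pz': "(\<Prod>l\<in>{i..j} - {k}. ?o k l) = 0" if "i \<le> k" "k < j" for k
  proof (rule prod_zero)
    show "\<exists>l\<in>{i..j} - {k}. ?o k l = 0" using that z[of k] by (intro bexI[of _ "Suc k"]) auto
  qed simp
  let ?t = "\<lambda>k. \<phi> (a, k) * G (iv a i j - {(a, k)}) *
      ((\<Prod>l\<in>{i..j} - {k}. ?o k l) - (\<Prod>l\<in>{i..j} - {k}. ?o l k))"
  have "Z.com (Z.sing \<phi>) G (iv a i j) = (\<Sum>Q\<in>iv a i j. \<phi> Q * G (iv a i j - {Q}) *
      ((\<Prod>P\<in>iv a i j - {Q}. om0 Q P) - (\<Prod>P\<in>iv a i j - {Q}. om0 P Q)))"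
    by (rule Z.com_sing[OF sub])
  also have "\<dots> = (\<Sum>k\<in>{i..j}. ?t k)"
  proof -
    have "iv a i j = Pair a ` {i..j}" by (auto simp: iv_def)
    then have "sum f (iv a i j) = (\<Sum>k\<in>{i..j}. f (a, k))" for f :: "nat \<times> nat \<Rightarrow> real"
      by (simp add: sum.reindex inj_on_def)
    then show ?thesis
      by (simp only:) (intro sum.cong refl, simp only: pr om0_def fst_conv snd_conv simp_thms if_True)
  qed
  also have "\<dots> = (\<Sum>k\<in>{i, j}. ?t k)"
  proof (rule sum.mono_neutral_right[OF finite_atLeastAtMost])
    show "\<forall>k\<in>{i..j} - {i, j}. ?t k = 0"
    proof
      fix k assume "k \<in> {i..j} - {i, j}"
      then have "i < k" "k < j" by auto
      then show "?t k = 0" by (simp only: pz[OF _ less_imp_le] pz'[OF less_imp_le] diff_self mult_zero_right)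
    qed
  qed (use ij in simp)
  also have "\<dots> = ?t i + ?t j" using ij by simp
  also have "?t i = - (\<phi> (a, i) * G (iv a (Suc i) j) * (\<Prod>l\<in>{i<..j}. ?o l i))"
  proof -
    have e: "iv a i j - {(a, i)} = iv a (Suc i) j" "{i..j} - {i} = {i<..j}" using ij by (auto simp: iv_def)
    show ?thesis unfolding e pz'[OF order_refl ij(1), unfolded e] by simp
  qed
  also have "?t j = \<phi> (a, j) * G (iv a i (j - 1)) * (\<Prod>l\<in>{i..<j}. ?o j l)"
  proof -
    have e: "iv a i j - {(a, j)} = iv a i (j - 1)" "{i..j} - {j} = {i..<j}" using ij by (auto simp: iv_def)
    show ?thesis unfolding e pz[OF ij(1) order_refl, unfolded e] by simp
  qed
  finally show ?thesis by simp
qed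

lemma zgen_iv: "a < N \<Longrightarrow> k < length (ws a) \<Longrightarrow> zgen i (iv a k k) = (if ws a ! k = i then 1 else 0)"
proof -
  assume a: "a < N" "k < length (ws a)"
  have "iv a k k = {(a, k)}" by (auto simp: iv_def)
  moreover have "(a, k) \<in> PP" using a by (simp add: PP_def)
  ultimately show ?thesis by (simp add: zgen_def Z.sing_singleton) (simp add: col_def)
qed

lemma com_swap: "Z.com F G \<mu> = - Z.com G F \<mu>"
  by (simp add: Z.com_def)

text \<open>As the first letter does not recur, each new particle can be attached at the right end
  only. Up to sign the value is a product of twists of later against earlier points, which are
  nonzero.\<close>

lemma zroot_nonzero_nest:
  assumes a: "a < N" and w: "hd (ws a) \<notin> set (tl (ws a))"
  shows "foldl Z.com (zgen (hd (ws a))) (map zgen (tl (ws a))) (ch a) \<noteq> 0"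
proof -
  let ?w = "ws a"
  let ?G = "\<lambda>m. foldl Z.com (zgen (hd ?w)) (map zgen (take m (tl ?w)))"
  have ne: "?w \<noteq> []" using ws_ne[OF a] .
  have "?G m (iv a 0 m) \<noteq> 0" if "m < length ?w" for m
    using that
  proof (induction m)
    case 0
    then show ?case using zgen_iv[OF a, of 0 "hd ?w"] ne by (simp add: hd_conv_nth)
  next
    case (Suc m)
    have m: "m < length (tl ?w)" using Suc.prems by simp
    have tm: "tl ?w ! m = ?w ! Suc m" using m by (simp add: nth_tl)
    have step: "?G (Suc m) = Z.com (?G m) (zgen (?w ! Suc m))"
      using m tm by (simp add: take_Suc_conv_app_nth)
    have h0: "?w ! 0 \<noteq> ?w ! Suc m"
      using w m tm ne nth_mem[OF m] by (metis hd_conv_nth)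
    have "?G (Suc m) (iv a 0 (Suc m)) = - Z.com (zgen (?w ! Suc m)) (?G m) (iv a 0 (Suc m))"
      unfolding step by (rule com_swap)
    also have "Z.com (zgen (?w ! Suc m)) (?G m) (iv a 0 (Suc m)) =
        ?G m (iv a 0 m) * (\<Prod>l\<in>{0..<Suc m}. omw T ?w (Suc m) l)"
      unfolding zgen_def[of "?w ! Suc m"]
      using com_interval[OF a, of 0 "Suc m" "\<lambda>Q. if col Q = ?w ! Suc m then 1 else 0" "?G m"] Suc.prems h0
      by (simp add: col_def del: prod.op_ivl_Suc)
    finally have "?G (Suc m) (iv a 0 (Suc m)) =
        - (?G m (iv a 0 m) * (\<Prod>l\<in>{0..<Suc m}. omw T ?w (Suc m) l))" .
    moreover have "(\<Prod>l\<in>{0..<Suc m}. omw T ?w (Suc m) l) \<noteq> 0"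
      using omw_later[OF good[OF a]] Suc.prems by (simp add: prod_zero_iff del: prod.op_ivl_Suc)
    ultimately show ?case using Suc.IH Suc.prems by (simp del: prod.op_ivl_Suc)
  qed
  from this[of "length ?w - 1"] ne
  have "?G (length ?w - 1) (iv a 0 (length ?w - 1)) \<noteq> 0" by simp
  moreover have "iv a 0 (length ?w - 1) = ch a" using ne by (cases "length ?w") (auto simp: iv_def ch_def)
  ultimately show ?thesis by simp
qed

end

context chains
begin

lemma E_0: "E 0 f = E0 us f"
proof -
  have "om 0 = om0" by (simp add: om_def om0_def fun_eq_iff)
  moreover have "ph 0 = ph0 us" by (simp add: ph_def ph0_def pos_def fun_eq_iff)
  ultimately show ?thesis by simp
qed

end

section \<open>Words of chains\<close>

text \<open>The word \<open>[1, 2, 1, 2, 2]\<close> is not good: its two letters \<open>1\<close> sit at distance \<open>pc G2 1 1 = 3\<close>.\<close>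

definition cw :: "cartan_type \<Rightarrow> nat list \<Rightarrow> nat list" where
  "cw T \<beta> = (if T = G2 \<and> \<beta> = [1,2,1,2,2] then [1,2,2,1,2] else \<beta>)"

text \<open>One shape of word covers both kinds of roots. Before and after the turn at
  \<open>n\<close> the positions decrease, which settles pairs on the same side. For a pair on
  different sides the parity of \<open>k + l\<close> is fixed by whether the letters are equal or
  neighbours, and it rules out the bad distances.\<close>

lemma good_word_B:
  assumes i: "1 \<le> i" "i \<le> n" and len: "length w \<le> 2 * n + 1 - 2 * i"
    and nth: "\<And>k. k < length w \<Longrightarrow> w ! k = (if k \<le> n - i then i + k else 2 * n + 1 - i - k)"
  shows "good_word (B n) w"
proof -
  define pz :: "nat \<Rightarrow> nat \<Rightarrow> int" where
    "pz a b = (if a = b then (if a < n then 2 else 1) else if b = Suc a \<or> a = Suc b then - 1 else 0)" for a b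
  \<comment> \<open>Every step is -1 except that between the two letters \<open>n\<close>, which is
    \<open>pc (B n) n n = 1\<close>; hence the offset 2 after the turn.\<close>
  define tz :: "nat \<Rightarrow> int" where "tz k = (if k \<le> n - i then - int k else 2 - int k)" for k
  have pc: "pc (B n) a b = real_of_int (pz a b)" for a b
    by (auto simp: pc_def pz_def)
  have t: "tpos (B n) w k = real_of_int (tz k)" if "k < length w" for k
    using that
  proof (induction k)
    case 0
    then show ?case by (simp add: tpos_def tz_def)
  next
    case (Suc k)
    have l: "k < length w" "k < 2 * n - 2 * i" using Suc.prems len by linarith+
    consider "Suc k \<le> n - i" | "k = n - i" | "k > n - i" by linarith
    then have "pz (w ! k) (w ! Suc k) = tz (Suc k) - tz k"
    proof cases
      case 1
      then show ?thesis using nth[OF l(1)] nth[OF Suc.prems] by (simp add: pz_def tz_def)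
    next
      case 2
      have "w ! k = n" using nth[OF l(1)] 2 i by simp
      moreover have "w ! Suc k = n" using nth[OF Suc.prems] 2 i by simp
      ultimately show ?thesis using 2 by (simp add: pz_def tz_def)
    next
      case 3
      have "w ! k = Suc (w ! Suc k)" using nth[OF l(1)] nth[OF Suc.prems] 3 l(2) by simp
      then show ?thesis using 3 by (simp add: pz_def tz_def)
    qed
    then show ?case using Suc by (simp add: tpos_def pc)
  qed
  have "(w ! k = w ! l \<longrightarrow> tz k \<noteq> tz l) \<and> (pz (w ! k) (w ! l) \<noteq> 0 \<longrightarrow> tz l - tz k + pz (w ! k) (w ! l) \<noteq> 0)
      \<and> (l = Suc k \<longrightarrow> pz (w ! k) (w ! l) \<noteq> 0)" if kl: "l < length w" "k < l" for k l
  proof -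
    have k: "k < length w" using kl by simp
    have apart: ?thesis
      if ne: "w ! k \<noteq> w ! l" and lt: "tz l < tz k"
        and succ: "l = Suc k \<Longrightarrow> w ! l = Suc (w ! k) \<or> w ! k = Suc (w ! l)"
    proof -
      have "pz (w ! k) (w ! l) = 0 \<or> pz (w ! k) (w ! l) = - 1" using ne by (simp add: pz_def)
      moreover have "pz (w ! k) (w ! l) = - 1" if "l = Suc k" using succ[OF that] by (auto simp: pz_def)
      ultimately show ?thesis using ne lt by auto
    qed
    consider "l \<le> n - i" | "k > n - i" | "k \<le> n - i" "l > n - i" by linarith
    then show ?thesis
    proof cases
      case 3
      define x where "x = n - i"
      define q where "q = 2 * n + 1 - i - l"
      have x: "n = i + x" "q + l = 2 * x + 1 + i" "k \<le> x" "x < l"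
        using 3 i len kl by (auto simp: x_def q_def)
      have e: "w ! k = i + k" "w ! l = q" "tz k = - int k" "tz l = 2 - int l"
        using nth[OF k] nth[OF kl(1)] 3 by (auto simp: tz_def q_def)
      consider "q = i + k" | "q = Suc (i + k)" | "i + k = Suc q" | "pz (i + k) q = 0" "q \<noteq> i + k" "l \<noteq> Suc k"
      proof -
        have "pz (i + k) q = 0" if "q \<noteq> i + k" "q \<noteq> Suc (i + k)" "i + k \<noteq> Suc q"
          using that by (simp add: pz_def)
        moreover have "l = Suc k \<Longrightarrow> q = i + k" using x by linarith
        ultimately show thesis using that by blast
      qed
      then show ?thesis
      proof cases
        case 1
        then have s: "k + l = 2 * x + 1" using x by linarith
        then have ne: "int l \<noteq> int k + 2" "int l \<noteq> int k + 4" by presburger+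
        show ?thesis
        proof (cases "k = x")
          case True
          then have "l = Suc x" "pz (i + k) q = 1" using s x 1 by (auto simp: pz_def)
          then show ?thesis unfolding e using True by simp
        next
          case False
          then have "pz (i + k) q = 2" using x 1 by (auto simp: pz_def)
          then show ?thesis unfolding e using ne by simp
        qed
      next
        case 2
        then have "k + l = 2 * x" using x by linarith
        then have "int l \<noteq> int k + 1" by presburger
        moreover have "pz (i + k) q = - 1" using 2 by (simp add: pz_def)
        ultimately show ?thesis unfolding e using 2 by simp
      next
        case 3
        then have "k + l = 2 * x + 2" using x(2) by simp
        then have "int l \<noteq> int k + 1" by presburger
        moreover have "pz (i + k) q = - 1" using 3 by (simp add: pz_def)
        ultimately show ?thesis unfolding e using 3 by simp
      qed (simp add: e)
    next
      case 1
      then have "w ! k = i + k" "w ! l = i + l" "tz k = - int k" "tz l = - int l"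
        using nth[OF k] nth[OF kl(1)] kl(2) by (auto simp: tz_def)
      then show ?thesis using kl(2) by (intro apart) auto
    next
      case 2
      then have "w ! k = 2 * n + 1 - i - k" "w ! l = 2 * n + 1 - i - l" "tz k = 2 - int k" "tz l = 2 - int l"
        using nth[OF k] nth[OF kl(1)] kl(2) by (auto simp: tz_def)
      moreover have "l < 2 * n + 1 - i" using len kl(1) i by linarith
      ultimately show ?thesis using kl(2) by (intro apart) auto
    qed
  qed
  then show ?thesis
    unfolding good_word_def pc using t by (auto simp flip: of_int_diff of_int_add)
qed

lemma nth_rev_upt: "k < n - j \<Longrightarrow> rev [j..<n] ! k = n - 1 - k"
  by (simp add: rev_nth)

lemma good_words_G: "good_word G2 [1]" "good_word G2 [1,2]" "good_word G2 [1,2,2,1,2]"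
  "good_word G2 [1,2,2]" "good_word G2 [1,2,2,2]" "good_word G2 [2]"
proof -
  have t: "tpos T w 0 = 0" "tpos T w (Suc k) = tpos T w k + pc T (w ! k) (w ! Suc k)" for T w k
    by (simp_all add: tpos_def)
  have p: "pc G2 (Suc 0) (Suc 0) = 3" "pc G2 (Suc 0) 2 = - 3 / 2" "pc G2 2 (Suc 0) = - 3 / 2" "pc G2 2 2 = 1"
    by (simp_all add: pc_def)
  show "good_word G2 [1]" "good_word G2 [1,2]" "good_word G2 [1,2,2,1,2]"
    "good_word G2 [1,2,2]" "good_word G2 [1,2,2,2]" "good_word G2 [2]"
    by (simp_all add: good_word_def t p All_less_Suc)
qed

lemma good_cw:
  assumes "valid T" "\<beta> \<in> set (pos_roots T)"
  shows "good_word T (cw T \<beta>)"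
proof -
  consider "T = G2" | n where "n \<ge> 2" "T = B n" using assms by (auto simp: valid_def)
  then show ?thesis
  proof cases
    case 1
    then have "cw T \<beta> \<in> {[1], [1,2], [1,2,2,1,2], [1,2,2], [1,2,2,2], [2]}"
      using assms(2) by (auto simp: cw_def)
    then show ?thesis unfolding 1
      by (elim insertE emptyE) (simp_all only: good_words_G)
  next
    case 2
    have "cw T \<beta> = \<beta>" using 2 by (simp add: cw_def)
    moreover have "good_word (B n) \<beta>"
      using assms(2) unfolding 2(2) roots_B
    proof (elim disjE exE conjE)
      fix i j assume *: "1 \<le> i" "i \<le> j" "j \<le> n" "\<beta> = [i..<Suc j]"
      show ?thesis by (rule good_word_B[of i]) (use * in \<open>auto simp del: upt_Suc\<close>)
    next
      fix i j assume *: "1 \<le> i" "i < j" "j \<le> n" "\<beta> = [i..<Suc n] @ rev [j..<Suc n]"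
      show ?thesis
      proof (rule good_word_B[of i])
        fix k assume k: "k < length \<beta>"
        show "\<beta> ! k = (if k \<le> n - i then i + k else 2 * n + 1 - i - k)"
        proof (cases "k \<le> n - i")
          case True
          then have "k < Suc n - i" using *(2,3) by linarith
          then show ?thesis using * True by (simp add: nth_append del: upt_Suc)
        next
          case False
          then have "\<not> k < Suc n - i" using *(2,3) by linarith
          then have "\<beta> ! k = rev [j..<Suc n] ! (k - (Suc n - i))" using * by (simp add: nth_append del: upt_Suc)
          also have "\<dots> = Suc n - 1 - (k - (Suc n - i))"
            using k * False by (intro nth_rev_upt) (simp del: upt_Suc)
          finally show ?thesis using False * by simp
        qed
      qed (use * in \<open>auto simp del: upt_Suc\<close>)
    qed
    ultimately show ?thesis using 2 by simp
  qed
qed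

lemma mset_cw: "mset (cw T \<beta>) = mset \<beta>"
  by (auto simp: cw_def)

text \<open>In type B a repeated letter tells the two kinds of roots apart; the set of letters and
  the length then give the endpoints.\<close>

lemma roots_mset_inj:
  assumes "valid T" "\<beta> \<in> set (pos_roots T)" "\<gamma> \<in> set (pos_roots T)" "mset \<beta> = mset \<gamma>"
  shows "\<beta> = \<gamma>"
proof -
  consider "T = G2" | n where "n \<ge> 2" "T = B n" using assms by (auto simp: valid_def)
  then show ?thesis
  proof cases
    case 1
    have "length \<beta> = length \<gamma>" using assms(4) by (rule mset_eq_length)
    then show ?thesis using assms(2-4) 1 by auto
  next
    case 2
    have len: "length \<beta> = length \<gamma>" and set: "set \<beta> = set \<gamma>"
      using assms(4) mset_eq_length mset_eq_setD by blast+
    have card_f: "card (set ([i..<Suc n] @ rev [j..<Suc n])) < length ([i..<Suc n] @ rev [j..<Suc n])"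
      if "i < j" "j \<le> n" for i j
    proof -
      have "set ([i..<Suc n] @ rev [j..<Suc n]) = {i..<Suc n}" using that by auto
      then show ?thesis using that by (simp del: upt_Suc)
    qed
    have card_e: "card (set [i..<Suc j]) = length [i..<Suc j]" for i j :: nat by (simp del: upt_Suc)
    from assms(2,3)[unfolded 2(2) roots_B] show ?thesis
    proof (elim disjE exE conjE)
      fix i j i' j' assume *: "1 \<le> i" "i \<le> j" "j \<le> n" "\<beta> = [i..<Suc j]" "1 \<le> i'" "i' \<le> j'" "j' \<le> n" "\<gamma> = [i'..<Suc j']"
      have "{i..<Suc j} = {i'..<Suc j'}" using set * by (simp del: upt_Suc)
      then show ?thesis using * by (simp add: atLeastLessThan_eq_iff)
    next
      fix i j i' j' assume *: "\<beta> = [i..<Suc j]" "i' < j'" "j' \<le> n" "\<gamma> = [i'..<Suc n] @ rev [j'..<Suc n]"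
      have "card (set \<beta>) = length \<beta>" "card (set \<gamma>) < length \<gamma>"
        unfolding *(1,4) by (rule card_e, rule card_f[OF *(2,3)])
      then show ?thesis using len set by simp
    next
      fix i j i' j' assume *: "\<gamma> = [i'..<Suc j']" "i < j" "j \<le> n" "\<beta> = [i..<Suc n] @ rev [j..<Suc n]"
      have "card (set \<gamma>) = length \<gamma>" "card (set \<beta>) < length \<beta>"
        unfolding *(1,4) by (rule card_e, rule card_f[OF *(2,3)])
      then show ?thesis using len set by simp
    next
      fix i j i' j' assume *: "1 \<le> i" "i < j" "j \<le> n" "\<beta> = [i..<Suc n] @ rev [j..<Suc n]"
        "1 \<le> i'" "i' < j'" "j' \<le> n" "\<gamma> = [i'..<Suc n] @ rev [j'..<Suc n]"
      have "set \<beta> = {i..<Suc n}" "set \<gamma> = {i'..<Suc n}" using * by auto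
      then have i: "i = i'" using set * by (auto simp: atLeastLessThan_eq_iff)
      then have "j = j'" using len * by (simp del: upt_Suc)
      then show ?thesis using i * by simp
    qed
  qed
qed

lemma digits_unique:
  fixes d d' :: "nat \<Rightarrow> nat"
  assumes "finite S" "\<And>a. a \<in> S \<Longrightarrow> d a < D" "\<And>a. a \<in> S \<Longrightarrow> d' a < D"
    and "(\<Sum>a\<in>S. d a * D ^ a) = (\<Sum>a\<in>S. d' a * D ^ a)" and "a \<in> S"
  shows "d a = d' a"
proof -
  have all: "\<forall>a<m. e a = e' a"
    if "\<And>a. e a < D" "\<And>a. e' a < D" "(\<Sum>a<m. e a * D ^ a) = (\<Sum>a<m. e' a * D ^ a)" for m and e e' :: "nat \<Rightarrow> nat"
    using that
  proof (induction m arbitrary: e e')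
    case (Suc m)
    have sh: "(\<Sum>a<Suc m. e a * D ^ a) = e 0 + D * (\<Sum>a<m. e (Suc a) * D ^ a)" for e :: "nat \<Rightarrow> nat"
      by (simp only: sum.lessThan_Suc_shift sum_distrib_left) (simp add: ac_simps)
    have eq: "e 0 + D * (\<Sum>a<m. e (Suc a) * D ^ a) = e' 0 + D * (\<Sum>a<m. e' (Suc a) * D ^ a)"
      using Suc.prems(3) unfolding sh .
    have "(e 0 + D * X) mod D = e 0" "(e' 0 + D * X) mod D = e' 0" for X
      using Suc.prems(1,2) by simp_all
    then have 0: "e 0 = e' 0" using eq by metis
    have "D > 0" using Suc.prems(1)[of 0] by linarith
    then have "(\<Sum>a<m. e (Suc a) * D ^ a) = (\<Sum>a<m. e' (Suc a) * D ^ a)" using eq 0 by simp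
    then have "\<forall>a<m. e (Suc a) = e' (Suc a)" using Suc.IH[of "\<lambda>a. e (Suc a)" "\<lambda>a. e' (Suc a)"] Suc.prems by blast
    then show ?case using 0 less_Suc_eq_0_disj by auto
  qed simp
  obtain m where m: "S \<subseteq> {..<m}" using assms(1) finite_nat_iff_bounded by blast
  have D: "0 < D" using assms(2,5) by (metis gr0I less_nat_zero_code)
  have "(\<Sum>a<m. (if a \<in> S then f a else 0) * D ^ a) = (\<Sum>a\<in>S. f a * D ^ a)" for f
    using m by (intro sum.mono_neutral_cong_right) auto
  then have "\<forall>a<m. (if a \<in> S then d a else 0) = (if a \<in> S then d' a else 0)"
    using assms D by (intro all) auto
  then show ?thesis using assms(5) m by auto
qed

section \<open>Values of root vectors and monomials on chains\<close>

context chains0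
begin

lemma conv_diff: "Z.conv (\<lambda>\<mu>. F \<mu> - F' \<mu>) G = (\<lambda>\<mu>. Z.conv F G \<mu> - Z.conv F' G \<mu>)"
  "Z.conv G (\<lambda>\<mu>. F \<mu> - F' \<mu>) = (\<lambda>\<mu>. Z.conv G F \<mu> - Z.conv G F' \<mu>)"
  using Z.conv_add_left[of F "\<lambda>\<mu>. (-1) * F' \<mu>" G] Z.conv_add_right[of G F "\<lambda>\<mu>. (-1) * F' \<mu>"]
  by (simp_all only: Z.conv_scale) simp_all

lemma com_jacobi: "Z.com (Z.com F G) H \<mu> = Z.com F (Z.com G H) \<mu> - Z.com G (Z.com F H) \<mu>"
proof -
  have c: "Z.com F G = (\<lambda>\<mu>. Z.conv F G \<mu> - Z.conv G F \<mu>)" for F G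
    by (simp add: Z.com_def fun_eq_iff)
  show ?thesis unfolding c conv_diff Z.conv_assoc by simp
qed

text \<open>The letter 1 recurs, so both ends of an interval contribute and the value is computed.
  Jacobi, \<open>[[1, 2], g] = [1, [2, g]] - [2, [1, g]]\<close>, leaves only brackets with single
  letters, to which \<open>com_interval\<close> applies.\<close>

lemma zroot_nonzero_theta:
  assumes T: "T = G2" and a: "a < N" and w: "ws a = [1,2,2,1,2]"
  shows "Z.com (Z.com (zgen 1) (zgen 2)) (Z.com (Z.com (zgen 1) (zgen 2)) (zgen 2)) (ch a) \<noteq> 0"
proof -
  let ?w = "[1,2,2,1,2] :: nat list"
  \<comment> \<open>The points sit at 0, -3/2, -1/2, -2, -7/2; the entries other than 1 come from
    equal letters.\<close>
  have o: "omw G2 ?w 1 0 = 1" "omw G2 ?w 2 0 = 1" "omw G2 ?w 3 0 = - 1 / 2" "omw G2 ?w 4 0 = 1"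
    "omw G2 ?w 2 1 = 2" "omw G2 ?w 3 1 = 1" "omw G2 ?w 4 1 = 1 / 2"
    "omw G2 ?w 3 2 = 1" "omw G2 ?w 4 2 = 2 / 3" "omw G2 ?w 4 3 = 1"
    by (simp_all add: omw_def tpos_def pc_def lessThan_Suc numeral_eq_Suc)
  have I: "Z.com (zgen c) G (iv a i j) =
      (if ?w ! j = c then G (iv a i (j - 1)) * (\<Prod>l\<in>{i..<j}. omw G2 ?w j l) else 0)
      - (if ?w ! i = c then G (iv a (Suc i) j) * (\<Prod>l\<in>{i<..j}. omw G2 ?w l i) else 0)"
    if "i < j" "j < 5" for c G i j
    using com_interval[OF a, of i j "\<lambda>Q. if col Q = c then 1 else 0" G] that w T
    by (simp add: zgen_def col_def)
  have n: "?w ! 0 = 1" "?w ! 1 = 2" "?w ! 2 = 2" "?w ! 3 = 1" "?w ! 4 = 2" by simp_all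
  have z: "zgen c (iv a k k) = (if ?w ! k = c then 1 else 0)" if "k < 5" for c k
    using zgen_iv[OF a, of k c] that w by simp
  have sets: "{0..<1::nat} = {0}" "{1..<2::nat} = {1}" "{2..<3::nat} = {2}" "{3..<4::nat} = {3}"
    "{0<..1::nat} = {1}" "{1<..2::nat} = {2}" "{2<..3::nat} = {3}" "{3<..4::nat} = {4}"
    "{0..<2::nat} = {0,1}" "{1..<3::nat} = {1,2}" "{2..<4::nat} = {2,3}"
    "{0<..2::nat} = {1,2}" "{1<..3::nat} = {2,3}" "{2<..4::nat} = {3,4}"
    "{0..<3::nat} = {0,1,2}" "{1..<4::nat} = {1,2,3}" "{0<..3::nat} = {1,2,3}" "{1<..4::nat} = {2,3,4}"
    "{0..<4::nat} = {0,1,2,3}" "{0<..4::nat} = {1,2,3,4}"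
    by auto
  let ?f = "Z.com (zgen 1) (zgen 2)"
  let ?g = "Z.com ?f (zgen 2)"
  have f: "?f (iv a 0 1) = - 1" "?f (iv a 1 2) = 0" "?f (iv a 2 3) = 1" "?f (iv a 3 4) = - 1"
    using I[of 0 1 1 "zgen 2"] I[of 1 2 1 "zgen 2"] I[of 2 3 1 "zgen 2"] I[of 3 4 1 "zgen 2"]
      z[of 0 2] z[of 1 2] z[of 2 2] z[of 3 2] z[of 4 2]
    by (simp_all add: n sets o One_nat_def[symmetric] del: One_nat_def)
  have g: "?g (iv a 0 2) = 2" "?g (iv a 1 3) = 2" "?g (iv a 2 4) = - 4 / 3"
    using I[of 0 2 2 ?f] I[of 1 3 2 ?f] I[of 2 4 2 ?f] f
      com_swap[of ?f "zgen 2" "iv a 0 2"] com_swap[of ?f "zgen 2" "iv a 1 3"] com_swap[of ?f "zgen 2" "iv a 2 4"]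
    by (simp_all add: n sets o One_nat_def[symmetric] del: One_nat_def)
  let ?p = "Z.com (zgen 2) ?g" and ?q = "Z.com (zgen 1) ?g"
  have p: "?p (iv a 1 4) = 2" and q: "?q (iv a 0 3) = 0"
    using I[of 1 4 2 ?g] I[of 0 3 1 ?g] g by (simp_all add: n sets o One_nat_def[symmetric] del: One_nat_def)
  have "Z.com (zgen 1) ?p (iv a 0 4) = 1" "Z.com (zgen 2) ?q (iv a 0 4) = 0"
    using I[of 0 4 1 ?p] I[of 0 4 2 ?q] p q by (simp_all add: n sets o One_nat_def[symmetric] del: One_nat_def)
  then have "Z.com ?f ?g (iv a 0 4) \<noteq> 0" unfolding com_jacobi[of "zgen 1" "zgen 2" ?g] by simp
  moreover have "iv a 0 4 = ch a" using w by (auto simp: iv_def ch_def)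
  ultimately show ?thesis by simp
qed

lemma zroot_nonzero:
  assumes "valid T" "\<beta> \<in> set (pos_roots T)" "a < N" "ws a = cw T \<beta>"
  shows "zroot \<beta> (ch a) \<noteq> 0"
proof (cases "T = G2 \<and> \<beta> = [1,2,1,2,2]")
  case True
  then have "ws a = [1,2,2,1,2]" using assms(4) by (simp add: cw_def)
  then show ?thesis unfolding zroot_def if_P[OF True] using True assms(3) by (intro zroot_nonzero_theta) auto
next
  case False
  then have w: "ws a = \<beta>" using assms(4) by (auto simp: cw_def)
  consider "T = G2" | n where "n \<ge> 2" "T = B n" using assms by (auto simp: valid_def)
  then have "hd \<beta> \<notin> set (tl \<beta>)"
  proof cases
    case 1
    then show ?thesis using assms(2) False by auto
  next
    case 2
    have "hd ([i..<Suc j] @ xs) \<notin> set (tl ([i..<Suc j] @ xs))" if "i \<le> j" "i \<notin> set xs" for i j xs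
      using that by (simp add: upt_conv_Cons del: upt_Suc)
    from this[of _ _ "[]"] this show ?thesis
      using assms(2) unfolding 2(2) roots_B by (elim disjE exE conjE) (auto simp del: upt_Suc)
  qed
  then show ?thesis
    using zroot_nonzero_nest[OF assms(3)] w unfolding zroot_def if_not_P[OF False] by simp
qed

text \<open>A nested commutator of letters is supported on sets with exactly these colours, and the
  colours of the full chain spell its word.\<close>

lemma zroot_content:
  assumes \<delta>: "decomposition T \<delta>" and \<beta>: "\<beta> \<in> set (pos_roots T)" and nz: "zroot \<beta> (ch a) \<noteq> 0"
  shows "mset \<beta> = mset (ws a)"
proof -
  have ok: "ok (\<lambda>_. 1) 0 (mset \<beta>) (rvec T \<delta> (\<beta>, 0)) (zroot \<beta>)" by (rule ok_rvec[OF \<delta> \<beta>])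
  have "ch a \<subseteq> {a} \<times> UNIV" by (auto simp: ch_def)
  moreover have "scaled (\<lambda>_. 1) 0 (E0 (\<lambda>_. 1) (rvec T \<delta> (\<beta>, 0))) (zroot \<beta>)" using ok by (simp add: ok_def)
  ultimately have "E0 (\<lambda>_. 1) (rvec T \<delta> (\<beta>, 0)) (ch a) = 1 ^ 0 * zroot \<beta> (ch a)"
    unfolding scaled_def by blast
  then have "E0 (\<lambda>_. 1) (rvec T \<delta> (\<beta>, 0)) (ch a) \<noteq> 0" using nz by simp
  then have "image_mset col (mset_set (ch a)) = mset \<beta>" using ok by (auto simp: ok_def supp_def)
  moreover have "mset_set (ch a) = image_mset (Pair a) (mset_set {..<length (ws a)})"
  proof -
    have "ch a = Pair a ` {..<length (ws a)}" by (auto simp: ch_def)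
    then show ?thesis by (simp add: image_mset_mset_set inj_on_def)
  qed
  moreover have "image_mset ((!) (ws a)) (mset_set {..<length (ws a)}) = mset (ws a)"
    by (metis atLeast0LessThan map_nth mset_map mset_upt)
  ultimately show ?thesis by (simp add: multiset.map_comp comp_def col_def)
qed

text \<open>The value of a monomial on all chains as a polynomial in \<tau>, summed over the ways to
  give one chain to each factor. A factor of degree \<open>s\<close> on chain \<open>a\<close>,
  which sits at \<open>\<tau>^(D^a)\<close>, adds \<open>s * D^a\<close> to the exponent.\<close>

primrec PV :: "nat \<Rightarrow> (nat list \<times> nat) list \<Rightarrow> nat set \<Rightarrow> real poly" where
  "PV D [] S = 1"
| "PV D (p # ps) S =
    (\<Sum>a\<in>S. Polynomial.monom (zroot (fst p) (ch a)) (snd p * D ^ a) * PV D ps (S - {a}))"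

primrec KV :: "(nat \<Rightarrow> nat) \<Rightarrow> (nat list \<times> nat) list \<Rightarrow> nat set \<Rightarrow> real" where
  "KV d [] S = 1"
| "KV d (p # ps) S = (\<Sum>a\<in>S. (if snd p = d a then zroot (fst p) (ch a) else 0) * KV d ps (S - {a}))"

lemma E0_prim: "decomposition T \<delta> \<Longrightarrow> p \<in> set (pos_roots T) \<times> UNIV \<Longrightarrow> prim (E0 u (rvec T \<delta> p))"
  using ok_rvec[of \<delta> "fst p" u "snd p"] by (auto simp: ok_def)

lemma Cv_PV:
  assumes "decomposition T \<delta>" "set ps \<subseteq> set (pos_roots T) \<times> UNIV" "S \<subseteq> {..<N}" "card S = length ps"
  shows "Cv (map (\<lambda>p. E0 (\<lambda>a. \<tau> ^ (D ^ a)) (rvec T \<delta> p)) ps) (full S) = poly (PV D ps S) \<tau>"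
  using assms(2-)
proof (induction ps arbitrary: S)
  case Nil
  then have "S = {}" using finite_subset by fastforce
  then show ?case by (simp add: Cv_def full_def Z.one_fn_def)
next
  case (Cons p ps)
  let ?F = "\<lambda>p. E0 (\<lambda>a. \<tau> ^ (D ^ a)) (rvec T \<delta> p)"
  have "finite S" using Cons.prems(2) finite_subset by auto
  have "Cv (map ?F (p # ps)) (full S) = (\<Sum>a\<in>S. ?F p (ch a) * Cv (map ?F ps) (full (S - {a})))"
    unfolding list.map
    by (rule Cv_full) (use Cons.prems E0_prim[OF assms(1)] in \<open>auto simp del: Z.Phi_def\<close>)
  also have "\<dots> = (\<Sum>a\<in>S. poly (Polynomial.monom (zroot (fst p) (ch a)) (snd p * D ^ a) * PV D ps (S - {a})) \<tau>)"
  proof (rule sum.cong[OF refl])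
    fix a assume a: "a \<in> S"
    have "ch a \<subseteq> {a} \<times> UNIV" by (auto simp: ch_def)
    then have "?F p (ch a) = (\<tau> ^ (D ^ a)) ^ snd p * zroot (fst p) (ch a)"
      using ok_rvec[OF assms(1), of "fst p" "\<lambda>a. \<tau> ^ (D ^ a)" "snd p"] Cons.prems(1)
      by (auto simp: ok_def scaled_def)
    also have "(\<tau> ^ (D ^ a)) ^ snd p = \<tau> ^ (snd p * D ^ a)" by (simp add: power_mult mult.commute flip: power_mult)
    finally have 1: "?F p (ch a) = poly (Polynomial.monom (zroot (fst p) (ch a)) (snd p * D ^ a)) \<tau>"
      by (simp add: poly_monom)
    have "card (S - {a}) = length ps" using Cons.prems(3) a \<open>finite S\<close> by simp
    then have "Cv (map ?F ps) (full (S - {a})) = poly (PV D ps (S - {a})) \<tau>"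
      using Cons.prems by (intro Cons.IH) auto
    then show "?F p (ch a) * Cv (map ?F ps) (full (S - {a})) =
        poly (Polynomial.monom (zroot (fst p) (ch a)) (snd p * D ^ a) * PV D ps (S - {a})) \<tau>"
      unfolding 1 poly_mult by simp
  qed
  finally show ?case by (simp add: poly_sum)
qed

lemma PV_support:
  assumes "Polynomial.coeff (PV D ps S) m \<noteq> 0" "finite S" "card S = length ps" "\<And>p. p \<in> set ps \<Longrightarrow> snd p < D"
  shows "\<exists>d. (\<forall>a\<in>S. d a < D) \<and> m = (\<Sum>a\<in>S. d a * D ^ a)"
  using assms
proof (induction ps arbitrary: S m)
  case Nil
  then have "S = {}" "m = 0" by (auto split: if_splits)
  then show ?case by simp
next
  case (Cons p ps)
  obtain a where a: "a \<in> S"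
    "Polynomial.coeff (Polynomial.monom (zroot (fst p) (ch a)) (snd p * D ^ a) * PV D ps (S - {a})) m \<noteq> 0"
    using Cons.prems(1) by (auto simp: coeff_sum elim: sum.not_neutral_contains_not_neutral)
  then have m: "snd p * D ^ a \<le> m" "Polynomial.coeff (PV D ps (S - {a})) (m - snd p * D ^ a) \<noteq> 0"
    by (auto simp: coeff_monom_mult split: if_splits)
  obtain d where d: "\<forall>b\<in>S - {a}. d b < D" "m - snd p * D ^ a = (\<Sum>b\<in>S - {a}. d b * D ^ b)"
    using Cons.IH[OF m(2)] Cons.prems a by auto
  have "(\<Sum>b\<in>S. (d(a := snd p)) b * D ^ b) = snd p * D ^ a + (\<Sum>b\<in>S - {a}. d b * D ^ b)"
    using Cons.prems(2) a(1) by (simp add: sum.remove)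
  then show ?case
    using d m(1) Cons.prems(4) by (intro exI[of _ "d(a := snd p)"]) auto
qed

text \<open>All degrees are below \<open>D\<close>, so the exponents add without carry and determine
  the degree that each chain receives; \<open>KV\<close> collects the assignments with the degrees
  \<open>d\<close>.\<close>

lemma PV_coeff:
  assumes "finite S" "card S = length ps" "\<And>p. p \<in> set ps \<Longrightarrow> snd p < D" "\<And>a. a \<in> S \<Longrightarrow> d a < D"
  shows "Polynomial.coeff (PV D ps S) (\<Sum>a\<in>S. d a * D ^ a) = KV d ps S"
  using assms
proof (induction ps arbitrary: S)
  case Nil
  then show ?case by simp
next
  case (Cons p ps)
  let ?m = "\<Sum>a\<in>S. d a * D ^ a"
  have "Polynomial.coeff (Polynomial.monom (zroot (fst p) (ch a)) (snd p * D ^ a) * PV D ps (S - {a})) ?m =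
      (if snd p = d a then zroot (fst p) (ch a) else 0) * KV d ps (S - {a})" if a: "a \<in> S" for a
  proof -
    have m: "?m = d a * D ^ a + (\<Sum>b\<in>S - {a}. d b * D ^ b)" using Cons.prems(1) a by (rule sum.remove)
    have c: "card (S - {a}) = length ps" using Cons.prems a by simp
    show ?thesis
    proof (cases "snd p = d a")
      case True
      have "Polynomial.coeff (PV D ps (S - {a})) (\<Sum>b\<in>S - {a}. d b * D ^ b) = KV d ps (S - {a})"
        using Cons.prems c by (intro Cons.IH) auto
      then show ?thesis using True m by (simp add: coeff_monom_mult)
    next
      case False
      have "Polynomial.coeff (PV D ps (S - {a})) (?m - snd p * D ^ a) = 0" if le: "snd p * D ^ a \<le> ?m"
      proof (rule ccontr)
        assume "Polynomial.coeff (PV D ps (S - {a})) (?m - snd p * D ^ a) \<noteq> 0"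
        from PV_support[OF this _ c] Cons.prems(1,3)
        obtain d' where d': "\<forall>b\<in>S - {a}. d' b < D" "?m - snd p * D ^ a = (\<Sum>b\<in>S - {a}. d' b * D ^ b)"
          by auto
        have "(\<Sum>b\<in>S. (d'(a := snd p)) b * D ^ b) = snd p * D ^ a + (\<Sum>b\<in>S - {a}. d' b * D ^ b)"
          using Cons.prems(1) a by (simp add: sum.remove)
        then have "?m = (\<Sum>b\<in>S. (d'(a := snd p)) b * D ^ b)" using d'(2) le by linarith
        then have "d a = (d'(a := snd p)) a"
          using d'(1) Cons.prems a by (intro digits_unique[of S d D "d'(a := snd p)"]) auto
        then show False using False by simp
      qed
      then show ?thesis using False by (auto simp: coeff_monom_mult)
    qed
  qed
  then show ?case by (simp add: coeff_sum)
qed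

text \<open>A nonvanishing term assigns the factors bijectively to the chains, each with the root
  and the degree prescribed there.\<close>

lemma KV_mset:
  assumes "KV d ps S \<noteq> 0" "finite S" "card S = length ps"
    and "\<And>p a. p \<in> set ps \<Longrightarrow> a \<in> S \<Longrightarrow> zroot (fst p) (ch a) \<noteq> 0 \<Longrightarrow> fst p = \<beta>s a"
  shows "mset ps = image_mset (\<lambda>a. (\<beta>s a, d a)) (mset_set S)"
  using assms
proof (induction ps arbitrary: S)
  case (Cons p ps)
  obtain a where a: "a \<in> S" "(if snd p = d a then zroot (fst p) (ch a) else 0) * KV d ps (S - {a}) \<noteq> 0"
    using Cons.prems(1) by (auto elim: sum.not_neutral_contains_not_neutral)
  then have s: "snd p = d a" "zroot (fst p) (ch a) \<noteq> 0" "KV d ps (S - {a}) \<noteq> 0" by (auto split: if_splits)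
  have "mset ps = image_mset (\<lambda>a. (\<beta>s a, d a)) (mset_set (S - {a}))"
    using Cons.prems a(1) by (intro Cons.IH s(3)) auto
  moreover have "p = (\<beta>s a, d a)" using s Cons.prems(4)[of p a] a(1) by (cases p) auto
  moreover have "mset_set S = add_mset a (mset_set (S - {a}))" using Cons.prems(2) a(1) by (simp add: mset_set.remove)
  ultimately show ?case by simp
qed simp

text \<open>Every admissible assignment contributes the same product, so nothing can cancel;
  \<open>m\<close> counts these assignments.\<close>

lemma KV_value:
  assumes "mset ps = image_mset (\<lambda>a. (\<beta>s a, d a)) (mset_set S)" "finite S"
    and "\<And>p a. p \<in> set ps \<Longrightarrow> a \<in> S \<Longrightarrow> zroot (fst p) (ch a) \<noteq> 0 \<Longrightarrow> fst p = \<beta>s a"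
  shows "\<exists>m>0. KV d ps S = real m * (\<Prod>a\<in>S. zroot (\<beta>s a) (ch a))"
  using assms
proof (induction ps arbitrary: S)
  case Nil
  then have "S = {}" by (simp add: mset_set_empty_iff)
  then show ?case by (intro exI[of _ 1]) simp
next
  case (Cons p ps)
  let ?A = "{a \<in> S. (\<beta>s a, d a) = p}"
  have "\<exists>m>0. KV d ps (S - {a}) = real m * (\<Prod>b\<in>S - {a}. zroot (\<beta>s b) (ch b))" if a: "a \<in> ?A" for a
  proof (rule Cons.IH)
    have "mset_set S = add_mset a (mset_set (S - {a}))" using Cons.prems(2) a by (simp add: mset_set.remove)
    then show "mset ps = image_mset (\<lambda>a. (\<beta>s a, d a)) (mset_set (S - {a}))"
      using Cons.prems(1) a by simp
  qed (use Cons.prems in auto)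
  then have "\<forall>a\<in>?A. \<exists>m. 0 < m \<and> KV d ps (S - {a}) = real m * (\<Prod>b\<in>S - {a}. zroot (\<beta>s b) (ch b))"
    by (intro ballI)
  from bchoice[OF this] obtain m where m: "\<forall>a\<in>?A. 0 < m a \<and>
      KV d ps (S - {a}) = real (m a) * (\<Prod>b\<in>S - {a}. zroot (\<beta>s b) (ch b))" ..
  have "KV d (p # ps) S = (\<Sum>a\<in>S. if a \<in> ?A then real (m a) * (\<Prod>a\<in>S. zroot (\<beta>s a) (ch a)) else 0)"
    unfolding KV.simps
  proof (rule sum.cong[OF refl])
    fix a assume a: "a \<in> S"
    show "(if snd p = d a then zroot (fst p) (ch a) else 0) * KV d ps (S - {a}) =
        (if a \<in> ?A then real (m a) * (\<Prod>a\<in>S. zroot (\<beta>s a) (ch a)) else 0)"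
    proof (cases "a \<in> ?A")
      case True
      then have "(\<Prod>a\<in>S. zroot (\<beta>s a) (ch a)) = zroot (fst p) (ch a) * (\<Prod>b\<in>S - {a}. zroot (\<beta>s b) (ch b))"
        using Cons.prems(2) by (auto simp: prod.remove)
      then show ?thesis using True bspec[OF m True] by auto
    next
      case False
      then show ?thesis using Cons.prems(3)[of p a] a by (cases p) auto
    qed
  qed
  also have "\<dots> = real (\<Sum>a\<in>?A. m a) * (\<Prod>a\<in>S. zroot (\<beta>s a) (ch a))"
    using Cons.prems(2) by (simp add: sum.If_cases sum_distrib_right Int_def)
  finally have "KV d (p # ps) S = real (\<Sum>a\<in>?A. m a) * (\<Prod>a\<in>S. zroot (\<beta>s a) (ch a))" .
  moreover have "?A \<noteq> {}"
  proof -
    have "p \<in># image_mset (\<lambda>a. (\<beta>s a, d a)) (mset_set S)" using Cons.prems(1) by (metis list.set_intros(1) set_mset_mset)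
    then show ?thesis using Cons.prems(2) by auto
  qed
  then have "(\<Sum>a\<in>?A. m a) > 0" using Cons.prems(2) m by (intro sum_pos) auto
  ultimately show ?case by blast
qed

end

section \<open>Linear independence\<close>

lemma monomials_independent:
  assumes T: "valid T" and \<delta>: "decomposition T \<delta>" and S: "finite S" "S \<subseteq> exponents T"
    and ideal: "(\<Sum>h\<in>S. scal (c h) * bmono T \<delta> (expand T h)) \<in> yangian_ideal T"
  shows "\<forall>h\<in>S. c h = 0"
proof (rule ccontr)
  assume "\<not> (\<forall>h\<in>S. c h = 0)"
  then obtain h1 where h1: "h1 \<in> S" "c h1 \<noteq> 0" by blast
  let ?l = "\<lambda>h. length (expand T h)"
  \<comment> \<open>The power of \<open>hbar\<close> in \<open>bmono\<close> joins the coefficient,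
    so that orders in \<open>hbar\<close> can be compared across monomials of different
    lengths.\<close>
  define C where "C h = c h * hbar ^ ?l h" for h
  have "(\<Sum>h\<in>S. scal (C h) * root_mono T \<delta> (expand T h)) \<in> yangian_ideal T"
    using ideal by (simp only: C_def bmono_def scal_mult mult.assoc)
  note ideal' = this
  have "hbar \<noteq> 0" by (simp add: hbar_def)
  then have "C h1 \<noteq> 0" using h1 by (simp add: C_def)
  then have "Polynomial.coeff (C h1) (Polynomial.degree (C h1)) \<noteq> 0" by (simp add: leading_coeff_0_iff)
  then have ex_k: "\<exists>k. \<exists>h\<in>S. Polynomial.coeff (C h) k \<noteq> 0" using h1(1) by blast
  define k where "k = (LEAST k. \<exists>h\<in>S. Polynomial.coeff (C h) k \<noteq> 0)"
  have ex: "\<exists>h\<in>S. Polynomial.coeff (C h) k \<noteq> 0"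
    unfolding k_def by (rule LeastI_ex[OF ex_k])
  have low: "Polynomial.coeff (C h) l = 0" if "h \<in> S" "l < k" for h l
    using not_less_Least[of l "\<lambda>k. \<exists>h\<in>S. Polynomial.coeff (C h) k \<noteq> 0"] that unfolding k_def by blast
  define b where "b h = (of_rat (Polynomial.coeff (C h) k) :: real)" for h
  \<comment> \<open>Among the terms of lowest order only the longest can fill \<open>N\<close>
    chains; one of them, \<open>h0\<close>, supplies the chains.\<close>
  define N where "N = Max (?l ` {h \<in> S. b h \<noteq> 0})"
  have fin: "finite (?l ` {h \<in> S. b h \<noteq> 0})" and ne: "?l ` {h \<in> S. b h \<noteq> 0} \<noteq> {}"
    using S(1) ex by (auto simp: b_def)
  obtain h0 where h0: "h0 \<in> S" "b h0 \<noteq> 0" "?l h0 = N"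
  proof -
    have "N \<in> ?l ` {h \<in> S. b h \<noteq> 0}" unfolding N_def by (rule Max_in[OF fin ne])
    then show thesis using that by (elim imageE CollectE conjE) metis
  qed
  have maxN: "?l h \<le> N" if "h \<in> S" "b h \<noteq> 0" for h
    unfolding N_def using fin that by (intro Max_ge) auto
  define L where "L = expand T h0"
  have setex: "set (expand T h) \<subseteq> set (pos_roots T) \<times> UNIV" if "h \<in> S" for h
    using set_expand[of h T] that S(2) by blast
  define \<beta>s where "\<beta>s a = fst (L ! a)" for a
  define d where "d a = snd (L ! a)" for a
  define ws where "ws a = cw T (\<beta>s a)" for a
  have LN: "length L = N" using h0(3) by (simp add: L_def)
  have \<beta>r: "\<beta>s a \<in> set (pos_roots T)" if "a < N" for a
  proof -
    have "L ! a \<in> set L" using that LN by simp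
    then show ?thesis using setex[OF h0(1)] unfolding L_def[symmetric] \<beta>s_def by auto
  qed
  interpret chains0 T N ws
  proof
    show "good_word T (ws a)" if "a < N" for a unfolding ws_def by (rule good_cw[OF T \<beta>r[OF that]])
    show "ws a \<noteq> []" if "a < N" for a
      using pos_roots_ne[OF \<beta>r[OF that]] mset_cw[of T "\<beta>s a"] unfolding ws_def by auto
  qed
  \<comment> \<open>One \<open>Suc\<close> makes the bound on the degrees strict; the other gives
    \<open>D \<ge> 2\<close>, so that the powers \<open>D^a\<close> differ.\<close>
  define D where "D = Suc (Suc (\<Sum>h\<in>S. sum_list (map snd (expand T h))))"
  have D: "snd p < D" if "h \<in> S" "p \<in> set (expand T h)" for h p
  proof -
    have "snd p \<le> sum_list (map snd (expand T h))" using that(2) by (intro member_le_sum_list) auto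
    also have "\<dots> \<le> (\<Sum>h\<in>S. sum_list (map snd (expand T h)))"
      using S(1) that(1) by (intro member_le_sum) auto
    finally show ?thesis by (simp add: D_def)
  qed
  have dD: "d a < D" if "a < N" for a
    unfolding d_def using D[OF h0(1), of "L ! a"] that LN by (simp add: L_def)
  let ?S1 = "{h \<in> S. ?l h = N}"
  define R where "R = (\<Sum>h\<in>?S1. Polynomial.smult (b h) (PV D (expand T h) {..<N}))"
  \<comment> \<open>For \<open>\<tau> > 1\<close> the positions \<open>\<tau>^(D^a)\<close> are
    distinct. Infinitely many such \<tau> then force \<open>R = 0\<close>.\<close>
  have "poly R \<tau> = 0" if \<tau>: "\<tau> > 1" for \<tau>
  proof -
    interpret chains T N ws "\<lambda>a. \<tau> ^ (D ^ a)"
    proof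
      show "\<tau> ^ D ^ a \<noteq> \<tau> ^ D ^ b" if "a \<noteq> b" for a b
      proof -
        have "D ^ a \<noteq> D ^ b" using that power_inject_exp[of D a b] by (simp add: D_def)
        then show ?thesis using \<tau> power_inject_exp[of \<tau>] by simp
      qed
    qed
    let ?u = "\<lambda>a. \<tau> ^ (D ^ a)"
    let ?v = "\<lambda>h. Cv (map (\<lambda>p. E0 ?u (rvec T \<delta> p)) (expand T h)) (full {..<N})"
    have "(\<Sum>h\<in>S. b h * E 0 (root_mono T \<delta> (expand T h)) (full {..<N})) = 0"
      unfolding b_def by (rule lowest_coefficient_vanishes[OF T S(1) ideal' low])
    then have "0 = (\<Sum>h\<in>S. b h * ?v h)" unfolding E_0 E0_mono by simp
    also have "\<dots> = (\<Sum>h\<in>?S1. b h * ?v h)"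
    proof (rule sum.mono_neutral_right[OF S(1)])
      show "\<forall>h\<in>S - ?S1. b h * ?v h = 0"
      proof
        fix h assume h: "h \<in> S - ?S1"
        show "b h * ?v h = 0"
        proof (cases "b h = 0")
          case False
          then have "?l h < N" using maxN[of h] h by auto
          moreover have "card (fst ` full {..<N}) = N" using fst_full[of "{..<N}"] by simp
          moreover have "prim F" if "F \<in> set (map (\<lambda>p. E0 ?u (rvec T \<delta> p)) (expand T h))" for F
            using that E0_prim[OF \<delta>] setex[of h] h by auto
          ultimately have "?v h = 0" using full_PP[of "{..<N}"] by (intro Cv_few) auto
          then show ?thesis by simp
        qed simp
      qed
    qed auto
    also have "\<dots> = (\<Sum>h\<in>?S1. b h * poly (PV D (expand T h) {..<N}) \<tau>)"
      using setex by (intro sum.cong refl arg_cong2[of _ _ _ _ "(*)"] Cv_PV[OF \<delta>]) auto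
    finally show ?thesis by (simp add: R_def poly_sum)
  qed
  then have "{1<..} \<subseteq> {\<tau>. poly R \<tau> = 0}" by auto
  then have "R = 0" using poly_roots_finite[of R] infinite_Ioi[of "1::real"] finite_subset by blast
  have root: "fst p = \<beta>s a" if "h \<in> S" "p \<in> set (expand T h)" "a < N" "zroot (fst p) (ch a) \<noteq> 0" for h p a
  proof -
    have p: "fst p \<in> set (pos_roots T)" using setex[OF that(1)] that(2) by auto
    have "mset (fst p) = mset (\<beta>s a)"
      using zroot_content[OF \<delta> p that(4)] by (simp add: ws_def mset_cw)
    then show ?thesis using roots_mset_inj[OF T p \<beta>r[OF that(3)]] by blast
  qed
  have imL: "image_mset (\<lambda>a. (\<beta>s a, d a)) (mset_set {..<N}) = mset L"
  proof -
    have "(\<lambda>a. (\<beta>s a, d a)) = (!) L" by (simp add: \<beta>s_def d_def fun_eq_iff)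
    then show ?thesis using LN by (metis atLeast0LessThan map_nth mset_map mset_upt)
  qed
  have "0 = Polynomial.coeff R (\<Sum>a<N. d a * D ^ a)" using \<open>R = 0\<close> by simp
  also have "\<dots> = (\<Sum>h\<in>?S1. b h * KV d (expand T h) {..<N})"
  proof -
    have "Polynomial.coeff (PV D (expand T h) {..<N}) (\<Sum>a<N. d a * D ^ a) = KV d (expand T h) {..<N}"
      if "h \<in> ?S1" for h
      using that D dD by (intro PV_coeff) auto
    then show ?thesis unfolding R_def coeff_sum coeff_smult by (intro sum.cong refl) simp
  qed
  \<comment> \<open>A nonzero \<open>KV\<close> forces the multiset of factors to be that of
    \<open>L\<close>, hence the exponents to be those of \<open>h0\<close>.\<close>
  also have "\<dots> = (\<Sum>h\<in>{h0}. b h * KV d (expand T h) {..<N})"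
  proof (rule sum.mono_neutral_right)
    show "\<forall>h\<in>?S1 - {h0}. b h * KV d (expand T h) {..<N} = 0"
    proof (rule ballI, rule ccontr)
      fix h assume h: "h \<in> ?S1 - {h0}" and "b h * KV d (expand T h) {..<N} \<noteq> 0"
      then have "mset (expand T h) = mset L"
        unfolding imL[symmetric] using root[of h] by (intro KV_mset) auto
      then have "h p = h0 p" for p
      proof -
        have "h \<in> exponents T" "h0 \<in> exponents T" using h h0(1) S(2) by auto
        then show ?thesis
          using \<open>mset (expand T h) = mset L\<close> mset_expand[OF T, of h p] mset_expand[OF T, of h0 p]
          unfolding L_def by simp
      qed
      then show False using h by auto
    qed
  qed (use S(1) h0 in auto)
  finally have "KV d L {..<N} = 0" using h0(2) by (simp add: L_def)
  moreover have "\<exists>m>0. KV d L {..<N} = real m * (\<Prod>a\<in>{..<N}. zroot (\<beta>s a) (ch a))"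
    using root[OF h0(1)] unfolding L_def[symmetric] by (intro KV_value) (auto simp: imL)
  moreover have "(\<Prod>a\<in>{..<N}. zroot (\<beta>s a) (ch a)) \<noteq> 0"
    using zroot_nonzero[OF T \<beta>r] by (simp add: ws_def)
  ultimately show False by auto
qed

theorem theorem5p16:
  fixes T :: cartan_type
  assumes "T = G2 \<or> (\<exists>n \<ge> 2. T = B n)"
  shows "(\<forall>\<delta> \<delta>'. decomposition T \<delta> \<longrightarrow> decomposition T \<delta>' \<longrightarrow> dg_dual T \<delta> = dg_dual T \<delta>') \<and>
    (\<forall>\<delta>. decomposition T \<delta> \<longrightarrow>
      module_basis Q_hbar (yangian T\<lparr>carrier := dg_dual T \<delta>\<rparr>) (ordered_monomial T \<delta>) (exponents T))"
proof -
  have T: "valid T" using assms by (simp add: valid_def)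
  show ?thesis
  proof (intro conjI allI impI)
    fix \<delta> \<delta>' assume "decomposition T \<delta>" "decomposition T \<delta>'"
    then show "dg_dual T \<delta> = dg_dual T \<delta>'" by (simp only: dg_dual_rees[OF T])
  next
    fix \<delta> assume \<delta>: "decomposition T \<delta>"
    show "module_basis Q_hbar (yangian T\<lparr>carrier := dg_dual T \<delta>\<rparr>) (ordered_monomial T \<delta>) (exponents T)"
      by (rule basis_from_independence[OF T \<delta>], rule monomials_independent[OF T \<delta>])
  qed
qed

end
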